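(* Let $X=\Sigma_{\boldsymbol{a}}\times\mathbb{T}$, where $\Sigma_{\boldsymbol{a}}$ is the $\boldsymbol{a}$-adic solenoid, and let $\alpha_{ij}\in\mathrm{Aut}(X)$, where $i,j=1,2,3$. Let $\xi_j$, where $j=1,2,3$, be independent random variables with values in $X$ and distributions $\mu_j$ such that their characteristic functions do not vanish. Assume that the linear statistics $$L_1=\alpha_{11}\xi_1+\alpha_{12}\xi_2+\alpha_{13}\xi_3,\quad L_2=\alpha_{21}\xi_1+\alpha_{22}\xi_2+\alpha_{23}\xi_3,\quad L_3=\alpha_{31}\xi_1+\alpha_{32}\xi_2+\alpha_{33}\xi_3$$ are independent. Then all $\mu_j$ are either degenerate distributions or Gaussian distributions such that their supports are cosets of a subgroup of $X$ topologically isomorphic to $\Sigma_{\boldsymbol{a}}$.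
   Context: $\mathbb{T}=\{z\in\mathbb{C}:|z|=1\}$ is the circle group; the group operation of an Abelian group is written additively. The $\boldsymbol{a}$-adic solenoid: let $\boldsymbol{a}=(a_0,a_1,\dots)$ be a sequence of integers with all $a_j>1$. The group $\Delta_{\boldsymbol{a}}$ of $\boldsymbol{a}$-adic integers is the set $\prod_{n=0}^\infty\{0,1,\dots,a_n-1\}$ with the product topology and addition with carry: for $\boldsymbol{x}=(x_0,x_1,\dots)$, $\boldsymbol{y}=(y_0,y_1,\dots)$ the sum $\boldsymbol{z}=(z_0,z_1,\dots)$ is determined by $x_0+y_0=t_0a_0+z_0$ and inductively $x_{k+1}+y_{k+1}+t_k=t_{k+1}a_{k+1}+z_{k+1}$, with $z_k\in\{0,\dots,a_k-1\}$, $t_k\in\{0,1\}$. Let $\boldsymbol{u}=(1,0,0,\dots)\in\Delta_{\boldsymbol{a}}$ and $B=\{(n,n\boldsymbol{u}):n\in\mathbb{Z}\}\subset\mathbb{R}\times\Delta_{\boldsymbol{a}}$. Then $\Sigma_{\boldsymbol{a}}=(\mathbb{R}\times\Delta_{\boldsymbol{a}})/B$, a compact connected group of dimension one whose character group is isomorphic to the discrete group $\{m/(a_0a_1\cdots a_n): n=0,1,\dots;\ m\in\mathbb{Z}\}\subset\mathbb{Q}$. For a second countable locally compact Abelian group $X$, $Y$ denotes its character group, $(x,y)$ is the value of the character $y\in Y$ at $x\in X$, and $\mathrm{Aut}(X)$ is the group of topological automorphisms of $X$. The characteristic function of a probability distribution $\mu$ on $X$ is $\widehat\mu(y)=\int_X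 (x,y)\,d\mu(x)$, $y\in Y$. A distribution is degenerate if it is concentrated at one point. A probability distribution $\gamma$ on $X$ is called Gaussian if $\widehat\gamma(y)=(x,y)\exp\{-\varphi(y)\}$ for all $y\in Y$, where $x\in X$ is a fixed element and $\varphi$ is a continuous nonnegative function on $Y$ satisfying $\varphi(u+v)+\varphi(u-v)=2[\varphi(u)+\varphi(v)]$ for all $u,v\in Y$ (so degenerate distributions are Gaussian). *)

theory Defs
  imports "HOL-Probability.Probability" "HOL-Algebra.Coset"
begin

text \<open>
  A topological group is given by a HOL-Algebra group together with an abstract topology on its
  carrier. Abelian groups are written multiplicatively, following HOL-Algebra.
\<close>

definition topological_iso ::
  "('a, 'c) monoid_scheme \<Rightarrow> 'a topology \<Rightarrow> ('b, 'd) monoid_scheme \<Rightarrow> 'b topology \<Rightarrow> ('a \<Rightarrow> 'b) set"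
  where "topological_iso G S H T = {f \<in> iso G H. homeomorphic_map S T f}"

abbreviation topological_aut :: "('a, 'c) monoid_scheme \<Rightarrow> 'a topology \<Rightarrow> ('a \<Rightarrow> 'a) set"
  where "topological_aut G T \<equiv> topological_iso G T G T"

definition circle_group :: "complex monoid"
  where "circle_group = \<lparr>carrier = sphere 0 1, monoid.mult = (*), one = 1\<rparr>"

abbreviation circle_topology :: "complex topology"
  where "circle_topology \<equiv> top_of_set (sphere 0 1)"

text \<open>
  Characters are taken to be extensional, so that two characters agreeing on the carrier are equal.
\<close>

definition characters :: "('a, 'c) monoid_scheme \<Rightarrow> 'a topology \<Rightarrow> ('a \<Rightarrow> complex) set"
  where "characters G T =
    {y \<in> hom G circle_group. y \<in> extensional (carrier G) \<and> continuous_map T circle_topology y}"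

definition character_group :: "('a, 'c) monoid_scheme \<Rightarrow> 'a topology \<Rightarrow> ('a \<Rightarrow> complex) monoid"
  where "character_group G T =
    \<lparr>carrier = characters G T,
     monoid.mult = (\<lambda>y z. \<lambda>x\<in>carrier G. y x * z x),
     one = (\<lambda>x\<in>carrier G. 1)\<rparr>"

text \<open>The compact-open topology on the character group.\<close>

definition character_topology :: "('a, 'c) monoid_scheme \<Rightarrow> 'a topology \<Rightarrow> ('a \<Rightarrow> complex) topology"
  where "character_topology G T = topology_generated_by
    {{y \<in> characters G T. y ` K \<subseteq> U} | K U. compactin T K \<and> openin circle_topology U}"

definition borel_of :: "'a topology \<Rightarrow> 'a measure"
  where "borel_of T = sigma (topspace T) {U. openin T U}"

definition prob_distribution_on :: "'a topology \<Rightarrow> 'a measure \<Rightarrow> bool"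
  where "prob_distribution_on T \<mu> \<longleftrightarrow> prob_space \<mu> \<and> sets \<mu> = sets (borel_of T)"

definition char_function :: "'a measure \<Rightarrow> ('a \<Rightarrow> complex) \<Rightarrow> complex"
  where "char_function \<mu> y = (LINT x|\<mu>. y x)"

definition degenerate_distribution :: "'a topology \<Rightarrow> 'a measure \<Rightarrow> bool"
  where "degenerate_distribution T \<mu> \<longleftrightarrow>
    prob_distribution_on T \<mu> \<and> (\<exists>x\<in>topspace T. measure \<mu> {x} = 1)"

definition gaussian_distribution ::
  "('a, 'c) monoid_scheme \<Rightarrow> 'a topology \<Rightarrow> 'a measure \<Rightarrow> bool"
  where "gaussian_distribution G T \<gamma> \<longleftrightarrow>
    prob_distribution_on T \<gamma> \<and>
    (let Y = character_group G T in
      \<exists>x\<in>carrier G. \<exists>\<phi> :: ('a \<Rightarrow> complex) \<Rightarrow> real.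
        continuous_map (character_topology G T) euclideanreal \<phi> \<and>
        (\<forall>y\<in>carrier Y. 0 \<le> \<phi> y) \<and>
        (\<forall>u\<in>carrier Y. \<forall>v\<in>carrier Y.
           \<phi> (u \<otimes>\<^bsub>Y\<^esub> v) + \<phi> (u \<otimes>\<^bsub>Y\<^esub> inv\<^bsub>Y\<^esub> v) = 2 * (\<phi> u + \<phi> v)) \<and>
        (\<forall>y\<in>carrier Y. char_function \<gamma> y = y x * complex_of_real (exp (- \<phi> y))))"

definition measure_support :: "'a topology \<Rightarrow> 'a measure \<Rightarrow> 'a set"
  where "measure_support T \<mu> =
    {x \<in> topspace T. \<forall>U. openin T U \<and> x \<in> U \<longrightarrow> emeasure \<mu> U \<noteq> 0}"

definition quotient_topology :: "'a topology \<Rightarrow> ('a \<Rightarrow> 'b) \<Rightarrow> 'b topology"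
  where "quotient_topology T f =
    topology (\<lambda>U. U \<subseteq> f ` topspace T \<and> openin T {x \<in> topspace T. f x \<in> U})"

lemma openin_quotient_topology:
  fixes T :: "'a topology" and f :: "'a \<Rightarrow> 'b"
  shows "openin (quotient_topology T f) U \<longleftrightarrow>
    U \<subseteq> f ` topspace T \<and> openin T {x \<in> topspace T. f x \<in> U}"
proof -
  have "istopology (\<lambda>U. U \<subseteq> f ` topspace T \<and> openin T {x \<in> topspace T. f x \<in> U})"
    unfolding istopology_def
  proof (intro conjI allI impI; (elim conjE)?)
    fix U V
    assume "openin T {x \<in> topspace T. f x \<in> U}" "openin T {x \<in> topspace T. f x \<in> V}"
    then have "openin T ({x \<in> topspace T. f x \<in> U} \<inter> {x \<in> topspace T. f x \<in> V})"
      by blast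
    also have "{x \<in> topspace T. f x \<in> U} \<inter> {x \<in> topspace T. f x \<in> V} =
        {x \<in> topspace T. f x \<in> U \<inter> V}"
      by blast
    finally show "openin T {x \<in> topspace T. f x \<in> U \<inter> V}" .
  next
    fix \<K> :: "'b set set"
    assume *: "\<forall>K\<in>\<K>. K \<subseteq> f ` topspace T \<and> openin T {x \<in> topspace T. f x \<in> K}"
    then have "openin T (\<Union>K\<in>\<K>. {x \<in> topspace T. f x \<in> K})"
      by blast
    also have "(\<Union>K\<in>\<K>. {x \<in> topspace T. f x \<in> K}) = {x \<in> topspace T. f x \<in> \<Union>\<K>}"
      by blast
    finally show "openin T {x \<in> topspace T. f x \<in> \<Union>\<K>}" .
  qed blast+
  then show ?thesis
    by (simp add: quotient_topology_def topology_inverse')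
qed

lemma topspace_quotient_topology [simp]: "topspace (quotient_topology T f) = f ` topspace T"
proof -
  have "{x \<in> topspace T. f x \<in> f ` topspace T} = topspace T"
    by blast
  then have "openin (quotient_topology T f) (f ` topspace T)"
    by (simp add: openin_quotient_topology)
  then show ?thesis
    by (meson openin_quotient_topology openin_subset openin_topspace subset_antisym)
qed

lemma quotient_map_quotient_topology: "quotient_map T (quotient_topology T f) f"
  by (auto simp: quotient_map_def openin_quotient_topology)

definition real_group :: "real monoid"
  where "real_group = \<lparr>carrier = UNIV, monoid.mult = (+), one = 0\<rparr>"

fun adic_carry :: "(nat \<Rightarrow> int) \<Rightarrow> (nat \<Rightarrow> int) \<Rightarrow> (nat \<Rightarrow> int) \<Rightarrow> nat \<Rightarrow> int"
  where
    "adic_carry a x y 0 = (x 0 + y 0) div a 0"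
  | "adic_carry a x y (Suc k) = (x (Suc k) + y (Suc k) + adic_carry a x y k) div a (Suc k)"

fun adic_add :: "(nat \<Rightarrow> int) \<Rightarrow> (nat \<Rightarrow> int) \<Rightarrow> (nat \<Rightarrow> int) \<Rightarrow> nat \<Rightarrow> int"
  where
    "adic_add a x y 0 = (x 0 + y 0) mod a 0"
  | "adic_add a x y (Suc k) = (x (Suc k) + y (Suc k) + adic_carry a x y k) mod a (Suc k)"

definition adic_group :: "(nat \<Rightarrow> int) \<Rightarrow> (nat \<Rightarrow> int) monoid"
  where "adic_group a =
    \<lparr>carrier = (\<Pi>\<^sub>E n\<in>UNIV. {0..<a n}), monoid.mult = adic_add a, one = (\<lambda>_. 0)\<rparr>"

definition adic_topology :: "(nat \<Rightarrow> int) \<Rightarrow> (nat \<Rightarrow> int) topology"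
  where "adic_topology a = product_topology (\<lambda>n. discrete_topology {0..<a n}) UNIV"

definition adic_unit :: "nat \<Rightarrow> int"
  where "adic_unit = (\<lambda>n. if n = 0 then 1 else 0)"

definition solenoid_kernel :: "(nat \<Rightarrow> int) \<Rightarrow> (real \<times> (nat \<Rightarrow> int)) set"
  where "solenoid_kernel a =
    {(real_of_int n, adic_unit [^]\<^bsub>adic_group a\<^esub> n) | n :: int. True}"

definition solenoid_group :: "(nat \<Rightarrow> int) \<Rightarrow> (real \<times> (nat \<Rightarrow> int)) set monoid"
  where "solenoid_group a = (real_group \<times>\<times> adic_group a) Mod solenoid_kernel a"

definition solenoid_topology :: "(nat \<Rightarrow> int) \<Rightarrow> (real \<times> (nat \<Rightarrow> int)) set topology"
  where "solenoid_topology a =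
    quotient_topology (prod_topology euclideanreal (adic_topology a))
      (\<lambda>g. solenoid_kernel a #>\<^bsub>real_group \<times>\<times> adic_group a\<^esub> g)"

end

(*
  The character group of the solenoid times the circle is Y = H x Z, where H is the union of the
  groups (1 / A k) Z, A k = a 0 * ... * a (k - 1). The adjoint of an automorphism has the form
  (r, n) |-> (p r + c n, e n) with p H = H and e = 1 or e = -1, and independence of the statistics
  becomes a functional equation for the three characteristic functions f_j on Y. Krein's inequality
  |f (y + z) - f y f z|^2 <= (1 - |f y|^2) (1 - |f z|^2) is used to transport information from points
  where |f| is close to 1.

  If the matrix p is singular, a kernel vector shows that all |f_j| are 1 on a subgroup N H, hence
  periodic, and averaging the functional equation over H / N H kills -ln |f_j|. Otherwise all third
  differences of f_j along H vanish, so -ln |f_j| is a quadratic polynomial on each coset of N H;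
  averaging its minima shows that they are zero, and Krein's inequality then forces
  f_j (r, n) = l (r, n) exp (- s (r + t n)^2) with a homomorphism l. The cross terms of the
  functional equation make the rows of p orthogonal for the weights s_j; if t were irrational, they
  would be proportional to three sign vectors which are pairwise orthogonal for positive weights, and
  there are no such vectors. As t is rational, the annihilator of the kernel of (r, n) |-> r + t n is a
  copy of the solenoid.
*)
theory Submission
  imports Defs
begin

section \<open>The rational group dual to the solenoid\<close>

text \<open>\<open>H\<close> is not divisible and \<open>Y\<close> carries the discrete topology, so
  neither division nor continuity is available as on the real line. Division by a minor of
  \<open>p\<close> is possible only on a subgroup \<open>N H\<close>; this is why the intermediate
  results concern cosets of \<open>N H\<close> and why the finite quotient \<open>H / N H\<close>
  needs an argument of its own. Continuity is replaced by Krein's inequality: a sequence along which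
  |f| tends to 1 acts like a sequence tending to 0. Averaging over \<open>H / N H\<close> must also
  control the integer coordinate. By evenness a mean depends on \<open>n\<close> only up to sign,
  and signs \<open>s i\<close> can be chosen so that every column sum of \<open>e i j * s i\<close>
  is 1 or -1. The separate terms then have total mean three times that of the sums of the forms,
  which is impossible for nonnegative functions unless they vanish. Third differences vanish
  because, for invertible \<open>p\<close>, three shifts can be arranged so that every factor except
  one misses at least one of them; an alternating product over the vertices of a cube cancels such
  factors. The support of the Gaussian law is read off from an image of the normal distribution
  under a one-parameter subgroup.\<close>

definition adic_prod :: "(nat \<Rightarrow> int) \<Rightarrow> nat \<Rightarrow> int"
  where "adic_prod a k = (\<Prod>i<k. a i)"

definition adic_rationals :: "(nat \<Rightarrow> int) \<Rightarrow> real set"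
  where "adic_rationals a = {of_int m / of_int (adic_prod a k) | m k. True}"

locale adic_base =
  fixes a :: "nat \<Rightarrow> int"
  assumes a_gt_1: "\<And>n. a n > 1"
begin

abbreviation A :: "nat \<Rightarrow> int" where "A \<equiv> adic_prod a"
abbreviation H :: "real set" where "H \<equiv> adic_rationals a"

lemma A_0 [simp]: "A 0 = 1"
  by (simp add: adic_prod_def)

lemma A_Suc: "A (Suc k) = A k * a k"
  by (simp add: adic_prod_def mult.commute)

lemma A_ge: "int k < A k"
proof (induction k)
  case (Suc k)
  have "2 \<le> a k" using a_gt_1[of k] by linarith
  then have "A k * 2 \<le> A k * a k" using Suc by (intro mult_left_mono) auto
  then have "A k * 2 \<le> A (Suc k)" by (simp add: A_Suc)
  then show ?case using Suc by linarith
qed simp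

lemma A_pos [simp]: "0 < A k"
  using A_ge[of k] by linarith

lemma A_nonzero [simp]: "A k \<noteq> 0"
  using A_pos[of k] by linarith

lemma A_dvd: "j \<le> k \<Longrightarrow> A j dvd A k"
  by (induction k rule: dec_induct) (auto simp: A_Suc)

lemma adic_rationals_denominator:
  assumes "x \<in> H"
  shows "\<exists>k0. \<forall>k\<ge>k0. \<exists>m. x = of_int m / of_int (A k)"
proof -
  obtain m k0 where x: "x = of_int m / of_int (A k0)"
    using assms by (auto simp: adic_rationals_def)
  have "\<exists>m'. x = of_int m' / of_int (A k)" if k: "k \<ge> k0" for k
  proof -
    obtain q where q: "A k = A k0 * q" using A_dvd[OF k] by (auto elim: dvdE)
    then have "q \<noteq> 0" using A_nonzero[of k] by auto
    then have "x = of_int (m * q) / of_int (A k)" by (simp add: x q)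
    then show ?thesis by blast
  qed
  then show ?thesis by blast
qed

lemma H_I: "of_int m / of_int (A k) \<in> H"
  by (auto simp: adic_rationals_def)

text \<open>The \<open>A k\<close> form a divisibility chain, so every sufficiently late
  \<open>A k\<close> is a denominator of a given element. Questions about finitely many elements of
  \<open>H\<close> thereby become questions about integers.\<close>

lemma adic_rationals_common_denominator:
  assumes "finite S" "S \<subseteq> H"
  shows "\<exists>k. \<forall>x\<in>S. \<exists>m. x = of_int m / of_int (A k)"
proof -
  have "\<forall>x\<in>S. \<exists>k0. \<forall>k\<ge>k0. \<exists>m. x = of_int m / of_int (A k)"
    using assms adic_rationals_denominator by blast
  then obtain f where f: "\<And>x k. x \<in> S \<Longrightarrow> k \<ge> f x \<Longrightarrow> \<exists>m. x = of_int m / of_int (A k)"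
    by metis
  have "\<forall>x\<in>S. f x \<le> Max (insert 0 (f ` S))" using assms by auto
  then show ?thesis using f by blast
qed

lemma H_add: assumes "x \<in> H" "y \<in> H" shows "x + y \<in> H"
proof -
  obtain k where "\<forall>z\<in>{x, y}. \<exists>m. z = of_int m / of_int (A k)"
    using adic_rationals_common_denominator[of "{x, y}"] assms by auto
  then obtain m m' where "x = of_int m / of_int (A k)" "y = of_int m' / of_int (A k)" by blast
  then have "x + y = of_int (m + m') / of_int (A k)" by (simp add: add_divide_distrib)
  then show ?thesis using H_I by metis
qed

lemma H_mult: assumes "x \<in> H" shows "of_int m * x \<in> H"
proof -
  obtain m' k where "x = of_int m' / of_int (A k)" using assms by (auto simp: adic_rationals_def)
  then have "of_int m * x = of_int (m * m') / of_int (A k)" by simp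
  then show ?thesis using H_I by metis
qed

lemma H_minus: "x \<in> H \<Longrightarrow> - x \<in> H"
  using H_mult[of x "-1"] by simp

lemma H_diff: "x \<in> H \<Longrightarrow> y \<in> H \<Longrightarrow> x - y \<in> H"
  using H_add[of x "- y"] H_minus[of y] by simp

lemma H_of_int [simp]: "of_int m \<in> H"
  using H_I[of m 0] by simp

lemma H_0 [simp]: "0 \<in> H" and H_1 [simp]: "1 \<in> H"
  using H_of_int[of 0] H_of_int[of 1] by simp_all

lemma H_Rats: "x \<in> H \<Longrightarrow> x \<in> \<rat>"
  by (auto simp: adic_rationals_def)

lemma H_dense:
  assumes "d \<noteq> 0" "\<epsilon> > 0"
  shows "\<exists>h\<in>H. \<bar>d * h - x\<bar> < \<epsilon>"
proof -
  obtain k :: nat where k: "\<bar>d\<bar> / \<epsilon> < real k" using reals_Archimedean2 by blast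
  have Ak: "real k < of_int (A k)" using A_ge[of k] by linarith
  \<comment> \<open>Rounding \<open>x / d\<close> down to the grid of mesh \<open>1 / A k\<close>
    costs at most \<open>1 / A k\<close>, and \<open>k\<close> was chosen so that \<open>A k\<close>
    exceeds \<bar>d\<bar> / \<epsilon>.\<close>
  define h :: real where "h = of_int \<lfloor>x / d * of_int (A k)\<rfloor> / of_int (A k)"
  have "\<bar>of_int \<lfloor>x / d * of_int (A k)\<rfloor> - x / d * of_int (A k)\<bar> \<le> 1" by linarith
  moreover have "(h - x / d) * of_int (A k) = of_int \<lfloor>x / d * of_int (A k)\<rfloor> - x / d * of_int (A k)"
    by (simp add: h_def field_simps)
  ultimately have 1: "\<bar>h - x / d\<bar> * of_int (A k) \<le> 1" by (metis A_pos abs_mult abs_of_pos of_int_0_less_iff)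
  have "d * h - x = d * (h - x / d)" using assms by (simp add: field_simps)
  then have "\<bar>d * h - x\<bar> * of_int (A k) = \<bar>d\<bar> * (\<bar>h - x / d\<bar> * of_int (A k))"
    by (simp add: abs_mult)
  also have "\<dots> \<le> \<bar>d\<bar> * 1" using 1 by (intro mult_left_mono) auto
  also have "\<dots> < \<epsilon> * of_int (A k)" using k Ak assms by (simp add: field_simps) (smt (verit) mult_less_cancel_left_pos)
  finally have "\<bar>d * h - x\<bar> < \<epsilon>" by (simp add: mult_less_cancel_right_pos)
  then show ?thesis using H_I h_def by blast
qed

lemma H_multiple_dense:
  assumes "d \<noteq> 0" "N > (0::int)" "\<epsilon> > 0"
  shows "\<exists>x. x / of_int N \<in> H \<and> \<bar>d * x - r\<bar> < \<epsilon>"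
proof -
  obtain h where "h \<in> H" "\<bar>(d * of_int N) * h - r\<bar> < \<epsilon>"
    using H_dense[of "d * of_int N" \<epsilon> r] assms by auto
  then show ?thesis using assms by (intro exI[of _ "of_int N * h"]) (auto simp: mult.assoc)
qed

lemma H_multiple_subset: assumes "N > (0::int)" "x / of_int N \<in> H" shows "x \<in> H"
  using H_mult[OF assms(2), of N] assms(1) by simp

text \<open>Over a common denominator, elements whose numerators agree modulo \<open>N\<close>
  differ by an element of \<open>N H\<close>; so pairwise incongruent elements number at most
  \<open>N\<close>. A set of them of largest size cannot be enlarged and is therefore a transversal
  of \<open>H / N H\<close>.\<close>

lemma finite_representatives:
  assumes N: "N > (0::int)"
  shows "\<exists>R. finite R \<and> R \<subseteq> H \<and> R \<noteq> {} \<and> (\<forall>h\<in>H. \<exists>r\<in>R. (h - r) / of_int N \<in> H)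
    \<and> (\<forall>r\<in>R. \<forall>s\<in>R. (r - s) / of_int N \<in> H \<longrightarrow> r = s)"
proof -
  define Q where "Q S \<longleftrightarrow> finite S \<and> S \<subseteq> H \<and> (\<forall>r\<in>S. \<forall>s\<in>S. (r - s) / of_int N \<in> H \<longrightarrow> r = s)" for S
  have bound: "card S \<le> nat N" if "Q S" for S
  proof -
    have S: "finite S" "S \<subseteq> H" "\<And>r s. r \<in> S \<Longrightarrow> s \<in> S \<Longrightarrow> (r - s) / of_int N \<in> H \<Longrightarrow> r = s"
      using that by (auto simp: Q_def)
    obtain k where "\<forall>x\<in>S. \<exists>m. x = of_int m / of_int (A k)"
      using adic_rationals_common_denominator[OF S(1,2)] by blast
    then obtain m where m: "\<And>x. x \<in> S \<Longrightarrow> x = of_int (m x) / of_int (A k)" by metis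
    have "inj_on (\<lambda>x. m x mod N) S"
    proof (rule inj_onI)
      fix x y assume xy: "x \<in> S" "y \<in> S" "m x mod N = m y mod N"
      then obtain q where q: "m x - m y = N * q" by (metis mod_eq_dvd_iff dvdE)
      have "x - y = of_int (m x - m y) / of_int (A k)" using m[OF xy(1)] m[OF xy(2)]
        by (metis diff_divide_distrib of_int_diff)
      also have "\<dots> = of_int N * (of_int q / of_int (A k))" by (simp add: q)
      finally have "(x - y) / of_int N = of_int q / of_int (A k)" using N by simp
      then show "x = y" using S(3)[OF xy(1,2)] H_I by metis
    qed
    moreover have "(\<lambda>x. m x mod N) ` S \<subseteq> {0..<N}" using N by auto
    ultimately have "card S \<le> card {0..<N}" by (intro card_inj_on_le) auto
    then show ?thesis by simp
  qed
  have "\<exists>S. Q S \<and> (\<forall>T. Q T \<longrightarrow> card T \<le> card S)"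
  proof -
    have "Q {}" by (simp add: Q_def)
    moreover have "\<forall>T. Q T \<longrightarrow> card T < Suc (nat N)" using bound by (simp add: less_Suc_eq_le)
    ultimately show ?thesis by (metis ex_has_greatest_nat bound)
  qed
  then obtain R where R: "Q R" "\<And>T. Q T \<Longrightarrow> card T \<le> card R" by blast
  have covers: "\<exists>r\<in>R. (h - r) / of_int N \<in> H" if h: "h \<in> H" for h
  proof (rule ccontr)
    assume no: "\<not> (\<exists>r\<in>R. (h - r) / of_int N \<in> H)"
    then have "h \<notin> R" by force
    moreover have "Q (insert h R)"
      unfolding Q_def
    proof (intro conjI ballI impI)
      fix r s assume rs: "r \<in> insert h R" "s \<in> insert h R" "(r - s) / of_int N \<in> H"
      have "(s - r) / of_int N \<in> H" using H_minus[OF rs(3)] by (simp add: minus_divide_left)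
      then show "r = s" using rs no R(1) unfolding Q_def by blast
    next
      show "finite (insert h R)" "insert h R \<subseteq> H" using R(1) h by (auto simp: Q_def)
    qed
    ultimately show False using R(2)[of "insert h R"] R(1) by (auto simp: Q_def)
  qed
  moreover have "R \<noteq> {}" using covers[of 0] by auto
  ultimately show ?thesis using R(1) unfolding Q_def by blast
qed

definition periodic_on_H :: "int \<Rightarrow> (real \<Rightarrow> real) \<Rightarrow> bool"
  where "periodic_on_H N g \<longleftrightarrow> (\<forall>x\<in>H. \<forall>d. d / of_int N \<in> H \<longrightarrow> g (x + d) = g x)"

text \<open>Multiplication by \<open>p\<close> is an automorphism of \<open>H\<close>, so the affine
  map permutes the finite quotient \<open>H / N H\<close>, and a periodic function has the same sum
  before and after. \<open>\<rho>\<close> sends an element to its representative.\<close>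

lemma sum_representatives_affine:
  assumes N: "N > 0" and R: "finite R" "R \<subseteq> H"
    and cover: "\<And>h. h \<in> H \<Longrightarrow> \<exists>r\<in>R. (h - r) / of_int N \<in> H"
    and unique: "\<And>r s. r \<in> R \<Longrightarrow> s \<in> R \<Longrightarrow> (r - s) / of_int N \<in> H \<Longrightarrow> r = s"
    and g: "periodic_on_H N g" and p: "p \<noteq> 0" "(\<lambda>x. p * x) ` H = H" and c: "c \<in> H"
  shows "(\<Sum>r\<in>R. g (p * r + c)) = sum g R"
proof -
  obtain \<rho> where \<rho>: "\<And>h. h \<in> H \<Longrightarrow> \<rho> h \<in> R \<and> (h - \<rho> h) / of_int N \<in> H"
    using cover by metis
  have pH: "p * x \<in> H" if "x \<in> H" for x using p that by auto
  have pH': "x \<in> H" if "p * x \<in> H" for x using p that by (metis (no_types, lifting) imageE mult_left_cancel)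
  have in_H: "p * r + c \<in> H" if "r \<in> R" for r using that R pH c by (auto intro: H_add)
  have "inj_on (\<lambda>r. \<rho> (p * r + c)) R"
  proof (rule inj_onI)
    fix r s assume rs: "r \<in> R" "s \<in> R" "\<rho> (p * r + c) = \<rho> (p * s + c)"
    have "((p * r + c) - \<rho> (p * r + c)) / of_int N - ((p * s + c) - \<rho> (p * s + c)) / of_int N \<in> H"
      by (intro H_diff conjunct2[OF \<rho>] in_H rs(1,2))
    also have "((p * r + c) - \<rho> (p * r + c)) / of_int N - ((p * s + c) - \<rho> (p * s + c)) / of_int N
      = p * ((r - s) / of_int N)" using rs(3) N by (simp add: field_simps)
    finally show "r = s" using pH' unique rs by blast
  qed
  then have "bij_betw (\<lambda>r. \<rho> (p * r + c)) R R"
    using \<rho> in_H R(1) by (simp add: bij_betw_def endo_inj_surj image_subsetI)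
  moreover have "g (p * r + c) = g (\<rho> (p * r + c))" if "r \<in> R" for r
  proof -
    have "g (\<rho> (p * r + c) + ((p * r + c) - \<rho> (p * r + c))) = g (\<rho> (p * r + c))"
      using g \<rho>[OF in_H[OF that]] R unfolding periodic_on_H_def by blast
    then show ?thesis by simp
  qed
  ultimately show ?thesis
    using sum.reindex_bij_betw[of "\<lambda>r. \<rho> (p * r + c)" R R g] by simp
qed

end

section \<open>A single characteristic function with vanishing third differences\<close>

context adic_base
begin

section \<open>Additive and quadratic functions on \<open>N H\<close>, and Krein's
  inequality\<close>

definition H_multiples :: "int \<Rightarrow> real set"
  where "H_multiples N = {x. x / of_int N \<in> H}"

abbreviation Y :: "(real \<times> int) set" where "Y \<equiv> H \<times> UNIV"

lemma zero_Y: "(0 :: real \<times> int) \<in> Y"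
  by (simp add: zero_prod_def)

lemma Y_add: "y \<in> Y \<Longrightarrow> z \<in> Y \<Longrightarrow> y + z \<in> Y"
  by (auto intro: H_add)

lemma Y_minus: "y \<in> Y \<Longrightarrow> - y \<in> Y"
  by (auto intro: H_minus)

lemma H_multiples_add: "x \<in> H_multiples N \<Longrightarrow> y \<in> H_multiples N \<Longrightarrow> x + y \<in> H_multiples N"
  by (auto simp: H_multiples_def add_divide_distrib intro: H_add)

lemma H_multiples_minus: "x \<in> H_multiples N \<Longrightarrow> - x \<in> H_multiples N"
  by (auto simp: H_multiples_def dest: H_minus)

lemma H_multiples_mult: "x \<in> H_multiples N \<Longrightarrow> of_int m * x \<in> H_multiples N"
  using H_mult[of "x / of_int N" m] by (simp add: H_multiples_def)

lemma H_multiples_0 [simp]: "0 \<in> H_multiples N"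
  by (simp add: H_multiples_def)

lemma H_multiples_self: "N > 0 \<Longrightarrow> of_int N \<in> H_multiples N"
  by (simp add: H_multiples_def)

lemma H_multiples_subset: "N > 0 \<Longrightarrow> x \<in> H_multiples N \<Longrightarrow> x \<in> H"
  using H_multiple_subset by (auto simp: H_multiples_def)

text \<open>No regularity is involved: \<open>N H\<close> has rank one, so some positive multiple
  \<open>A k * x\<close> is an integer multiple of \<open>N\<close>, and the reals are
  torsion-free.\<close>

lemma additive_on_H_multiples:
  fixes L :: "real \<Rightarrow> real"
  assumes N: "N > 0"
    and add: "\<And>x y. x \<in> H_multiples N \<Longrightarrow> y \<in> H_multiples N \<Longrightarrow> L (x + y) = L x + L y"
    and x: "x \<in> H_multiples N"
  shows "L x = L (of_int N) / of_int N * x"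
proof -
  have L0: "L 0 = 0" using add[of 0 0] by simp
  have nat: "L (of_nat n * u) = of_nat n * L u" if "u \<in> H_multiples N" for n u
  proof (induction n)
    case (Suc n)
    have "L (of_nat n * u + u) = L (of_nat n * u) + L u"
      using H_multiples_mult[OF that, of "int n"] that by (intro add) auto
    then show ?case using Suc by (simp add: algebra_simps)
  qed (simp add: L0)
  have int: "L (of_int m * u) = of_int m * L u" if u: "u \<in> H_multiples N" for m u
  proof (cases "m \<ge> 0")
    case True
    then show ?thesis using nat[OF u, of "nat m"] by simp
  next
    case False
    have "L (of_int m * u + of_nat (nat (- m)) * u) = L (of_int m * u) + L (of_nat (nat (- m)) * u)"
      using H_multiples_mult[OF u, of m] H_multiples_mult[OF u, of "- m"] False by (intro add) auto
    then show ?thesis using nat[OF u, of "nat (- m)"] False L0 by (simp add: algebra_simps)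
  qed
  obtain m k where mk: "x / of_int N = of_int m / of_int (A k)"
    using x by (auto simp: H_multiples_def adic_rationals_def)
  then have "of_int (A k) * x = of_int m * of_int N" using N by (simp add: field_simps)
  then have "of_int (A k) * L x = of_int m * L (of_int N)"
    using int[OF x, of "A k"] int[OF H_multiples_self[OF N], of m] by metis
  then have "L x = of_int m / of_int (A k) * L (of_int N)" by (simp add: field_simps)
  then show ?thesis using N by (simp add: mk[symmetric])
qed

text \<open>The hypothesis says that the second difference \<open>S\<close> is additive in each
  variable, hence equals \<open>2 * c * x * y\<close>. Subtracting \<open>c\<close> times the square
  leaves an additive function, which is linear.\<close>

lemma quadratic_on_H_multiples:
  fixes g :: "real \<Rightarrow> real"
  assumes N: "N > 0" and g0: "g 0 = 0"
    and third: "\<And>x y z. x \<in> H_multiples N \<Longrightarrow> y \<in> H_multiples N \<Longrightarrow> z \<in> H_multiples N \<Longrightarrow>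
      g (x + y + z) + g x + g y + g z = g (x + y) + g (x + z) + g (y + z)"
  shows "\<exists>b c. \<forall>x\<in>H_multiples N. g x = b * x + c * x\<^sup>2"
proof -
  define S where "S y x = g (x + y) - g x - g y" for x y
  have S: "S y x = S y (of_int N) / of_int N * x" if "x \<in> H_multiples N" "y \<in> H_multiples N" for x y
  proof (rule additive_on_H_multiples[OF N])
    show "S y (u + v) = S y u + S y v" if "u \<in> H_multiples N" "v \<in> H_multiples N" for u v
      using third[OF that \<open>y \<in> H_multiples N\<close>] by (simp add: S_def)
  qed (use that in auto)
  have sym: "S y x = S x y" for x y by (simp add: S_def add.commute)
  define c where "c = S (of_int N) (of_int N) / (2 * (of_int N)\<^sup>2)"
  have Sc: "S y x = 2 * c * x * y" if "x \<in> H_multiples N" "y \<in> H_multiples N" for x y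
  proof -
    have "S y (of_int N) = S (of_int N) (of_int N) / of_int N * y"
      using S[OF that(2) H_multiples_self[OF N]] sym by metis
    then show ?thesis using S[OF that] N by (simp add: c_def power2_eq_square)
  qed
  define L where "L x = g x - c * x\<^sup>2" for x
  have "L x = L (of_int N) / of_int N * x" if "x \<in> H_multiples N" for x
  proof (rule additive_on_H_multiples[OF N _ that])
    show "L (u + v) = L u + L v" if "u \<in> H_multiples N" "v \<in> H_multiples N" for u v
      using Sc[OF that] by (simp add: L_def S_def power2_eq_square algebra_simps)
  qed
  then have "g x = L (of_int N) / of_int N * x + c * x\<^sup>2" if "x \<in> H_multiples N" for x
    using that unfolding L_def by (metis diff_add_cancel)
  then show ?thesis by blast
qed

text \<open>The last condition is Krein's inequality for positive definite functions.\<close>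

definition char_like :: "(real \<times> int \<Rightarrow> complex) \<Rightarrow> bool"
  where "char_like f \<longleftrightarrow> f 0 = 1 \<and> (\<forall>y\<in>Y. f (- y) = cnj (f y)) \<and> (\<forall>y\<in>Y. f y \<noteq> 0) \<and>
    (\<forall>y\<in>Y. cmod (f y) \<le> 1) \<and>
    (\<forall>y\<in>Y. \<forall>z\<in>Y. (cmod (f (y + z) - f y * f z))\<^sup>2 \<le> (1 - (cmod (f y))\<^sup>2) * (1 - (cmod (f z))\<^sup>2))"

lemma char_likeD:
  assumes "char_like f"
  shows char_like_zero: "f 0 = 1"
    and char_like_cnj: "y \<in> Y \<Longrightarrow> f (- y) = cnj (f y)"
    and char_like_nonzero: "y \<in> Y \<Longrightarrow> f y \<noteq> 0"
    and char_like_le_one: "y \<in> Y \<Longrightarrow> cmod (f y) \<le> 1"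
    and char_like_krein: "y \<in> Y \<Longrightarrow> z \<in> Y \<Longrightarrow>
      (cmod (f (y + z) - f y * f z))\<^sup>2 \<le> (1 - (cmod (f y))\<^sup>2) * (1 - (cmod (f z))\<^sup>2)"
  using assms unfolding char_like_def by blast+

text \<open>When |f| tends to 1 along \<open>y k\<close>, the right side of Krein's inequality tends
  to 0 whatever \<open>z k\<close> is. This uniformity in \<open>z k\<close> is the substitute for
  continuity used throughout.\<close>

lemma char_like_near_one:
  assumes f: "char_like f" and y: "\<And>k. y k \<in> Y" and z: "\<And>k. z k \<in> Y"
    and lim: "(\<lambda>k. cmod (f (y k))) \<longlonglongrightarrow> 1"
  shows "(\<lambda>k. f (y k + z k) - f (y k) * f (z k)) \<longlonglongrightarrow> 0"
proof -
  have bound: "cmod (f (y k + z k) - f (y k) * f (z k)) \<le> sqrt (1 - (cmod (f (y k)))\<^sup>2)" for k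
  proof (rule real_le_rsqrt)
    have 1: "cmod (f (y k)) \<le> 1" "cmod (f (z k)) \<le> 1"
      "(cmod (f (y k + z k) - f (y k) * f (z k)))\<^sup>2 \<le> (1 - (cmod (f (y k)))\<^sup>2) * (1 - (cmod (f (z k)))\<^sup>2)"
      using char_likeD[OF f] y z by blast+
    have "(1 - (cmod (f (y k)))\<^sup>2) * (1 - (cmod (f (z k)))\<^sup>2) \<le> (1 - (cmod (f (y k)))\<^sup>2) * 1"
      using 1(1) by (intro mult_left_mono) (auto simp: power_le_one)
    then show "(cmod (f (y k + z k) - f (y k) * f (z k)))\<^sup>2 \<le> 1 - (cmod (f (y k)))\<^sup>2"
      using 1 by simp
  qed
  have "(\<lambda>k. sqrt (1 - (cmod (f (y k)))\<^sup>2)) \<longlonglongrightarrow> sqrt (1 - 1\<^sup>2)"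
    by (intro tendsto_intros lim)
  then have "(\<lambda>k. sqrt (1 - (cmod (f (y k)))\<^sup>2)) \<longlonglongrightarrow> 0" by simp
  then show ?thesis by (rule Lim_null_comparison[rotated]) (use bound in auto)
qed

lemma char_like_near_one_norm:
  assumes f: "char_like f" and y: "\<And>k. y k \<in> Y" and z: "\<And>k. z k \<in> Y"
    and lim: "(\<lambda>k. cmod (f (y k))) \<longlonglongrightarrow> 1" and lim': "(\<lambda>k. cmod (f (z k))) \<longlonglongrightarrow> c"
  shows "(\<lambda>k. cmod (f (y k + z k))) \<longlonglongrightarrow> c"
proof -
  have "(\<lambda>k. cmod (f (y k + z k)) - cmod (f (y k)) * cmod (f (z k))) \<longlonglongrightarrow> 0"
  proof (rule Lim_null_comparison[OF _ tendsto_norm_zero[OF char_like_near_one[OF f y z lim]]])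
    show "\<forall>\<^sub>F k in sequentially. norm (cmod (f (y k + z k)) - cmod (f (y k)) * cmod (f (z k)))
        \<le> norm (f (y k + z k) - f (y k) * f (z k))"
      using norm_triangle_ineq3 by (auto simp: norm_mult[symmetric] intro!: always_eventually)
  qed
  moreover have "(\<lambda>k. cmod (f (y k)) * cmod (f (z k))) \<longlonglongrightarrow> 1 * c" by (intro tendsto_intros lim lim')
  ultimately have "(\<lambda>k. (cmod (f (y k + z k)) - cmod (f (y k)) * cmod (f (z k)))
      + cmod (f (y k)) * cmod (f (z k))) \<longlonglongrightarrow> 0 + 1 * c" by (rule tendsto_add)
  then show ?thesis by simp
qed

text \<open>The limiting case of Krein's inequality, in which the right side is 0.\<close>

lemma char_like_periodic:
  assumes f: "char_like f" and "y \<in> Y" "z \<in> Y" "cmod (f z) = 1"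
  shows "f (y + z) = f y * f z"
proof -
  have "(cmod (f (y + z) - f y * f z))\<^sup>2 \<le> (1 - (cmod (f y))\<^sup>2) * (1 - (cmod (f z))\<^sup>2)"
    using char_like_krein[OF f] assms by blast
  then show ?thesis using assms(4) by simp
qed

end

text \<open>The vanishing of the third differences of log f in the \<open>H\<close> direction,
  written as an equality of products so that no branch of the complex logarithm has to be chosen. It
  holds for the modulus and for the phase separately.\<close>

locale third_difference_free = adic_base +
  fixes N :: int and f :: "real \<times> int \<Rightarrow> complex"
  assumes N_pos: "N > 0"
    and f: "char_like f"
    and third_difference: "\<And>y x1 x2 x3. y \<in> Y \<Longrightarrow> x1 \<in> H_multiples N \<Longrightarrow> x2 \<in> H_multiples N \<Longrightarrow> x3 \<in> H \<Longrightarrow>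
      f (y + (x1 + x2 + x3, 0)) * f (y + (x1, 0)) * f (y + (x2, 0)) * f (y + (x3, 0)) =
      f (y + (x1 + x2, 0)) * f (y + (x1 + x3, 0)) * f (y + (x2 + x3, 0)) * f y"
begin

abbreviation D :: "real set" where "D \<equiv> H_multiples N"

lemma D_H: "x \<in> D \<Longrightarrow> x \<in> H"
  using H_multiples_subset N_pos by blast

lemma Y_shift: "y \<in> Y \<Longrightarrow> x \<in> D \<Longrightarrow> y + (x, 0) \<in> Y"
  using D_H by (intro Y_add) auto

lemma D_Y: "x \<in> D \<Longrightarrow> (x, n) \<in> Y"
  using D_H by auto

lemma f_nonzero: "y \<in> Y \<Longrightarrow> f y \<noteq> 0"
  using char_like_nonzero[OF f] .

definition \<psi> :: "real \<times> int \<Rightarrow> real" where "\<psi> y = - ln (cmod (f y))"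

lemma norm_f: "y \<in> Y \<Longrightarrow> cmod (f y) = exp (- \<psi> y)"
  using f_nonzero by (simp add: \<psi>_def)

lemma psi_nonneg: "y \<in> Y \<Longrightarrow> \<psi> y \<ge> 0"
  using char_like_le_one[OF f, of y] f_nonzero[of y] by (simp add: \<psi>_def)

lemma psi_third_difference:
  assumes "y \<in> Y" "x1 \<in> D" "x2 \<in> D" "x3 \<in> H"
  shows "\<psi> (y + (x1 + x2 + x3, 0)) + \<psi> (y + (x1, 0)) + \<psi> (y + (x2, 0)) + \<psi> (y + (x3, 0)) =
      \<psi> (y + (x1 + x2, 0)) + \<psi> (y + (x1 + x3, 0)) + \<psi> (y + (x2 + x3, 0)) + \<psi> y"
proof -
  have Y: "y + (x, 0) \<in> Y" if "x \<in> H" for x using assms(1) that by (intro Y_add) auto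
  have nz: "f (y + (x, 0)) \<noteq> 0" if "x \<in> H" for x using f_nonzero[OF Y[OF that]] .
  have "ln (cmod (f (y + (x1 + x2 + x3, 0)) * f (y + (x1, 0)) * f (y + (x2, 0)) * f (y + (x3, 0)))) =
      ln (cmod (f (y + (x1 + x2, 0)) * f (y + (x1 + x3, 0)) * f (y + (x2 + x3, 0)) * f y))"
    using third_difference[OF assms] by simp
  then show ?thesis using nz f_nonzero[OF assms(1)] assms D_H
    by (simp add: norm_mult ln_mult \<psi>_def H_add)
qed

lemma psi_quadratic:
  assumes "y \<in> Y"
  shows "\<exists>b c. \<forall>x\<in>D. \<psi> (y + (x, 0)) = \<psi> y + b * x + c * x\<^sup>2"
proof -
  have "\<exists>b c. \<forall>x\<in>D. \<psi> (y + (x, 0)) - \<psi> y = b * x + c * x\<^sup>2"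
  proof (rule quadratic_on_H_multiples[OF N_pos])
    show "\<psi> (y + (0, 0)) - \<psi> y = 0" by (simp add: zero_prod_def[symmetric])
    show "\<psi> (y + (u + v + w, 0)) - \<psi> y + (\<psi> (y + (u, 0)) - \<psi> y) + (\<psi> (y + (v, 0)) - \<psi> y) + (\<psi> (y + (w, 0)) - \<psi> y)
      = \<psi> (y + (u + v, 0)) - \<psi> y + (\<psi> (y + (u + w, 0)) - \<psi> y) + (\<psi> (y + (v + w, 0)) - \<psi> y)"
      if "u \<in> D" "v \<in> D" "w \<in> D" for u v w
      using psi_third_difference[OF assms that(1,2) D_H[OF that(3)]] by simp
  qed
  then show ?thesis by (simp add: diff_eq_eq algebra_simps)
qed

lemma psi_even: "y \<in> Y \<Longrightarrow> \<psi> (- y) = \<psi> y"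
  using char_like_cnj[OF f] by (simp add: \<psi>_def)

lemma psi_0: "\<psi> 0 = 0"
  using char_like_zero[OF f] by (simp add: \<psi>_def)

end

text \<open>In terms of \<open>\<psi>\<close>, the infimum over every coset of \<open>N H\<close> is
  zero. This supplies, on each coset, sequences to which Krein's inequality can be applied.\<close>

locale third_difference_free_sup_one = third_difference_free +
  assumes sup_one: "\<And>y \<epsilon>. y \<in> Y \<Longrightarrow> \<epsilon> > 0 \<Longrightarrow> \<exists>x\<in>H_multiples N. cmod (f (y + (x, 0))) > 1 - \<epsilon>"
begin

lemma sup_one_seq:
  assumes "y \<in> Y"
  shows "\<exists>x. (\<forall>k. x k \<in> D) \<and> (\<lambda>k. cmod (f (y + (x k, 0)))) \<longlonglongrightarrow> 1"
proof -
  have "\<forall>k::nat. \<exists>x\<in>D. cmod (f (y + (x, 0))) > 1 - inverse (real (Suc k))"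
    using sup_one[OF assms] by simp
  then obtain x where x: "\<And>k. x k \<in> D" "\<And>k. cmod (f (y + (x k, 0))) > 1 - inverse (real (Suc k))"
    by metis
  have "(\<lambda>k. cmod (f (y + (x k, 0)))) \<longlonglongrightarrow> 1"
  proof (rule tendsto_sandwich)
    show "(\<lambda>k. 1 - inverse (real (Suc k))) \<longlonglongrightarrow> 1"
      using tendsto_diff[OF tendsto_const LIMSEQ_inverse_real_of_nat, of 1] by simp
    show "\<forall>\<^sub>F k in sequentially. cmod (f (y + (x k, 0))) \<le> 1"
      using char_like_le_one[OF f] Y_shift[OF assms x(1)] by simp
    show "\<forall>\<^sub>F k in sequentially. 1 - inverse (real (Suc k)) \<le> cmod (f (y + (x k, 0)))"
      by (intro always_eventually allI less_imp_le x(2))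
  qed auto
  then show ?thesis using x by blast
qed

definition \<sigma> :: real where "\<sigma> = \<psi> (of_int N, 0) / (of_int N)\<^sup>2"

lemma sigma_nonneg: "\<sigma> \<ge> 0"
  unfolding \<sigma>_def using psi_nonneg by (intro divide_nonneg_nonneg) auto

text \<open>Along \<open>x k\<close> with |f (y + x k)| tending to 1, the values of |f| at
  \<open>y + x k + w\<close> tend to those at \<open>w\<close>. The symmetric second difference of a
  quadratic polynomial with step \<open>N\<close> does not depend on the base point, so on every
  coset it equals the one at 0.\<close>

lemma psi_leading_coefficient:
  assumes y: "y \<in> Y" and bc: "\<And>x. x \<in> D \<Longrightarrow> \<psi> (y + (x, 0)) = \<psi> y + b * x + c * x\<^sup>2"
  shows "c = \<sigma>"
proof -
  define z where "z = (real_of_int N)"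
  have zD: "z \<in> D" "- z \<in> D" using H_multiples_self[OF N_pos] H_multiples_minus by (auto simp: z_def)
  have z: "z \<noteq> 0" using N_pos by (simp add: z_def)
  obtain x where x: "\<And>k. x k \<in> D" "(\<lambda>k. cmod (f (y + (x k, 0)))) \<longlonglongrightarrow> 1"
    using sup_one_seq[OF y] by blast
  have Y: "y + (x k, 0) \<in> Y" for k using Y_shift[OF y x(1)] .
  have shift: "(\<lambda>k. cmod (f (y + (x k, 0) + (w, 0)))) \<longlonglongrightarrow> exp (- \<psi> (w, 0))" if "w \<in> D" for w
    using char_like_near_one_norm[OF f Y _ x(2), of "\<lambda>_. (w, 0)" "cmod (f (w, 0))"] D_Y[OF that, of 0] norm_f
    by simp
  have psi_minus: "\<psi> (- z, 0) = \<psi> (z, 0)" using psi_even[OF D_Y[OF zD(1), of 0]] by simp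
  have "(\<lambda>k. cmod (f (y + (x k, 0) + (z, 0))) * cmod (f (y + (x k, 0) + (- z, 0))) / (cmod (f (y + (x k, 0))))\<^sup>2)
    \<longlonglongrightarrow> exp (- \<psi> (z, 0)) * exp (- \<psi> (- z, 0)) / 1\<^sup>2"
    by (intro tendsto_intros shift zD x) auto
  moreover have "cmod (f (y + (x k, 0) + (z, 0))) * cmod (f (y + (x k, 0) + (- z, 0))) / (cmod (f (y + (x k, 0))))\<^sup>2
    = exp (- (2 * c * z\<^sup>2))" for k
  proof -
    have D: "x k + z \<in> D" "x k + - z \<in> D" using x(1) zD H_multiples_add by blast+
    have "\<psi> (y + (x k, 0) + (z, 0)) + \<psi> (y + (x k, 0) + (- z, 0)) - 2 * \<psi> (y + (x k, 0)) = 2 * c * z\<^sup>2"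
      using bc[OF D(1)] bc[OF D(2)] bc[OF x(1)] by (simp add: add.assoc power2_eq_square algebra_simps)
    moreover have "cmod (f (y + (x k, 0) + (z, 0))) * cmod (f (y + (x k, 0) + (- z, 0))) / (cmod (f (y + (x k, 0))))\<^sup>2
      = exp (- (\<psi> (y + (x k, 0) + (z, 0)) + \<psi> (y + (x k, 0) + (- z, 0)) - 2 * \<psi> (y + (x k, 0))))"
      using norm_f[OF Y] norm_f[OF Y_shift[OF Y zD(1)]] norm_f[OF Y_shift[OF Y zD(2)]]
      by (simp add: exp_add[symmetric] exp_diff[symmetric] power2_eq_square)
    ultimately show ?thesis by simp
  qed
  ultimately have "(\<lambda>k::nat. exp (- (2 * c * z\<^sup>2))) \<longlonglongrightarrow> exp (- \<psi> (z, 0)) * exp (- \<psi> (- z, 0)) / 1\<^sup>2" by simp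
  then have "exp (- (2 * c * z\<^sup>2)) = exp (- \<psi> (z, 0)) * exp (- \<psi> (- z, 0)) / 1\<^sup>2"
    using LIMSEQ_unique tendsto_const by blast
  then have "c * z\<^sup>2 = \<psi> (z, 0)" by (simp add: psi_minus exp_add[symmetric])
  then show ?thesis using z by (simp add: \<sigma>_def z_def field_simps)
qed

lemma psi_shift:
  assumes "y \<in> Y"
  shows "\<exists>b. \<forall>x\<in>D. \<psi> (y + (x, 0)) = \<psi> y + b * x + \<sigma> * x\<^sup>2"
  using psi_quadratic[OF assms] psi_leading_coefficient[OF assms] by blast

text \<open>With leading coefficient 0, \<open>\<psi>\<close> is affine along the coset. An affine
  function that is nonnegative on a dense subset of the line is constant, and the constant is 0
  because |f| comes arbitrarily close to 1.\<close>

lemma norm_one_of_sigma_0: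
  assumes "\<sigma> = 0" "y \<in> Y"
  shows "cmod (f y) = 1"
proof -
  obtain b where b: "\<And>x. x \<in> D \<Longrightarrow> \<psi> (y + (x, 0)) = \<psi> y + b * x"
    using psi_shift[OF assms(2)] assms(1) by auto
  have nonneg: "\<psi> y + b * x \<ge> 0" if "x \<in> D" for x
    using b[OF that] psi_nonneg[OF Y_shift[OF assms(2) that]] by simp
  have "b = 0"
  proof (rule ccontr)
    assume "b \<noteq> 0"
    then obtain x where x: "x / of_int N \<in> H" "\<bar>b * x - (- \<psi> y - 2)\<bar> < 1"
      using H_multiple_dense[of b N 1 "- \<psi> y - 2"] N_pos by auto
    then show False using nonneg[of x] by (simp add: H_multiples_def)
  qed
  obtain x where x: "\<And>k. x k \<in> D" "(\<lambda>k. cmod (f (y + (x k, 0)))) \<longlonglongrightarrow> 1"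
    using sup_one_seq[OF assms(2)] by blast
  have "cmod (f (y + (x k, 0))) = cmod (f y)" for k
    using norm_f[OF Y_shift[OF assms(2) x(1)]] norm_f[OF assms(2)] b[OF x(1)] \<open>b = 0\<close> by simp
  then have "(\<lambda>k::nat. cmod (f y)) \<longlonglongrightarrow> 1" using x(2) by simp
  then show ?thesis by (simp add: LIMSEQ_const_iff)
qed

end

context adic_base
begin

lemma H_multiples_approx:
  assumes "N > 0"
  shows "\<exists>x. (\<forall>k. x k \<in> H_multiples N) \<and> x \<longlonglongrightarrow> r"
proof -
  have "\<exists>x. x \<in> H_multiples N \<and> \<bar>x - r\<bar> < inverse (real (Suc k))" for k
    using H_multiple_dense[of 1 N "inverse (real (Suc k))" r] assms by (simp add: H_multiples_def)
  then obtain x where x: "\<And>k. x k \<in> H_multiples N" "\<And>k. \<bar>x k - r\<bar> < inverse (real (Suc k))" by metis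
  have "(\<lambda>k. x k - r) \<longlonglongrightarrow> 0"
    by (rule Lim_null_comparison[OF _ LIMSEQ_inverse_real_of_nat]) (use x(2) less_imp_le in \<open>auto intro!: always_eventually\<close>)
  then have "x \<longlonglongrightarrow> r" by (rule LIM_zero_cancel)
  then show ?thesis using x by blast
qed

end

section \<open>Positive leading coefficient: the modulus and the phase\<close>

locale gaussian_factor = third_difference_free_sup_one +
  assumes sigma_pos: "\<sigma> > 0"
begin

text \<open>The linear coefficient divided by \<open>2 * \<sigma>\<close>, so that
  \<open>- lam y\<close> is the vertex of the parabola carried by the coset of \<open>y\<close>. It
  turns out to be the linear form \<open>r + t * n\<close>.\<close>

definition lam :: "real \<times> int \<Rightarrow> real"
  where "lam y = (SOME b. \<forall>x\<in>D. \<psi> (y + (x, 0)) = \<psi> y + b * x + \<sigma> * x\<^sup>2) / (2 * \<sigma>)"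

text \<open>Completing the square leaves a constant \<open>\<kappa>\<close>. It is at most 0 since
  \<open>\<psi>\<close> has infimum 0 on the coset, and at least 0 since \<open>\<psi>\<close> is
  nonnegative and the vertex \<open>- lam y\<close> is a limit of elements of
  \<open>D\<close>.\<close>

lemma psi_completed_square:
  assumes y: "y \<in> Y" and x: "x \<in> D"
  shows "\<psi> (y + (x, 0)) = \<sigma> * (x + lam y)\<^sup>2"
proof -
  define \<kappa> where "\<kappa> = \<psi> y - \<sigma> * (lam y)\<^sup>2"
  define b where "b = (SOME b. \<forall>x\<in>D. \<psi> (y + (x, 0)) = \<psi> y + b * x + \<sigma> * x\<^sup>2)"
  have "\<forall>x\<in>D. \<psi> (y + (x, 0)) = \<psi> y + b * x + \<sigma> * x\<^sup>2"
    unfolding b_def by (rule someI_ex[OF psi_shift[OF y]])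
  moreover have "2 * \<sigma> * lam y = b" using sigma_pos by (simp add: lam_def b_def)
  ultimately have "\<forall>x\<in>D. \<psi> (y + (x, 0)) = \<psi> y + (2 * \<sigma> * lam y) * x + \<sigma> * x\<^sup>2"
    by simp
  then have eq: "\<psi> (y + (x, 0)) = \<sigma> * (x + lam y)\<^sup>2 + \<kappa>" if "x \<in> D" for x
    using that by (simp add: \<kappa>_def power2_eq_square algebra_simps)
  obtain u where u: "\<And>k. u k \<in> D" "(\<lambda>k. cmod (f (y + (u k, 0)))) \<longlonglongrightarrow> 1"
    using sup_one_seq[OF y] by blast
  have "(\<lambda>k. - ln (cmod (f (y + (u k, 0))))) \<longlonglongrightarrow> - ln 1"
    by (intro tendsto_intros u) auto
  then have "(\<lambda>k. \<psi> (y + (u k, 0))) \<longlonglongrightarrow> 0" by (simp add: \<psi>_def)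
  moreover have "\<kappa> \<le> \<psi> (y + (u k, 0))" for k using eq[OF u(1)] sigma_pos by simp
  ultimately have \<kappa>: "\<kappa> \<le> 0" by (intro LIMSEQ_le_const[where X = "\<lambda>k. \<psi> (y + (u k, 0))"]) auto
  obtain v where v: "\<And>k. v k \<in> D" "v \<longlonglongrightarrow> - lam y"
    using H_multiples_approx[OF N_pos] by blast
  have "(\<lambda>k. \<sigma> * (v k + lam y)\<^sup>2 + \<kappa>) \<longlonglongrightarrow> \<sigma> * (- lam y + lam y)\<^sup>2 + \<kappa>"
    by (intro tendsto_intros v)
  moreover have "0 \<le> \<sigma> * (v k + lam y)\<^sup>2 + \<kappa>" for k
    using eq[OF v(1)] psi_nonneg[OF Y_shift[OF y v(1)]] by metis
  ultimately have "0 \<le> \<sigma> * (- lam y + lam y)\<^sup>2 + \<kappa>" by (intro LIMSEQ_le_const) auto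
  then show ?thesis using \<kappa> eq[OF x] by simp
qed

lemma psi_eq: "y \<in> Y \<Longrightarrow> \<psi> y = \<sigma> * (lam y)\<^sup>2"
  using psi_completed_square[of y 0] by (simp add: zero_prod_def[symmetric])

text \<open>The completed squares based at \<open>y\<close> and at \<open>y + (x, 0)\<close>
  describe the same function. Equality at one point fixes the vertex up to sign only; comparison at
  the second point \<open>N\<close> removes the sign.\<close>

lemma lambda_shift:
  assumes y: "y \<in> Y" and x: "x \<in> D"
  shows "lam (y + (x, 0)) = lam y + x"
proof -
  have *: "(z + (x + lam y))\<^sup>2 = (z + lam (y + (x, 0)))\<^sup>2" if "z \<in> D" for z
    using psi_completed_square[OF Y_shift[OF y x] that] psi_completed_square[OF y H_multiples_add[OF x that]] sigma_pos
    by (simp add: add.assoc add_ac)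
  have "(x + lam y)\<^sup>2 = (lam (y + (x, 0)))\<^sup>2" using *[of 0] by simp
  then have "2 * of_int N * (x + lam y) = 2 * of_int N * lam (y + (x, 0))"
    using *[OF H_multiples_self[OF N_pos]] by (simp add: power2_sum)
  then show ?thesis using N_pos by simp
qed

lemma norm_f_eq: "y \<in> Y \<Longrightarrow> cmod (f y) = exp (- (\<sigma> * (lam y)\<^sup>2))"
  using norm_f psi_eq by simp

lemma norm_f_tendsto_1:
  assumes "\<And>k. y k \<in> Y" "(\<lambda>k. lam (y k)) \<longlonglongrightarrow> 0"
  shows "(\<lambda>k. cmod (f (y k))) \<longlonglongrightarrow> 1"
proof -
  have "(\<lambda>k. exp (- (\<sigma> * (lam (y k))\<^sup>2))) \<longlonglongrightarrow> exp (- (\<sigma> * 0\<^sup>2))"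
    by (intro tendsto_intros assms)
  then show ?thesis using norm_f_eq[OF assms(1)] by simp
qed

lemma lambda_null_seq:
  assumes "y \<in> Y"
  shows "\<exists>x. (\<forall>k. x k \<in> D) \<and> (\<lambda>k. lam (y + (x k, 0))) \<longlonglongrightarrow> 0"
proof -
  obtain v where v: "\<And>k. v k \<in> D" "v \<longlonglongrightarrow> - lam y"
    using H_multiples_approx[OF N_pos] by blast
  have "(\<lambda>k. lam y + v k) \<longlonglongrightarrow> lam y + - lam y" by (intro tendsto_intros v)
  then show ?thesis using v lambda_shift[OF assms] by (intro exI[of _ v]) simp
qed

text \<open>Both arguments are moved inside their cosets until \<open>lam\<close> tends to 0, so
  that |f| tends to 1 at both and, by Krein's inequality, at their sum. There the exponent tends to
  \<open>\<sigma>\<close> times the square of the additivity defect, which must therefore be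
  0.\<close>

lemma lambda_add:
  assumes y: "y \<in> Y" and z: "z \<in> Y"
  shows "lam (y + z) = lam y + lam z"
proof -
  obtain u where u: "\<And>k. u k \<in> D" "(\<lambda>k. lam (y + (u k, 0))) \<longlonglongrightarrow> 0" using lambda_null_seq[OF y] by blast
  obtain v where v: "\<And>k. v k \<in> D" "(\<lambda>k. lam (z + (v k, 0))) \<longlonglongrightarrow> 0" using lambda_null_seq[OF z] by blast
  have Yu: "y + (u k, 0) \<in> Y" and Yv: "z + (v k, 0) \<in> Y" for k using Y_shift y z u v by blast+
  have "(\<lambda>k. cmod (f ((y + (u k, 0)) + (z + (v k, 0))))) \<longlonglongrightarrow> 1"
    by (rule char_like_near_one_norm[OF f Yu Yv norm_f_tendsto_1[OF Yu u(2)] norm_f_tendsto_1[OF Yv v(2)]])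
  then have "(\<lambda>k. - ln (cmod (f ((y + (u k, 0)) + (z + (v k, 0)))))) \<longlonglongrightarrow> - ln 1"
    by (intro tendsto_intros) auto
  moreover have "- ln (cmod (f ((y + (u k, 0)) + (z + (v k, 0))))) =
      \<sigma> * (lam (y + (u k, 0)) + lam (z + (v k, 0)) + (lam (y + z) - lam y - lam z))\<^sup>2" for k
  proof -
    have eq: "(y + (u k, 0)) + (z + (v k, 0)) = (y + z) + (u k + v k, 0)" by (cases y; cases z) simp
    have "\<psi> ((y + (u k, 0)) + (z + (v k, 0))) = \<sigma> * (u k + v k + lam (y + z))\<^sup>2"
      unfolding eq using psi_completed_square[OF Y_add[OF y z] H_multiples_add[OF u(1)[of k] v(1)[of k]]] by simp
    then show ?thesis using lambda_shift[OF y u(1)] lambda_shift[OF z v(1)]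
      by (simp add: \<psi>_def add_ac)
  qed
  moreover have "(\<lambda>k. \<sigma> * (lam (y + (u k, 0)) + lam (z + (v k, 0)) + (lam (y + z) - lam y - lam z))\<^sup>2) \<longlonglongrightarrow>
      \<sigma> * (0 + 0 + (lam (y + z) - lam y - lam z))\<^sup>2"
    by (intro tendsto_intros u v)
  ultimately have "\<sigma> * (0 + 0 + (lam (y + z) - lam y - lam z))\<^sup>2 = - ln 1"
    by (metis (no_types, lifting) LIMSEQ_unique ext)
  then show ?thesis using sigma_pos by simp
qed

lemma lambda_0: "lam 0 = 0"
  using lambda_add[OF zero_Y zero_Y] by simp

lemma lambda_minus: "y \<in> Y \<Longrightarrow> lam (- y) = - lam y"
  using lambda_add[of y "- y"] Y_minus[of y] lambda_0 by simp

definition t :: real where "t = lam (0, 1)"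

lemma lambda_eq:
  assumes "r \<in> H"
  shows "lam (r, n) = r + t * of_int n"
proof -
  have nat: "lam (of_nat m * fst y, of_nat m * snd y) = of_nat m * lam y" if "y \<in> Y" for m y
  proof (induction m)
    case 0
    then show ?case using lambda_0 by (simp add: zero_prod_def)
  next
    case (Suc m)
    have "(of_nat (Suc m) * fst y, of_nat (Suc m) * snd y) = (of_nat m * fst y, of_nat m * snd y) + y"
      by (cases y) (simp add: distrib_right)
    moreover have "(of_nat m * fst y, of_nat m * snd y) \<in> Y" using that H_mult[of "fst y" "int m"] by auto
    ultimately show ?case using Suc lambda_add[of "(of_nat m * fst y, of_nat m * snd y)" y] that by (simp add: distrib_right)
  qed
  \<comment> \<open>On \<open>D\<close> the form \<open>lam\<close> is known from its shift rule;
    additivity carries the value from \<open>N * r\<close> back to \<open>r\<close>.\<close>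
  have "of_int N * r \<in> D" using assms N_pos by (simp add: H_multiples_def)
  then have "lam (of_int N * r, 0) = of_int N * r"
    using lambda_shift[OF zero_Y] lambda_0 by simp
  moreover have "lam (of_int N * r, 0) = of_int N * lam (r, 0)"
    using nat[of "(r, 0)" "nat N"] assms N_pos by simp
  ultimately have 1: "lam (r, 0) = r" using N_pos by simp
  have 2: "lam (0, n) = t * of_int n"
  proof (cases "n \<ge> 0")
    case True
    then show ?thesis using nat[of "(0, 1)" "nat n"] by (simp add: t_def)
  next
    case False
    then have "lam (- (0, n)) = - t * of_int n" using nat[of "(0, 1)" "nat (- n)"] by (simp add: t_def)
    then show ?thesis using lambda_minus[of "(0, n)"] by simp
  qed
  show ?thesis using lambda_add[of "(r, 0)" "(0, n)"] assms 1 2 by simp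
qed

definition l :: "real \<times> int \<Rightarrow> complex" where "l y = sgn (f y)"

lemma l_nonzero: "y \<in> Y \<Longrightarrow> l y \<noteq> 0"
  using f_nonzero by (simp add: l_def sgn_zero_iff)

lemma norm_l: "y \<in> Y \<Longrightarrow> cmod (l y) = 1"
  using f_nonzero by (simp add: l_def norm_sgn)

lemma f_eq: "y \<in> Y \<Longrightarrow> f y = l y * exp (- (\<sigma> * (lam y)\<^sup>2))"
  using norm_f_eq[of y] f_nonzero[of y] by (simp add: l_def sgn_eq)

lemma l_0: "l 0 = 1"
  using char_like_zero[OF f] by (simp add: l_def)

lemma l_minus: "y \<in> Y \<Longrightarrow> l (- y) = cnj (l y)"
  using char_like_cnj[OF f] by (simp add: l_def sgn_eq)

text \<open>The multiplicative defect of the phase \<open>l\<close>. It is shown to be 1 for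
  arguments of growing generality.\<close>

definition c :: "real \<times> int \<Rightarrow> real \<times> int \<Rightarrow> complex" where "c y z = l (y + z) / (l y * l z)"

lemma c_sym: "c y z = c z y"
  by (simp add: c_def add.commute mult.commute)

lemma norm_c: "y \<in> Y \<Longrightarrow> z \<in> Y \<Longrightarrow> cmod (c y z) = 1"
  using norm_l Y_add by (simp add: c_def norm_divide norm_mult)

text \<open>If \<open>lam (y k)\<close> tends to 0 then |f (y k)| tends to 1, so Krein's inequality
  makes the quotient of \<open>f (y k + z)\<close> by \<open>f (y k) * f z\<close> tend to 1;
  \<open>sgn\<close> is continuous at 1.\<close>

lemma c_tendsto_1:
  assumes y: "\<And>k. y k \<in> Y" "(\<lambda>k. lam (y k)) \<longlonglongrightarrow> 0" and z: "z \<in> Y"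
  shows "(\<lambda>k. c (y k) z) \<longlonglongrightarrow> 1"
proof -
  have lim1: "(\<lambda>k. cmod (f (y k))) \<longlonglongrightarrow> 1" using norm_f_tendsto_1[OF y] .
  have nz: "f (y k) \<noteq> 0" "f z \<noteq> 0" for k using f_nonzero y z by auto
  have "(\<lambda>k. cmod (f (y k + z) - f (y k) * f z)) \<longlonglongrightarrow> 0"
    using tendsto_norm[OF char_like_near_one[OF f y(1) _ lim1, of "\<lambda>_. z"]] z by simp
  then have "(\<lambda>k. cmod (f (y k + z) - f (y k) * f z) / (cmod (f (y k)) * cmod (f z))) \<longlonglongrightarrow> 0 / (1 * cmod (f z))"
    by (intro tendsto_intros lim1) (use nz in auto)
  moreover have "cmod (f (y k + z) - f (y k) * f z) / (cmod (f (y k)) * cmod (f z)) =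
      cmod (f (y k + z) / (f (y k) * f z) - 1)" for k
    using nz by (simp add: norm_divide[symmetric] norm_mult[symmetric] divide_simps)
  ultimately have "(\<lambda>k. cmod (f (y k + z) / (f (y k) * f z) - 1)) \<longlonglongrightarrow> 0" by simp
  then have "(\<lambda>k. f (y k + z) / (f (y k) * f z)) \<longlonglongrightarrow> 1"
    by (rule LIM_zero_cancel[OF tendsto_norm_zero_cancel])
  then have "(\<lambda>k. sgn (f (y k + z) / (f (y k) * f z))) \<longlonglongrightarrow> sgn 1" by (rule tendsto_sgn) simp
  moreover have "sgn (f (y k + z) / (f (y k) * f z)) = c (y k) z" for k
    unfolding c_def l_def divide_inverse by (simp only: sgn_mult sgn_inverse inverse_mult_distrib)
  ultimately show ?thesis by simp
qed

lemma third_difference_l: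
  assumes "y \<in> Y" "x1 \<in> D" "x2 \<in> D" "x3 \<in> H"
  shows "l (y + (x1 + x2 + x3, 0)) * l (y + (x1, 0)) * l (y + (x2, 0)) * l (y + (x3, 0)) =
      l (y + (x1 + x2, 0)) * l (y + (x1 + x3, 0)) * l (y + (x2 + x3, 0)) * l y"
  using arg_cong[OF third_difference[OF assms], of sgn] by (simp add: l_def sgn_mult)

text \<open>The third difference identity with third step \<open>h k\<close> expresses the quotient
  of the two defects by \<open>c (x, 0) (x', 0)\<close> and by defects based at
  \<open>y + (h k, 0)\<close>. The latter tend to 1 as \<open>lam (y + (h k, 0))\<close> tends to 0,
  while the quotient does not depend on \<open>k\<close>.\<close>

lemma c_shift:
  assumes y: "y \<in> Y" and x: "x \<in> D" and x': "x' \<in> D"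
  shows "c (y + (x, 0)) (x', 0) = c y (x', 0) * c (x, 0) (x', 0)"
proof -
  obtain h where h: "\<And>k. h k \<in> D" "(\<lambda>k. lam (y + (h k, 0))) \<longlonglongrightarrow> 0" using lambda_null_seq[OF y] by blast
  have Yh: "y + (h k, 0) \<in> Y" for k using Y_shift[OF y h(1)] .
  have xx: "x + x' \<in> D" using H_multiples_add[OF x x'] .
  have nz: "l (y + (w, 0)) \<noteq> 0" "l (y + (h k, 0) + (w, 0)) \<noteq> 0" "l (w, 0) \<noteq> 0" if "w \<in> D" for w k
    by (rule l_nonzero[OF Y_shift[OF y that]], rule l_nonzero[OF Y_shift[OF Yh that]],
        rule l_nonzero[OF D_Y[OF that]])
  have nzy: "l y \<noteq> 0" "l (y + (h k, 0)) \<noteq> 0" for k by (rule l_nonzero[OF y], rule l_nonzero[OF Yh])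
  have eq: "c (y + (x, 0)) (x', 0) / c y (x', 0) =
      c (y + (h k, 0)) (x + x', 0) * c (x, 0) (x', 0) / (c (y + (h k, 0)) (x, 0) * c (y + (h k, 0)) (x', 0))" for k
  proof -
    have "l (y + (x + x' + h k, 0)) * l (y + (x, 0)) * l (y + (x', 0)) * l (y + (h k, 0)) =
      l (y + (x + x', 0)) * l (y + (x + h k, 0)) * l (y + (x' + h k, 0)) * l y"
      by (rule third_difference_l[OF y x x' D_H[OF h(1)]])
    moreover have "y + (x + x' + h k, 0) = y + (h k, 0) + (x + x', 0)" "y + (x + h k, 0) = y + (h k, 0) + (x, 0)"
      "y + (x' + h k, 0) = y + (h k, 0) + (x', 0)" "y + (x + x', 0) = y + (x, 0) + (x', 0)"
      by (cases y; simp)+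
    ultimately have "l (y + (h k, 0) + (x + x', 0)) * l (y + (x, 0)) * l (y + (x', 0)) * l (y + (h k, 0)) =
      l (y + (x, 0) + (x', 0)) * l (y + (h k, 0) + (x, 0)) * l (y + (h k, 0) + (x', 0)) * l y" by simp
    then have "l (y + (x, 0) + (x', 0)) * l y / (l (y + (x, 0)) * l (y + (x', 0))) =
       l (y + (h k, 0) + (x + x', 0)) * l (y + (h k, 0)) / (l (y + (h k, 0) + (x, 0)) * l (y + (h k, 0) + (x', 0)))"
      using nz[OF x] nz[OF x'] by (simp add: divide_simps) (simp add: mult_ac)
    then show ?thesis using nz[OF x] nz[OF x'] nz[OF xx] nzy by (simp add: c_def)
  qed
  have "(\<lambda>k. c (y + (h k, 0)) (x + x', 0) * c (x, 0) (x', 0) / (c (y + (h k, 0)) (x, 0) * c (y + (h k, 0)) (x', 0)))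
    \<longlonglongrightarrow> 1 * c (x, 0) (x', 0) / (1 * 1)"
    by (intro tendsto_intros c_tendsto_1[OF Yh h(2)] D_Y x x' xx) auto
  then have "(\<lambda>k::nat. c (y + (x, 0)) (x', 0) / c y (x', 0)) \<longlonglongrightarrow> c (x, 0) (x', 0)" by (simp add: eq[symmetric])
  then have "c (y + (x, 0)) (x', 0) / c y (x', 0) = c (x, 0) (x', 0)" by (simp add: LIMSEQ_const_iff)
  moreover have "c y (x', 0) \<noteq> 0" using norm_c[OF y D_Y[OF x', of 0]] by auto
  ultimately show ?thesis by (simp add: field_simps)
qed

text \<open>On \<open>D\<close> the defect is a symmetric bicharacter. Changing both signs preserves
  a bicharacter but conjugates \<open>c\<close>, so its values are 1 and -1. It is close to 1 when
  the first argument is small, hence equal to 1 there, and \<open>x\<close> is an integer multiple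
  of arbitrarily small elements of \<open>D\<close>.\<close>

lemma c_D:
  assumes x: "x \<in> D" and x': "x' \<in> D"
  shows "c (x, 0) (x', 0) = 1"
proof -
  have add: "c (u + v, 0) (w, 0) = c (u, 0) (w, 0) * c (v, 0) (w, 0)" if "u \<in> D" "v \<in> D" "w \<in> D" for u v w
    using c_shift[OF D_Y[OF that(1), of 0] that(2,3)] by simp
  have n1: "cmod (c (u, 0) (w, 0)) = 1" if "u \<in> D" "w \<in> D" for u w using norm_c D_Y that by blast
  have c0: "c (0, 0) (w, 0) = 1" if "w \<in> D" for w
    using l_0 l_nonzero[OF D_Y[OF that, of 0]] by (simp add: c_def zero_prod_def)
  have minus: "c (- u, 0) (w, 0) * c (u, 0) (w, 0) = 1" if "u \<in> D" "w \<in> D" for u w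
    using add[of "- u" u w] H_multiples_minus that c0 by simp
  have minus2: "c (- u, 0) (- w, 0) = c (u, 0) (w, 0)" if uw: "u \<in> D" "w \<in> D" for u w
  proof -
    have "c (- u, 0) (w, 0) * c (u, 0) (w, 0) = c (- u, 0) (w, 0) * c (- u, 0) (- w, 0)"
      using minus[OF uw] minus[of w "- u"] H_multiples_minus[OF uw(1)] uw c_sym by (metis mult.commute)
    then show ?thesis using n1[of "- u" w] H_multiples_minus uw by auto
  qed
  have sq: "(c (u, 0) (w, 0))\<^sup>2 = 1" if uw: "u \<in> D" "w \<in> D" for u w
  proof -
    have "c (- u, 0) (- w, 0) = cnj (c (u, 0) (w, 0))"
      using l_minus[OF D_Y[OF uw(1), of 0]] l_minus[OF D_Y[OF uw(2), of 0]] l_minus[OF D_Y[OF H_multiples_add[OF uw], of 0]]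
      by (simp add: c_def add.commute)
    then have "c (u, 0) (w, 0) * c (u, 0) (w, 0) = c (u, 0) (w, 0) * cnj (c (u, 0) (w, 0))"
      using minus2[OF uw] by simp
    also have "\<dots> = 1" using n1[OF uw] by (simp add: complex_norm_square[symmetric])
    finally show ?thesis by (simp add: power2_eq_square)
  qed
  obtain m j where mj: "x / of_int N = of_int m / of_int (A j)"
    using x by (auto simp: H_multiples_def adic_rationals_def)
  \<comment> \<open>\<open>x\<close> divided by the integer \<open>A (j + k) / A j\<close>: a null
    sequence in \<open>D\<close> of which \<open>x\<close> is always an integer multiple.\<close>
  define v :: "nat \<Rightarrow> real" where "v k = of_int N * (of_int m / of_int (A (j + k)))" for k
  have vD: "v k \<in> D" for k using N_pos H_I by (simp add: H_multiples_def v_def)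
  have "v \<longlonglongrightarrow> 0"
  proof (rule Lim_null_comparison)
    show "(\<lambda>k. \<bar>of_int (N * m)\<bar> * inverse (real (Suc k))) \<longlonglongrightarrow> 0"
      by (intro tendsto_mult_right_zero LIMSEQ_inverse_real_of_nat)
    have "\<bar>v k\<bar> \<le> \<bar>of_int (N * m)\<bar> * inverse (real (Suc k))" for k
    proof -
      have "int (Suc k) \<le> A (j + k)" using A_ge[of "j + k"] by simp
      then have "inverse (of_int (A (j + k))) \<le> inverse (real (Suc k))"
        by (intro le_imp_inverse_le) linarith+
      then show ?thesis by (simp add: v_def abs_mult divide_inverse mult_left_mono mult.assoc)
    qed
    then show "\<forall>\<^sub>F k in sequentially. norm (v k) \<le> \<bar>of_int (N * m)\<bar> * inverse (real (Suc k))" by simp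
  qed
  moreover have "lam (v k, 0) = v k" for k using lambda_eq[OF D_H[OF vD], of k 0] by simp
  ultimately have "(\<lambda>k. c (v k, 0) (x', 0)) \<longlonglongrightarrow> 1"
    by (intro c_tendsto_1 D_Y vD x') simp
  then have "\<forall>\<^sub>F k in sequentially. dist (c (v k, 0) (x', 0)) 1 < 1" by (simp add: tendsto_iff)
  then obtain k where "dist (c (v k, 0) (x', 0)) 1 < 1" by (auto simp: eventually_sequentially)
  moreover have "c (v k, 0) (x', 0) = 1 \<or> c (v k, 0) (x', 0) = - 1" using sq[OF vD x'] by (simp add: power2_eq_1_iff)
  ultimately have ck: "c (v k, 0) (x', 0) = 1" by (auto simp: dist_norm)
  have pow: "c (of_nat q * v k, 0) (x', 0) = 1" for q
  proof (induction q)
    case (Suc q)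
    have "of_nat q * v k \<in> D" using H_multiples_mult[OF vD, of "int q"] by simp
    then show ?case using add[of "of_nat q * v k" "v k" x'] vD x' Suc ck by (simp add: algebra_simps)
  qed (use c0 x' in simp)
  obtain q where q: "A (j + k) = A j * q" using A_dvd[of j "j + k"] by (auto elim: dvdE)
  then have "q > 0" using A_pos[of "j + k"] A_pos[of j] by (metis zero_less_mult_pos)
  then have "of_nat (nat q) * v k = of_int N * (of_int m / of_int (A j))"
    by (simp add: v_def q)
  also have "\<dots> = x" using N_pos by (simp add: mj[symmetric])
  finally show ?thesis using pow by metis
qed

lemma c_Y_D:
  assumes y: "y \<in> Y" and x': "x' \<in> D"
  shows "c y (x', 0) = 1"
proof -
  obtain h where h: "\<And>k. h k \<in> D" "(\<lambda>k. lam (y + (h k, 0))) \<longlonglongrightarrow> 0" using lambda_null_seq[OF y] by blast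
  have "(\<lambda>k. c (y + (h k, 0)) (x', 0)) \<longlonglongrightarrow> 1" by (rule c_tendsto_1[OF Y_shift[OF y h(1)] h(2) D_Y[OF x']])
  then show ?thesis using c_shift[OF y h(1) x'] c_D[OF h(1) x'] by (simp add: LIMSEQ_const_iff)
qed

text \<open>Shifting \<open>y\<close> inside its coset does not change \<open>c y z\<close>, because
  shifts from \<open>D\<close> are already multiplicative for \<open>l\<close>. A shift along which
  \<open>lam\<close> tends to 0 makes the same quantity tend to 1.\<close>

lemma l_add:
  assumes y: "y \<in> Y" and z: "z \<in> Y"
  shows "l (y + z) = l y * l z"
proof -
  have shift: "l (w + (x, 0)) = l w * l (x, 0)" if "w \<in> Y" "x \<in> D" for w x
    using c_Y_D[OF that] l_nonzero[OF that(1)] l_nonzero[OF D_Y[OF that(2), of 0]] by (simp add: c_def)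
  obtain h where h: "\<And>k. h k \<in> D" "(\<lambda>k. lam (y + (h k, 0))) \<longlonglongrightarrow> 0" using lambda_null_seq[OF y] by blast
  have "(\<lambda>k. c (y + (h k, 0)) z) \<longlonglongrightarrow> 1" by (rule c_tendsto_1[OF Y_shift[OF y h(1)] h(2) z])
  moreover have "c (y + (h k, 0)) z = c y z" for k
  proof -
    have eq: "y + (h k, 0) + z = (y + z) + (h k, 0)" by (simp add: add_ac)
    show ?thesis using l_nonzero[OF D_Y[OF h(1)[of k], of 0]]
      unfolding c_def eq shift[OF y h(1)] shift[OF Y_add[OF y z] h(1)] by simp
  qed
  ultimately have "c y z = 1" by (simp add: LIMSEQ_const_iff)
  then show ?thesis using l_nonzero y z by (simp add: c_def)
qed

end

context adic_base
begin

definition gaussian_like :: "(real \<times> int \<Rightarrow> complex) \<Rightarrow> real \<Rightarrow> real \<Rightarrow> (real \<times> int \<Rightarrow> complex) \<Rightarrow> bool"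
  where "gaussian_like f \<sigma> t l \<longleftrightarrow> (\<forall>y\<in>Y. \<forall>z\<in>Y. l (y + z) = l y * l z) \<and> (\<forall>y\<in>Y. cmod (l y) = 1) \<and>
    (\<forall>y\<in>Y. f y = l y * exp (- (\<sigma> * (fst y + t * of_int (snd y))\<^sup>2)))"

end

theorem (in third_difference_free_sup_one) unimodular_or_gaussian_like:
  "(\<forall>y\<in>Y. cmod (f y) = 1) \<or> (\<exists>s>0. \<exists>t l. gaussian_like f s t l)"
proof (cases "\<sigma> = 0")
  case True
  then show ?thesis using norm_one_of_sigma_0 by blast
next
  case False
  then interpret gaussian_factor a N f
    by unfold_locales (use sigma_nonneg in simp)
  have "gaussian_like f \<sigma> t l"
    unfolding gaussian_like_def using l_add norm_l f_eq lambda_eq by auto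
  then show ?thesis using sigma_pos by blast
qed

section \<open>Independent linear forms on the character group\<close>

lemma sum_1_3: "(\<Sum>i\<in>{1..3::nat}. g i) = g 1 + g 2 + g 3"
  by (simp add: numeral_3_eq_3 numeral_2_eq_2 atLeastAtMostSuc_conv add_ac)

lemma prod_1_3: "(\<Prod>i\<in>{1..3::nat}. g i) = g 1 * g 2 * g 3"
  by (simp add: numeral_3_eq_3 numeral_2_eq_2 atLeastAtMostSuc_conv mult_ac)

lemma index_1_3: "i \<in> {1..3::nat} \<longleftrightarrow> i = 1 \<or> i = 2 \<or> i = 3"
  by auto

text \<open>Columns with entries \<open>\<plusminus>1\<close> fall into four classes up to sign; three columns miss one of
  them, and a representative of the missed class is the required sign vector.\<close>

lemma exists_sign_vector:
  fixes e :: "nat \<Rightarrow> nat \<Rightarrow> int"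
  assumes e: "\<And>i j. i \<in> {1..3} \<Longrightarrow> j \<in> {1..3} \<Longrightarrow> e i j = 1 \<or> e i j = - 1"
  shows "\<exists>s. (\<forall>i. s i = 1 \<or> s i = - 1) \<and>
    (\<forall>j\<in>{1..3}. e 1 j * s 1 + e 2 j * s 2 + e 3 j * s (3::nat) = 1 \<or>
      e 1 j * s 1 + e 2 j * s 2 + e 3 j * s 3 = - 1)"
proof -
  let ?K = "{1, - 1 :: int} \<times> {1, - 1 :: int}"
  let ?f = "\<lambda>j. (e 1 j * e 2 j, e 1 j * e 3 j)"
  have "\<not> ?K \<subseteq> ?f ` {1..3}"
  proof
    assume "?K \<subseteq> ?f ` {1..3}"
    then have "card ?K \<le> card {1..3::nat}" by (rule surj_card_le[OF finite_atLeastAtMost])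
    then show False by (simp add: card_cartesian_product)
  qed
  then obtain k where k: "k \<in> ?K" "k \<notin> ?f ` {1..3}" by (meson subsetI)
  obtain v w where kvw: "k = (v, w)" by (cases k)
  have vw: "v = 1 \<or> v = - 1" "w = 1 \<or> w = - 1" using k(1) unfolding kvw by blast+
  have missed: "e 1 j * e 2 j \<noteq> v \<or> e 1 j * e 3 j \<noteq> w" if "j \<in> {1..3}" for j
  proof (rule ccontr)
    assume "\<not> ?thesis"
    then have eq: "k = ?f j" by (simp only: kvw de_Morgan_disj not_not)
    have "k \<in> ?f ` {1..3}" unfolding eq by (rule imageI[OF that])
    then show False using k(2) by (rule rev_notE)
  qed
  define s where "s i = (if i = 1 then 1 else if i = 2 then v else w)" for i :: nat
  have "e 1 j * s 1 + e 2 j * s 2 + e 3 j * s 3 = 1 \<or> e 1 j * s 1 + e 2 j * s 2 + e 3 j * s 3 = - 1"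
    if j: "j \<in> {1..3}" for j
  proof -
    have "e 1 j = 1 \<or> e 1 j = - 1" "e 2 j = 1 \<or> e 2 j = - 1" "e 3 j = 1 \<or> e 3 j = - 1"
      using e j by simp_all
    then show ?thesis using vw missed[OF j] unfolding s_def by (elim disjE) simp_all
  qed
  moreover have "\<forall>i. s i = 1 \<or> s i = - 1" using vw by (simp add: s_def)
  ultimately show ?thesis by blast
qed

section \<open>Determinants with three columns\<close>

definition det3 :: "(nat \<Rightarrow> real) \<Rightarrow> (nat \<Rightarrow> real) \<Rightarrow> (nat \<Rightarrow> real) \<Rightarrow> real"
  where "det3 x q w = x 1 * (q 2 * w 3 - q 3 * w 2) - x 2 * (q 1 * w 3 - q 3 * w 1)
    + x 3 * (q 1 * w 2 - q 2 * w 1)"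

lemma det3_swap: "det3 q x w = - det3 x q w" "det3 x w q = - det3 x q w"
  by (simp_all add: det3_def algebra_simps)

lemma det3_permute:
  assumes "det3 (p 1) (p 2) (p 3) \<noteq> 0" "j \<in> {1..3::nat}" "j' \<in> {1..3}" "j'' \<in> {1..3}"
    "j \<noteq> j'" "j \<noteq> j''" "j' \<noteq> j''"
  shows "det3 (p j) (p j') (p j'') \<noteq> 0"
proof -
  have "det3 (p 2) (p 1) (p 3) \<noteq> 0" "det3 (p 1) (p 3) (p 2) \<noteq> 0"
    using assms(1) det3_swap by (metis neg_equal_0_iff_equal)+
  moreover from this have "det3 (p 2) (p 3) (p 1) \<noteq> 0" "det3 (p 3) (p 1) (p 2) \<noteq> 0"
    using det3_swap by (metis neg_equal_0_iff_equal)+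
  moreover from this have "det3 (p 3) (p 2) (p 1) \<noteq> 0"
    using det3_swap by (metis neg_equal_0_iff_equal)
  ultimately show ?thesis using assms unfolding index_1_3 by (elim disjE) (simp_all only: not_False_eq_True simp_thms)
qed

lemma det3_rows_zero:
  assumes "det3 x q w \<noteq> 0"
    and "\<And>i. i \<in> {1..3} \<Longrightarrow> x i * v1 + q i * v2 + w i * v3 = 0"
  shows "v1 = 0" "v2 = 0" "v3 = 0"
proof -
  have *: "x 1 * v1 + q 1 * v2 + w 1 * v3 = 0" "x 2 * v1 + q 2 * v2 + w 2 * v3 = 0" "x 3 * v1 + q 3 * v2 + w 3 * v3 = 0"
    using assms(2) by auto
  have "det3 x q w * v1 = 0" "det3 x q w * v2 = 0" "det3 x q w * v3 = 0"
    using * unfolding det3_def by algebra+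
  then show "v1 = 0" "v2 = 0" "v3 = 0" using assms(1) by auto
qed

text \<open>Selects the two minors by which the cube argument divides. After scaling each row by its
  entry in \<open>x\<close>, the minors become differences of the ratios \<open>Q\<close> and
  \<open>W\<close>; if each choice of rows failed, these differences would make the determinant
  vanish.\<close>

lemma det3_row_choice:
  assumes det: "det3 x q w \<noteq> 0" and x: "\<And>i. i \<in> {1..3} \<Longrightarrow> x i \<noteq> 0"
  shows "\<exists>i i' i''. {i, i', i''} = {1..3} \<and> i \<noteq> i' \<and> i \<noteq> i'' \<and> i' \<noteq> i'' \<and>
    x i * q i' - x i' * q i \<noteq> 0 \<and> x i * w i'' - x i'' * w i \<noteq> 0"
proof (rule ccontr)
  assume no: "\<not> ?thesis"
  have S: "{1..3} = {1, 2, 3::nat}" by auto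
  have *: "x i * q i' - x i' * q i = 0 \<or> x i * w i'' - x i'' * w i = 0"
    if "{i, i', i''} = {1, 2, 3}" "i \<noteq> i'" "i \<noteq> i''" "i' \<noteq> i''" for i i' i''
    using no that unfolding S by blast
  define Q where "Q i = q i / x i" for i
  define W where "W i = w i / x i" for i
  have qw: "q i = Q i * x i" "w i = W i * x i" if "i \<in> {1..3}" for i
    using x[OF that] by (simp_all add: Q_def W_def)
  have QW: "Q i = Q i' \<or> W i = W i''" if "{i, i', i''} = {1, 2, 3}" "i \<noteq> i'" "i \<noteq> i''" "i' \<noteq> i''" for i i' i''
  proof -
    have "i \<in> {1..3}" "i' \<in> {1..3}" "i'' \<in> {1..3}" using that(1) unfolding S by blast+
    then show ?thesis using *[OF that] qw x by (auto simp: field_simps)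
  qed
  have perms: "{1, 3, 2} = {1, 2, 3::nat}" "{2, 1, 3} = {1, 2, 3::nat}" by auto
  have "Q 1 = Q 2 \<or> W 1 = W 3" "Q 1 = Q 3 \<or> W 1 = W 2" "Q 2 = Q 1 \<or> W 2 = W 3"
    by (rule QW[OF refl] QW[OF perms(1)] QW[OF perms(2)]; simp)+
  then have "Q 2 = Q 1 \<and> (Q 3 = Q 1 \<or> W 2 = W 1) \<or> W 3 = W 1 \<and> W 2 = W 1"
    by metis
  then have "(Q 2 - Q 1) * (W 3 - W 1) - (Q 3 - Q 1) * (W 2 - W 1) = 0"
    by (elim disjE conjE) simp_all
  moreover have "det3 x q w = x 1 * x 2 * x 3 * ((Q 2 - Q 1) * (W 3 - W 1) - (Q 3 - Q 1) * (W 2 - W 1))"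
    using qw[of 1] qw[of 2] qw[of 3] unfolding det3_def by (simp add: algebra_simps del: One_nat_def)
  ultimately show False using det by simp
qed

context adic_base
begin

section \<open>Multipliers of \<open>H\<close> and integral linear algebra over them\<close>

definition H_endomorphism :: "real \<Rightarrow> bool"
  where "H_endomorphism q \<longleftrightarrow> (\<forall>x\<in>H. q * x \<in> H)"

lemma H_endomorphism_mult: "H_endomorphism q \<Longrightarrow> H_endomorphism r \<Longrightarrow> H_endomorphism (q * r)"
  by (simp add: H_endomorphism_def mult.assoc)

lemma H_endomorphism_diff: "H_endomorphism q \<Longrightarrow> H_endomorphism r \<Longrightarrow> H_endomorphism (q - r)"
  by (simp add: H_endomorphism_def left_diff_distrib H_diff)

lemma H_endomorphism_add: "H_endomorphism q \<Longrightarrow> H_endomorphism r \<Longrightarrow> H_endomorphism (q + r)"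
  by (simp add: H_endomorphism_def distrib_right H_add)

lemma H_endomorphism_minus: "H_endomorphism q \<Longrightarrow> H_endomorphism (- q)"
  by (simp add: H_endomorphism_def H_minus)

lemma H_endomorphism_0: "H_endomorphism 0"
  by (simp add: H_endomorphism_def)

lemmas H_endomorphism_intros = H_endomorphism_mult H_endomorphism_diff H_endomorphism_add
  H_endomorphism_minus H_endomorphism_0

lemma H_endomorphism_Rats: "H_endomorphism q \<Longrightarrow> q \<in> \<rat>"
  using H_Rats[of "q * 1"] unfolding H_endomorphism_def by (metis H_1 mult.right_neutral)

lemma H_endomorphism_multiples: "H_endomorphism q \<Longrightarrow> x \<in> H_multiples N \<Longrightarrow> q * x \<in> H_multiples N"
  by (auto simp: H_endomorphism_def H_multiples_def)

text \<open>Division by \<open>q = m / n\<close> can leave \<open>H\<close>, but not on the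
  multiples of \<bar>m\<bar>. This is the origin of the modulus \<open>N\<close>.\<close>

lemma divide_rational_in_H:
  assumes "q \<in> \<rat>" "q \<noteq> 0"
  shows "\<exists>N>0. \<forall>x\<in>H_multiples N. x / q \<in> H"
proof -
  obtain m n where mn: "q = of_int m / of_int n" "n > 0"
    using assms(1) by (metis Rats_cases')
  then have m: "m \<noteq> 0" using assms(2) by auto
  have "x / q \<in> H" if "x \<in> H_multiples \<bar>m\<bar>" for x
  proof -
    have "x / q = of_int (sgn m * n) * (x / of_int \<bar>m\<bar>)" using m unfolding mn(1)
      by (cases "m > 0") auto
    then show ?thesis using that H_mult[of "x / of_int \<bar>m\<bar>" "sgn m * n"] by (simp only: H_multiples_def mem_Collect_eq)
  qed
  then show ?thesis using m by (intro exI[of _ "\<bar>m\<bar>"]) auto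
qed

lemma H_multiples_of_mult:
  assumes "N > 0" "M > 0" "x \<in> H_multiples (N * M)"
  shows "x \<in> H_multiples N"
  using H_mult[of "x / of_int (N * M)" M] assms by (simp add: H_multiples_def field_simps)

text \<open>The kernel vector must have multipliers of \<open>H\<close> as entries, so it is built
  from minors without division. The cross product of \<open>q\<close> and \<open>w\<close> serves
  unless it vanishes; then \<open>w\<close> is parallel to \<open>q\<close> and the cross product of
  \<open>q\<close> and \<open>x\<close> serves; if that vanishes too, all columns are parallel to
  \<open>q\<close> and a vector orthogonal to \<open>q\<close> suffices.\<close>

lemma det3_zero_left_kernel:
  assumes det: "det3 x q w = 0"
    and nz: "\<And>i. i \<in> {1..3} \<Longrightarrow> q i \<noteq> 0"
    and endo: "\<And>i. i \<in> {1..3} \<Longrightarrow> H_endomorphism (x i)" "\<And>i. i \<in> {1..3} \<Longrightarrow> H_endomorphism (q i)"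
      "\<And>i. i \<in> {1..3} \<Longrightarrow> H_endomorphism (w i)"
  shows "\<exists>v. (\<forall>i\<in>{1..3}. H_endomorphism (v i)) \<and> (\<exists>i\<in>{1..3::nat}. v i \<noteq> 0) \<and>
    x 1 * v 1 + x 2 * v 2 + x 3 * v 3 = 0 \<and> q 1 * v 1 + q 2 * v 2 + q 3 * v 3 = 0 \<and>
    w 1 * v 1 + w 2 * v 2 + w 3 * v 3 = 0"
proof -
  have S: "{1..3} = {1, 2, 3::nat}" by auto
  have E: "H_endomorphism (x 1)" "H_endomorphism (x 2)" "H_endomorphism (x 3)"
     "H_endomorphism (q 1)" "H_endomorphism (q 2)" "H_endomorphism (q 3)"
     "H_endomorphism (w 1)" "H_endomorphism (w 2)" "H_endomorphism (w 3)"
    using endo by auto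
  define vec where "vec a b c i = (if i = (1::nat) then a else if i = 2 then b else c)" for a b c :: real and i
  have vec: "vec a b c 1 = a" "vec a b c 2 = b" "vec a b c 3 = c" for a b c by (simp_all add: vec_def)
  have wit: ?thesis if "H_endomorphism a" "H_endomorphism b" "H_endomorphism c" "a \<noteq> 0 \<or> b \<noteq> 0 \<or> c \<noteq> 0"
    "x 1 * a + x 2 * b + x 3 * c = 0" "q 1 * a + q 2 * b + q 3 * c = 0" "w 1 * a + w 2 * b + w 3 * c = 0" for a b c
    using that unfolding S by (intro exI[of _ "vec a b c"]) (auto simp: vec simp del: One_nat_def)
  define c1 where "c1 = q 2 * w 3 - q 3 * w 2"
  define c2 where "c2 = q 3 * w 1 - q 1 * w 3"
  define c3 where "c3 = q 1 * w 2 - q 2 * w 1"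
  define d1 where "d1 = q 2 * x 3 - q 3 * x 2"
  define d2 where "d2 = q 3 * x 1 - q 1 * x 3"
  define d3 where "d3 = q 1 * x 2 - q 2 * x 1"
  show ?thesis
  proof (cases "c1 = 0 \<and> c2 = 0 \<and> c3 = 0")
    case False
    show ?thesis
    proof (rule wit)
      show "x 1 * c1 + x 2 * c2 + x 3 * c3 = 0" using det by (simp add: det3_def c1_def c2_def c3_def algebra_simps)
    qed (use False in \<open>auto simp: c1_def c2_def c3_def algebra_simps simp del: One_nat_def intro!: H_endomorphism_intros E\<close>)
  next
    case c: True
    show ?thesis
    proof (cases "d1 = 0 \<and> d2 = 0 \<and> d3 = 0")
      case False
      have "q 1 * (w 1 * d1 + w 2 * d2 + w 3 * d3) = 0"
        using c unfolding c1_def c2_def c3_def d1_def d2_def d3_def by algebra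
      then have "w 1 * d1 + w 2 * d2 + w 3 * d3 = 0" using nz[of 1] by simp
      then show ?thesis using False
        by (intro wit[of d1 d2 d3]) (auto simp: d1_def d2_def d3_def algebra_simps simp del: One_nat_def intro!: H_endomorphism_intros E)
    next
      case True
      show ?thesis
        by (rule wit[of "q 2" "- q 1" 0])
          (use True c nz[of 1] in \<open>auto simp: c3_def d3_def algebra_simps simp del: One_nat_def intro!: H_endomorphism_intros E\<close>)
    qed
  qed
qed

end

section \<open>Three linear forms and averaging over \<open>H / N H\<close>\<close>

locale linear_forms = adic_base +
  fixes p c :: "nat \<Rightarrow> nat \<Rightarrow> real" and e :: "nat \<Rightarrow> nat \<Rightarrow> int"
    and f :: "nat \<Rightarrow> real \<times> int \<Rightarrow> complex"
  assumes p_nonzero: "\<And>i j. i \<in> {1..3} \<Longrightarrow> j \<in> {1..3} \<Longrightarrow> p i j \<noteq> 0"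
    and p_H: "\<And>i j. i \<in> {1..3} \<Longrightarrow> j \<in> {1..3} \<Longrightarrow> (\<lambda>x. p i j * x) ` H = H"
    and c_H: "\<And>i j. i \<in> {1..3} \<Longrightarrow> j \<in> {1..3} \<Longrightarrow> c i j \<in> H"
    and e_sign: "\<And>i j. i \<in> {1..3} \<Longrightarrow> j \<in> {1..3} \<Longrightarrow> e i j = 1 \<or> e i j = - 1"
    and char_like_f: "\<And>j. j \<in> {1..3} \<Longrightarrow> char_like (f j)"
begin

definition act :: "nat \<Rightarrow> nat \<Rightarrow> real \<times> int \<Rightarrow> real \<times> int"
  where "act i j u = (p i j * fst u + c i j * of_int (snd u), e i j * snd u)"

lemma act_add: "act i j (u + v) = act i j u + act i j v"
  by (simp add: act_def algebra_simps)

lemma act_pair_0: "act i j (x, 0) = (p i j * x, 0)"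
  by (simp add: act_def)

lemma act_0: "act i j 0 = 0"
  by (simp add: act_def zero_prod_def)

lemma p_endo: "i \<in> {1..3} \<Longrightarrow> j \<in> {1..3} \<Longrightarrow> H_endomorphism (p i j)"
  unfolding H_endomorphism_def using p_H by blast

lemma p_divide_H:
  assumes "i \<in> {1..3}" "j \<in> {1..3}" "x \<in> H"
  shows "x / p i j \<in> H"
proof -
  obtain y where "y \<in> H" "x = p i j * y" using p_H[OF assms(1,2)] assms(3) by blast
  then show ?thesis using p_nonzero[OF assms(1,2)] by simp
qed

lemma act_Y: "i \<in> {1..3} \<Longrightarrow> j \<in> {1..3} \<Longrightarrow> u \<in> Y \<Longrightarrow> act i j u \<in> Y"
  using p_endo[of i j] c_H[of i j] H_mult[of "c i j" "snd u"]
  by (auto simp: act_def H_endomorphism_def mult.commute intro!: H_add)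

text \<open>With the integer coordinates fixed as \<open>s i * n\<close>, every term is a periodic
  function of an affine expression in one free variable and so has mean \<open>m j n\<close>.
  Summing over \<open>r3\<close> alone turns the inequality into \<open>V 1 r1 + V 2 r2\<close> plus
  \<open>M\<close> being at most \<open>M\<close> (up to the factor \<open>card R\<close>), so
  \<open>V 1\<close> vanishes on all representatives; its sum is again \<open>M\<close>, hence
  \<open>M = 0\<close>.\<close>

lemma averaging:
  fixes B :: "nat \<Rightarrow> real \<times> int \<Rightarrow> real"
  assumes N: "N > 0"
    and nonneg: "\<And>j y. j \<in> {1..3} \<Longrightarrow> y \<in> Y \<Longrightarrow> B j y \<ge> 0"
    and even: "\<And>j y. j \<in> {1..3} \<Longrightarrow> y \<in> Y \<Longrightarrow> B j (- y) = B j y"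
    and periodic: "\<And>j y d. j \<in> {1..3} \<Longrightarrow> y \<in> Y \<Longrightarrow> d \<in> H_multiples N \<Longrightarrow> B j (y + (d, 0)) = B j y"
    and ineq: "\<And>u. (\<And>i. i \<in> {1..3} \<Longrightarrow> u i \<in> Y) \<Longrightarrow>
      (\<Sum>i\<in>{1..3}. \<Sum>j\<in>{1..3}. B j (act i j (u i))) \<le> (\<Sum>j\<in>{1..3}. B j (\<Sum>i\<in>{1..3}. act i j (u i)))"
    and j: "j \<in> {1..3}" and y: "y \<in> Y"
  shows "B j y = 0"
proof -
  obtain R where R: "finite R" "R \<subseteq> H" "R \<noteq> {}"
    and cover: "\<And>h. h \<in> H \<Longrightarrow> \<exists>r\<in>R. (h - r) / of_int N \<in> H"
    and unique: "\<And>r s. r \<in> R \<Longrightarrow> s \<in> R \<Longrightarrow> (r - s) / of_int N \<in> H \<Longrightarrow> r = s"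
    using finite_representatives[OF N] by metis
  define n where "n = snd y"
  define m where "m j n = (\<Sum>r\<in>R. B j (r, n))" for j n
  have affine: "(\<Sum>r\<in>R. B j (q * r + d, n)) = m j n"
    if "j \<in> {1..3}" "q \<noteq> 0" "(\<lambda>x. q * x) ` H = H" "d \<in> H" for j n q d
  proof -
    have "periodic_on_H N (\<lambda>x. B j (x, n))"
      unfolding periodic_on_H_def using periodic[OF that(1), of "(x, n)" for x] by (auto simp: H_multiples_def)
    from sum_representatives_affine[OF N R(1,2) cover unique this that(2-4)]
    show ?thesis unfolding m_def by simp
  qed
  have m_minus: "m j (- n) = m j n" if "j \<in> {1..3}" for j n
  proof -
    have "(\<lambda>x. - 1 * x) ` H = H"
    proof (intro equalityI subsetI)
      show "x \<in> (\<lambda>x. - 1 * x) ` H" if "x \<in> H" for x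
        using H_minus[OF that] by (intro image_eqI[of _ _ "- x"]) auto
    qed (use H_minus in auto)
    then have "m j n = (\<Sum>r\<in>R. B j (- 1 * r + 0, n))" using affine[OF that, of "-1" 0 n] by simp
    also have "\<dots> = (\<Sum>r\<in>R. B j (r, - n))"
    proof (rule sum.cong[OF refl])
      fix r assume "r \<in> R"
      then show "B j (- 1 * r + 0, n) = B j (r, - n)" using even[OF that, of "(r, - n)"] R(2) by auto
    qed
    finally show ?thesis by (simp add: m_def)
  qed
  \<comment> \<open>Evenness identifies the sums at \<open>n\<close> and \<open>- n\<close>. The
    signs make the integer coordinate of each column sum equal to \<open>n\<close> or
    \<open>- n\<close>, so that the right side has the same sum \<open>M\<close> as each
    row.\<close>
  from exists_sign_vector[of e, OF e_sign] obtain s :: "nat \<Rightarrow> int" where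
    ss: "(\<forall>i. s i = 1 \<or> s i = - 1) \<and> (\<forall>j\<in>{1..3}. e 1 j * s 1 + e 2 j * s 2 + e 3 j * s 3 = 1 \<or>
      e 1 j * s 1 + e 2 j * s 2 + e 3 j * s 3 = - 1)" by (rule exE)
  note s = spec[OF conjunct1[OF ss]] and s_sum = bspec[OF conjunct2[OF ss]]
  define V where "V i r = (\<Sum>j\<in>{1..3}. B j (act i j (r, s i * n)))" for i r
  define T where "T r1 r2 r3 = (\<Sum>j\<in>{1..3}. B j (act 1 j (r1, s 1 * n) + act 2 j (r2, s 2 * n) + act 3 j (r3, s 3 * n)))"
    for r1 r2 r3
  define M where "M = (\<Sum>j\<in>{1..3}. m j n)"
  have VT: "V 1 r1 + V 2 r2 + V 3 r3 \<le> T r1 r2 r3" if "r1 \<in> H" "r2 \<in> H" "r3 \<in> H" for r1 r2 r3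
  proof -
    define u where "u i = (if i = 1 then r1 else if i = 2 then r2 else r3, s i * n)" for i :: nat
    have "u i \<in> Y" for i using that by (simp add: u_def)
    from ineq[of u, OF this] show ?thesis
      unfolding sum_1_3[of "\<lambda>i. act i j (u i)" for j] sum_1_3[of "\<lambda>i. \<Sum>j\<in>{1..3}. B j (act i j (u i))"]
      by (simp add: V_def T_def u_def del: One_nat_def)
  qed
  have sum_V: "(\<Sum>r\<in>R. V i r) = M" if i: "i \<in> {1..3}" for i
  proof -
    have "(\<Sum>r\<in>R. B j (act i j (r, s i * n))) = m j n" if jj: "j \<in> {1..3}" for j
    proof -
      have "c i j * of_int (s i * n) \<in> H" using H_mult[OF c_H[OF i jj]] by (metis mult.commute)
      then have "(\<Sum>r\<in>R. B j (p i j * r + c i j * of_int (s i * n), e i j * (s i * n))) = m j (e i j * (s i * n))"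
        by (rule affine[OF jj p_nonzero[OF i jj] p_H[OF i jj]])
      also have "\<dots> = m j n" using s[of i] e_sign[OF i jj] m_minus[OF jj] by auto
      finally show ?thesis by (simp add: act_def)
    qed
    then show ?thesis unfolding V_def M_def by (subst sum.swap) simp
  qed
  have sum_T: "(\<Sum>r3\<in>R. T r1 r2 r3) = M" if r: "r1 \<in> H" "r2 \<in> H" for r1 r2
  proof -
    have "(\<Sum>r3\<in>R. B j (act 1 j (r1, s 1 * n) + act 2 j (r2, s 2 * n) + act 3 j (r3, s 3 * n))) = m j n"
      if jj: "j \<in> {1..3}" for j
    proof -
      define d where "d = fst (act 1 j (r1, s 1 * n)) + fst (act 2 j (r2, s 2 * n)) + c 3 j * of_int (s 3 * n)"
      have "of_int (s 3 * n) * c 3 j \<in> H" using jj by (intro H_mult c_H) auto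
      then have "c 3 j * of_int (s 3 * n) \<in> H" by (simp only: mult.commute)
      moreover have "fst (act 1 j (r1, s 1 * n)) \<in> H" "fst (act 2 j (r2, s 2 * n)) \<in> H"
        using act_Y[of 1 j "(r1, s 1 * n)"] act_Y[of 2 j "(r2, s 2 * n)"] jj r by auto
      ultimately have d: "d \<in> H" unfolding d_def by (intro H_add)
      have "act 1 j (r1, s 1 * n) + act 2 j (r2, s 2 * n) + act 3 j (r3, s 3 * n) =
        (p 3 j * r3 + d, (e 1 j * s 1 + e 2 j * s 2 + e 3 j * s 3) * n)" for r3
        by (simp add: d_def act_def algebra_simps)
      then have "(\<Sum>r3\<in>R. B j (act 1 j (r1, s 1 * n) + act 2 j (r2, s 2 * n) + act 3 j (r3, s 3 * n)))
        = m j ((e 1 j * s 1 + e 2 j * s 2 + e 3 j * s 3) * n)"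
        using affine[OF jj p_nonzero[of 3 j] p_H[of 3 j] d] jj by simp
      also have "\<dots> = m j n" using s_sum[OF jj] m_minus[OF jj] by auto
      finally show ?thesis .
    qed
    then show ?thesis unfolding T_def M_def by (subst sum.swap) simp
  qed
  have V_nonneg: "V i r \<ge> 0" if "i \<in> {1..3}" "r \<in> H" for i r
    unfolding V_def using that by (intro sum_nonneg nonneg act_Y) auto
  have "V 1 r1 = 0" if r1: "r1 \<in> R" for r1
  proof -
    obtain r2 where r2: "r2 \<in> R" using R(3) by blast
    have H: "r1 \<in> H" "r2 \<in> H" using r1 r2 R(2) by auto
    \<comment> \<open>Only the third variable is summed over; the other two stay fixed, which yields
      a pointwise statement about \<open>V 1\<close>.\<close>
    have "(\<Sum>r3\<in>R. V 1 r1 + V 2 r2 + V 3 r3) \<le> (\<Sum>r3\<in>R. T r1 r2 r3)"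
      using H R(2) by (intro sum_mono VT) auto
    then have "of_nat (card R) * (V 1 r1 + V 2 r2) + M \<le> M"
      using sum_T[OF H] sum_V[of 3] by (simp add: sum.distrib)
    then have "V 1 r1 + V 2 r2 \<le> 0" using R(1,3) by (simp add: mult_le_0_iff card_gt_0_iff)
    then show ?thesis using V_nonneg[of 1 r1] V_nonneg[of 2 r2] H by simp
  qed
  then have "M = 0" using sum_V[of 1] by simp
  have BR: "0 \<le> B k (r, n)" if "k \<in> {1..3}" "r \<in> R" for k r
    using that R(2) by (intro nonneg) auto
  have "0 \<le> m k n" if "k \<in> {1..3}" for k
    unfolding m_def by (rule sum_nonneg[OF BR[OF that]])
  then have "m j n = 0"
    using \<open>M = 0\<close> j sum_nonneg_eq_0_iff[of "{1..3::nat}" "\<lambda>j. m j n"] unfolding M_def by blast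
  then have R0: "B j (r, n) = 0" if "r \<in> R" for r
    using that R(1) sum_nonneg_eq_0_iff[of R "\<lambda>r. B j (r, n)"] BR[OF j] unfolding m_def by blast
  obtain r where r: "r \<in> R" "(fst y - r) / of_int N \<in> H" using cover[of "fst y"] y by auto
  have "B j ((r, n) + (fst y - r, 0)) = B j (r, n)"
    using periodic[OF j, of "(r, n)" "fst y - r"] r R(2) by (auto simp: H_multiples_def)
  then show ?thesis using R0[OF r(1)] by (cases y) (simp add: n_def)
qed

end

lemma sum_permuted:
  assumes "{i, i', i''} = {1..3::nat}" "i \<noteq> i'" "i \<noteq> i''" "i' \<noteq> i''"
  shows "sum g {1..3} = g i + g i' + (g i'' :: 'a :: comm_monoid_add)"
  unfolding assms(1)[symmetric] using assms(2-) by (simp add: add.assoc)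

lemma prod_permuted:
  assumes "{i, i', i''} = {1..3::nat}" "i \<noteq> i'" "i \<noteq> i''" "i' \<noteq> i''"
  shows "prod g {1..3} = g i * g i' * (g i'' :: 'a :: comm_monoid_mult)"
  unfolding assms(1)[symmetric] using assms(2-) by (simp add: mult.assoc)

lemma exists_permutation:
  assumes "j \<in> {1..3::nat}"
  shows "\<exists>j' j''. {j, j', j''} = {1..3} \<and> j \<noteq> j' \<and> j \<noteq> j'' \<and> j' \<noteq> j''"
proof -
  have "{1, 2, 3} = {1..3::nat}" "{2, 1, 3} = {1..3::nat}" "{3, 1, 2} = {1..3::nat}" by auto
  moreover consider "j = 1" | "j = 2" | "j = 3" using assms unfolding index_1_3 by blast
  ultimately show ?thesis by (metis (no_types) num.distinct numeral_eq_iff numeral_eq_one_iff one_eq_numeral_iff)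
qed

text \<open>A function that ignores one of the three switches takes the same value at the two ends
  of each edge in that direction, and these ends lie on opposite sides of the identity.\<close>

lemma cube_identity:
  fixes F :: "bool \<Rightarrow> bool \<Rightarrow> bool \<Rightarrow> 'a :: comm_monoid_mult"
  assumes "\<And>a b c. F a b c = R1 a b * R2 a c * R3 b c"
  shows "F True True True * F True False False * F False True False * F False False True =
    F True True False * F True False True * F False True True * F False False False"
  unfolding assms by (simp only: mult_ac)

text \<open>Three pairwise orthogonal rows of equal positive length would make the columns
  orthogonal as well, but the inner product of two columns of three signs is an odd integer. With
  the first sign vector normalised to 1, a finite check over the signs is enough.\<close>

lemma orthogonal_sign_vectors_contradiction:
  fixes s1 s2 s3 :: real and e2 e3 :: "nat \<Rightarrow> real"
  assumes "s1 > 0" "s2 \<ge> 0" "s3 \<ge> 0"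
    and e: "e2 1 = 1 \<or> e2 1 = - 1" "e2 2 = 1 \<or> e2 2 = - 1" "e2 3 = 1 \<or> e2 3 = - 1"
      "e3 1 = 1 \<or> e3 1 = - 1" "e3 2 = 1 \<or> e3 2 = - 1" "e3 3 = 1 \<or> e3 3 = - 1"
    and orth: "s1 + s2 * (e2 1 * e2 2) + s3 * (e3 1 * e3 2) = 0" "s1 + s2 * (e2 1 * e2 3) + s3 * (e3 1 * e3 3) = 0"
      "s1 + s2 * (e2 2 * e2 3) + s3 * (e3 2 * e3 3) = 0"
  shows False
proof -
  define a where "a = e2 1 * e2 2"
  define a' where "a' = e2 1 * e2 3"
  define b where "b = e3 1 * e3 2"
  define b' where "b' = e3 1 * e3 3"
  have "e2 2 * e2 3 = a * a'" "e3 2 * e3 3 = b * b'" using e by (auto simp: a_def a'_def b_def b'_def)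
  moreover have "a = 1 \<or> a = - 1" "a' = 1 \<or> a' = - 1" "b = 1 \<or> b = - 1" "b' = 1 \<or> b' = - 1"
    using e by (auto simp: a_def a'_def b_def b'_def)
  ultimately show False using assms(1-3) orth unfolding a_def[symmetric] a'_def[symmetric] b_def[symmetric] b'_def[symmetric]
    by auto
qed

section \<open>Consequences of the functional equation\<close>

locale independent_linear_forms = linear_forms +
  assumes functional_equation: "\<And>u. (\<And>i. i \<in> {1..3} \<Longrightarrow> u i \<in> Y) \<Longrightarrow>
    (\<Prod>j\<in>{1..3}. f j (\<Sum>i\<in>{1..3}. act i j (u i))) = (\<Prod>i\<in>{1..3}. \<Prod>j\<in>{1..3}. f j (act i j (u i)))"
begin

definition psi :: "nat \<Rightarrow> real \<times> int \<Rightarrow> real" where "psi j y = - ln (cmod (f j y))"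

lemma sum_Y: "(\<And>i. i \<in> I \<Longrightarrow> g i \<in> Y) \<Longrightarrow> sum g I \<in> Y"
  by (induction I rule: infinite_finite_induct) (auto simp: zero_Y intro: Y_add)

lemma psi_nonneg: "j \<in> {1..3} \<Longrightarrow> y \<in> Y \<Longrightarrow> 0 \<le> psi j y"
  using char_like_le_one[OF char_like_f, of j y] char_like_nonzero[OF char_like_f, of j y] by (simp add: psi_def)

lemma norm_f: "j \<in> {1..3} \<Longrightarrow> y \<in> Y \<Longrightarrow> cmod (f j y) = exp (- psi j y)"
  using char_like_nonzero[OF char_like_f, of j y] by (simp add: psi_def)

lemma psi_0: "j \<in> {1..3} \<Longrightarrow> psi j 0 = 0"
  using char_like_zero[OF char_like_f] by (simp add: psi_def)

lemma psi_even: "j \<in> {1..3} \<Longrightarrow> y \<in> Y \<Longrightarrow> psi j (- y) = psi j y"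
  using char_like_cnj[OF char_like_f] by (simp add: psi_def)

lemma psi_functional_equation:
  assumes u: "\<And>i. i \<in> {1..3} \<Longrightarrow> u i \<in> Y"
  shows "(\<Sum>j\<in>{1..3}. psi j (\<Sum>i\<in>{1..3}. act i j (u i))) = (\<Sum>i\<in>{1..3}. \<Sum>j\<in>{1..3}. psi j (act i j (u i)))"
proof -
  have pos: "0 < cmod (f j y)" if "j \<in> {1..3}" "y \<in> Y" for j y
    using char_like_nonzero[OF char_like_f[OF that(1)] that(2)] by simp
  have "(\<Prod>j\<in>{1..3}. cmod (f j (\<Sum>i\<in>{1..3}. act i j (u i)))) = (\<Prod>i\<in>{1..3}. \<Prod>j\<in>{1..3}. cmod (f j (act i j (u i))))"
    using arg_cong[OF functional_equation[of u, OF u], where f = cmod] by (simp only: prod_norm)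
  then have "ln (\<Prod>j\<in>{1..3}. cmod (f j (\<Sum>i\<in>{1..3}. act i j (u i)))) = ln (\<Prod>i\<in>{1..3}. \<Prod>j\<in>{1..3}. cmod (f j (act i j (u i))))"
    by (rule arg_cong)
  also have "ln (\<Prod>j\<in>{1..3}. cmod (f j (\<Sum>i\<in>{1..3}. act i j (u i)))) = (\<Sum>j\<in>{1..3}. ln (cmod (f j (\<Sum>i\<in>{1..3}. act i j (u i)))))"
    by (intro ln_prod less_imp_neq[OF pos, symmetric] sum_Y act_Y u) auto
  also have "ln (\<Prod>i\<in>{1..3}. \<Prod>j\<in>{1..3}. cmod (f j (act i j (u i)))) = (\<Sum>i\<in>{1..3}. ln (\<Prod>j\<in>{1..3}. cmod (f j (act i j (u i)))))"
    by (intro ln_prod less_imp_neq[OF prod_pos, symmetric] pos act_Y u) auto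
  also have "\<dots> = (\<Sum>i\<in>{1..3}. \<Sum>j\<in>{1..3}. ln (cmod (f j (act i j (u i)))))"
    by (intro sum.cong refl ln_prod less_imp_neq[OF pos, symmetric] act_Y u) auto
  finally show ?thesis by (simp only: psi_def sum_negf)
qed

abbreviation col :: "nat \<Rightarrow> nat \<Rightarrow> real" where "col j \<equiv> (\<lambda>i. p i j)"
abbreviation \<Delta> :: real where "\<Delta> \<equiv> det3 (col 1) (col 2) (col 3)"

text \<open>Multiples of a kernel vector make every column sum vanish, so a sum of nonnegative
  values of \<open>psi\<close> is 0 and each of them is 0. Periodicity of |f| then follows from the
  equality case of Krein's inequality, and averaging applies to \<open>psi\<close> itself.\<close>

lemma unimodular_of_det_0:
  assumes det: "\<Delta> = 0" and j: "j \<in> {1..3}" and y: "y \<in> Y"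
  shows "cmod (f j y) = 1"
proof -
  have m: "1 \<in> {1..3::nat}" "2 \<in> {1..3::nat}" "3 \<in> {1..3::nat}" by auto
  obtain v :: "nat \<Rightarrow> real" and i0 where v: "\<And>i. i \<in> {1..3} \<Longrightarrow> H_endomorphism (v i)" "i0 \<in> {1..3}" "v i0 \<noteq> 0"
    "p 1 1 * v 1 + p 2 1 * v 2 + p 3 1 * v 3 = 0" "p 1 2 * v 1 + p 2 2 * v 2 + p 3 2 * v 3 = 0"
    "p 1 3 * v 1 + p 2 3 * v 2 + p 3 3 * v 3 = 0"
    using det3_zero_left_kernel[OF det p_nonzero[OF _ m(2)] p_endo[OF _ m(1)] p_endo[OF _ m(2)] p_endo[OF _ m(3)]]
    by blast
  have kernel: "(\<Sum>i\<in>{1..3}. p i k * v i) = 0" if "k \<in> {1..3}" for k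
    using that v(4-6) unfolding index_1_3 sum_1_3 by (elim disjE) (simp_all only:)
  obtain N where N: "N > 0" "\<And>x. x \<in> H_multiples N \<Longrightarrow> x / v i0 \<in> H"
    using divide_rational_in_H[OF H_endomorphism_Rats[OF v(1)[OF v(2)]] v(3)] by blast
  have psi_N: "psi k (x, 0) = 0" if k: "k \<in> {1..3}" and x: "x \<in> H_multiples N" for k x
  proof -
    \<comment> \<open>Chosen so that the term in row \<open>i0\<close> and column \<open>k\<close>
      is evaluated at \<open>x\<close>. Division by \<open>p i0 k\<close> stays in \<open>H\<close>;
      division by \<open>v i0\<close> is the reason for restricting \<open>x\<close> to
      \<open>H_multiples N\<close>.\<close>
    define h where "h = x / v i0 / p i0 k"
    have h: "h \<in> H" unfolding h_def by (rule p_divide_H[OF v(2) k N(2)[OF x]])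
    define u where "u i = (v i * h, 0 :: int)" for i
    have u: "u i \<in> Y" if "i \<in> {1..3}" for i
      using v(1)[OF that] h by (simp add: u_def H_endomorphism_def)
    have "(\<Sum>i\<in>{1..3}. act i k' (u i)) = 0" if "k' \<in> {1..3}" for k'
    proof -
      have "(\<Sum>i\<in>{1..3}. p i k' * (v i * h)) = (\<Sum>i\<in>{1..3}. p i k' * v i) * h"
        by (simp only: sum_distrib_right mult.assoc)
      then have "p 1 k' * (v 1 * h) + p 2 k' * (v 2 * h) + p 3 k' * (v 3 * h) = 0"
        unfolding kernel[OF that] sum_1_3 by simp
      then show ?thesis unfolding u_def act_pair_0 sum_1_3 add_Pair zero_prod_def by simp
    qed
    then have "(\<Sum>j\<in>{1..3}. psi j (\<Sum>i\<in>{1..3}. act i j (u i))) = 0"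
      by (intro sum.neutral) (use psi_0 in auto)
    then have sum0: "(\<Sum>i\<in>{1..3}. \<Sum>j\<in>{1..3}. psi j (act i j (u i))) = 0"
      using psi_functional_equation[of u, OF u] by simp
    have nn: "0 \<le> psi j (act i j (u i))" if "i \<in> {1..3}" "j \<in> {1..3}" for i j
      using psi_nonneg act_Y u that by blast
    have "(\<Sum>j\<in>{1..3}. psi j (act i0 j (u i0))) = 0"
      by (rule sum_nonneg_0[OF finite_atLeastAtMost _ sum0 v(2)]) (rule sum_nonneg[OF nn])
    from sum_nonneg_0[OF finite_atLeastAtMost nn[OF v(2)] this k] have "psi k (act i0 k (u i0)) = 0" .
    moreover have "act i0 k (u i0) = (x, 0)"
      using v(3) p_nonzero[OF v(2) k] by (simp add: u_def act_pair_0 h_def)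
    ultimately show ?thesis by simp
  qed
  have "psi j y = 0"
  proof (rule averaging[OF N(1), where B = psi])
    show "psi k (z + (d, 0)) = psi k z" if "k \<in> {1..3}" "z \<in> Y" "d \<in> H_multiples N" for k z d
    proof -
      have d: "(d, 0) \<in> Y" using H_multiples_subset[OF N(1) that(3)] by simp
      have "cmod (f k (d, 0)) = 1" using norm_f[OF that(1) d] psi_N[OF that(1,3)] by simp
      then show ?thesis using char_like_periodic[OF char_like_f[OF that(1)] that(2) d]
        by (simp add: psi_def norm_mult)
    qed
  qed (use psi_nonneg psi_even psi_functional_equation j y in auto)
  then show ?thesis using norm_f[OF j y] by simp
qed

lemma act_surj:
  assumes ij: "i \<in> {1..3}" "j \<in> {1..3}" and y: "y \<in> Y"
  shows "\<exists>z\<in>Y. act i j z = y"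
proof -
  define n where "n = e i j * snd y"
  define z where "z = ((fst y - of_int n * c i j) / p i j, n)"
  have "fst y - of_int n * c i j \<in> H" using y H_mult[OF c_H[OF ij]] by (intro H_diff) auto
  then have "z \<in> Y" using p_divide_H[OF ij] by (simp add: z_def)
  moreover have "e i j * n = snd y" using e_sign[OF ij] by (auto simp: n_def)
  then have "act i j z = y" using p_nonzero[OF ij] by (cases y) (simp add: act_def z_def)
  ultimately show ?thesis by blast
qed

text \<open>Three shifts are switched on and off independently. Column \<open>j\<close> sees all
  three, column \<open>j'\<close> does not see the first, column \<open>j''\<close> does not see the
  second, and each row contains at most two of them. So \<open>f j\<close> at the shifted point is a
  product of functions of two switches each.\<close>

lemma third_difference_identity:
  assumes det: "\<Delta> \<noteq> 0" and j: "j \<in> {1..3}"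
  shows "\<exists>N>0. \<forall>y\<in>Y. \<forall>x1\<in>H_multiples N. \<forall>x2\<in>H_multiples N. \<forall>x3\<in>H.
    f j (y + (x1 + x2 + x3, 0)) * f j (y + (x1, 0)) * f j (y + (x2, 0)) * f j (y + (x3, 0)) =
    f j (y + (x1 + x2, 0)) * f j (y + (x1 + x3, 0)) * f j (y + (x2 + x3, 0)) * f j y"
proof -
  obtain j' j'' where J: "{j, j', j''} = {1..3}" "j \<noteq> j'" "j \<noteq> j''" "j' \<noteq> j''"
    using exists_permutation[OF j] by blast
  have j': "j' \<in> {1..3}" "j'' \<in> {1..3}" using J(1) by blast+
  have "det3 (col j) (col j') (col j'') \<noteq> 0"
    using det3_permute[of "\<lambda>j i. p i j", OF det j j' J(2-4)] .
  then obtain i i' i'' where I: "{i, i', i''} = {1..3}" "i \<noteq> i'" "i \<noteq> i''" "i' \<noteq> i''"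
    and m1: "p i j * p i' j' - p i' j * p i j' \<noteq> 0" and m2: "p i j * p i'' j'' - p i'' j * p i j'' \<noteq> 0"
    using det3_row_choice[of "col j" "col j'" "col j''"] p_nonzero[OF _ j] by blast
  have i: "i \<in> {1..3}" "i' \<in> {1..3}" "i'' \<in> {1..3}" using I(1) by blast+
  \<comment> \<open>The displacements that the first two shifts cause in column \<open>j\<close> are
    \<open>h1 * \<mu>1\<close> and \<open>h2 * \<mu>2\<close>. Prescribing them as \<open>x1\<close>
    and \<open>x2\<close> requires division by these minors.\<close>
  define \<mu>1 where "\<mu>1 = p i j * p i' j' - p i' j * p i j'"
  define \<mu>2 where "\<mu>2 = p i j * p i'' j'' - p i'' j * p i j''"
  have \<mu>: "\<mu>1 \<noteq> 0" "\<mu>2 \<noteq> 0" "H_endomorphism \<mu>1" "H_endomorphism \<mu>2"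
    using m1 m2 by (auto simp: \<mu>1_def \<mu>2_def intro!: H_endomorphism_intros p_endo i j j')
  obtain N1 where N1: "N1 > 0" "\<And>x. x \<in> H_multiples N1 \<Longrightarrow> x / \<mu>1 \<in> H"
    using divide_rational_in_H[OF H_endomorphism_Rats[OF \<mu>(3)] \<mu>(1)] by blast
  obtain N2 where N2: "N2 > 0" "\<And>x. x \<in> H_multiples N2 \<Longrightarrow> x / \<mu>2 \<in> H"
    using divide_rational_in_H[OF H_endomorphism_Rats[OF \<mu>(4)] \<mu>(2)] by blast
  have "f j (y + (x1 + x2 + x3, 0)) * f j (y + (x1, 0)) * f j (y + (x2, 0)) * f j (y + (x3, 0)) =
    f j (y + (x1 + x2, 0)) * f j (y + (x1 + x3, 0)) * f j (y + (x2 + x3, 0)) * f j y"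
    if y: "y \<in> Y" and x1: "x1 \<in> H_multiples (N1 * N2)" and x2: "x2 \<in> H_multiples (N1 * N2)" and x3: "x3 \<in> H"
    for y x1 x2 x3
  proof -
    define h1 where "h1 = x1 / \<mu>1"
    define h2 where "h2 = x2 / \<mu>2"
    define h3 where "h3 = x3 / p i' j"
    have h: "h1 \<in> H" "h2 \<in> H" "h3 \<in> H"
      unfolding h1_def h2_def h3_def
      using N1(2) N2(2) H_multiples_of_mult[OF N1(1) N2(1) x1]
        H_multiples_of_mult[OF N2(1) N1(1), of x2] x2 p_divide_H[OF i(2) j x3] by (simp_all add: mult.commute)
    obtain z where z: "z \<in> Y" "act i j z = y" using act_surj[OF i(1) j y] by blast
    \<comment> \<open>The first shift uses the coefficients \<open>p i' j'\<close> and
      \<open>- p i j'\<close> in rows \<open>i\<close> and \<open>i'\<close>, which cancel in column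
      \<open>j'\<close>. The second uses \<open>p i'' j''\<close> and \<open>- p i j''\<close> in
      rows \<open>i\<close> and \<open>i''\<close>, which cancel in column \<open>j''\<close>. The
      third acts in row \<open>i'\<close> only.\<close>
    define g1 where "g1 a b = z + (of_bool a * (p i' j' * h1) + of_bool b * (p i'' j'' * h2), 0)" for a b
    define g2 where "g2 a c = (of_bool c * h3 - of_bool a * (p i j' * h1), 0 :: int)" for a c
    define g3 where "g3 b = (- (of_bool b * (p i j'' * h2)), 0 :: int)" for b
    define U where "U a b c k = (if k = i then g1 a b else if k = i' then g2 a c else g3 b)" for a b c k
    have pH: "p k l * x \<in> H" if "k \<in> {1..3}" "l \<in> {1..3}" "x \<in> H" for k l x
      using p_endo[OF that(1,2)] that(3) by (simp add: H_endomorphism_def)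
    have bH: "of_bool a * x \<in> H" if "x \<in> H" for a and x :: real using that by (cases a) auto
    have gY: "g1 a b \<in> Y" "g2 a c \<in> Y" "g3 b \<in> Y" for a b c
      unfolding g1_def g2_def g3_def using z(1) h
      by (auto intro!: H_add H_diff H_minus bH pH i j j')
    have UY: "U a b c k \<in> Y" for a b c k using gY by (simp add: U_def)
    have sumU: "(\<Sum>k\<in>{1..3}. act k l (U a b c k)) = act i l z +
        (of_bool a * h1 * (p i l * p i' j' - p i' l * p i j') +
         of_bool b * h2 * (p i l * p i'' j'' - p i'' l * p i j'') + of_bool c * (p i' l * h3), 0)" for a b c l
      unfolding sum_permuted[OF I] U_def g1_def g2_def g3_def act_add act_pair_0 using I(2-4)
      by (simp add: act_add act_pair_0 algebra_simps)
    define F where "F a b c = f j (y + (of_bool a * x1 + of_bool b * x2 + of_bool c * x3, 0))" for a b c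
    define P' where "P' b c = f j' (act i j' z + (of_bool b * h2 * (p i j' * p i'' j'' - p i'' j' * p i j'') + of_bool c * (p i' j' * h3), 0))" for b c
    define P'' where "P'' a c = f j'' (act i j'' z + (of_bool a * h1 * (p i j'' * p i' j' - p i' j'' * p i j') + of_bool c * (p i' j'' * h3), 0))" for a c
    define Q1 where "Q1 a b = (\<Prod>l\<in>{1..3}. f l (act i l (g1 a b)))" for a b
    define Q2 where "Q2 a c = (\<Prod>l\<in>{1..3}. f l (act i' l (g2 a c)))" for a c
    define Q3 where "Q3 b = (\<Prod>l\<in>{1..3}. f l (act i'' l (g3 b)))" for b
    have col_j: "f j (\<Sum>k\<in>{1..3}. act k j (U a b c k)) = F a b c" for a b c
    proof -
      have "h1 * (p i j * p i' j' - p i' j * p i j') = x1" "h2 * (p i j * p i'' j'' - p i'' j * p i j'') = x2"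
        "p i' j * h3 = x3"
        using \<mu> p_nonzero[OF i(2) j] by (simp_all add: h1_def h2_def h3_def \<mu>1_def \<mu>2_def)
      then show ?thesis unfolding sumU F_def z(2) by (simp add: mult.assoc)
    qed
    have col_j': "f j' (\<Sum>k\<in>{1..3}. act k j' (U a b c k)) = P' b c" for a b c
      unfolding sumU P'_def by (simp add: mult.commute)
    have col_j'': "f j'' (\<Sum>k\<in>{1..3}. act k j'' (U a b c k)) = P'' a c" for a b c
      unfolding sumU P''_def by (simp add: mult.commute)
    have nz: "f l (\<Sum>k\<in>{1..3}. act k l (U a b c k)) \<noteq> 0" if "l \<in> {1..3}" for a b c l
      by (rule char_like_nonzero[OF char_like_f[OF that] sum_Y[OF act_Y[OF _ that UY]]])
    have "F a b c * P' b c * P'' a c = Q1 a b * Q2 a c * Q3 b" for a b c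
    proof -
      have rows: "U a b c i = g1 a b" "U a b c i' = g2 a c" "U a b c i'' = g3 b"
        using I(2-4) by (simp_all add: U_def)
      have "(\<Prod>l\<in>{1..3}. f l (\<Sum>k\<in>{1..3}. act k l (U a b c k))) = F a b c * P' b c * P'' a c"
        by (subst prod_permuted[OF J]) (simp only: col_j col_j' col_j'')
      moreover have "(\<Prod>k\<in>{1..3}. \<Prod>l\<in>{1..3}. f l (act k l (U a b c k))) = Q1 a b * Q2 a c * Q3 b"
        by (subst prod_permuted[OF I]) (simp only: rows Q1_def Q2_def Q3_def)
      ultimately show ?thesis using functional_equation[of "U a b c", OF UY] by simp
    qed
    then have "F a b c = Q1 a b * (Q2 a c / P'' a c) * (Q3 b / P' b c)" for a b c
      using nz[OF j'(1), of a b c, unfolded col_j'] nz[OF j'(2), of a b c, unfolded col_j'']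
      by (simp add: field_simps)
    from cube_identity[of F Q1 "\<lambda>a c. Q2 a c / P'' a c" "\<lambda>b c. Q3 b / P' b c", OF this]
    show ?thesis by (simp add: F_def zero_prod_def[symmetric])
  qed
  then show ?thesis using N1(1) N2(1) by (intro exI[of _ "N1 * N2"]) simp
qed

end

context linear_forms
begin

text \<open>The solution is the transposed cofactor matrix applied to \<open>z\<close>. Keeping the
  determinant on the right side avoids division, so the solution stays in
  \<open>H_multiples N\<close>.\<close>

lemma solve_linear_system:
  assumes z: "\<And>k. k \<in> {1..3} \<Longrightarrow> z k \<in> H_multiples N"
  shows "\<exists>v. (\<forall>i\<in>{1..3}. v i \<in> H_multiples N) \<and>
    (\<forall>k\<in>{1..3}. (\<Sum>i\<in>{1..3}. p i k * v i) = det3 (\<lambda>i. p i 1) (\<lambda>i. p i 2) (\<lambda>i. p i 3) * z k)"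
proof -
  have m: "1 \<in> {1..3::nat}" "2 \<in> {1..3::nat}" "3 \<in> {1..3::nat}" by auto
  define v1 where "v1 = (p 2 2 * p 3 3 - p 3 2 * p 2 3) * z 1 + (p 2 3 * p 3 1 - p 3 3 * p 2 1) * z 2 + (p 2 1 * p 3 2 - p 3 1 * p 2 2) * z 3"
  define v2 where "v2 = (p 3 2 * p 1 3 - p 1 2 * p 3 3) * z 1 + (p 3 3 * p 1 1 - p 1 3 * p 3 1) * z 2 + (p 3 1 * p 1 2 - p 1 1 * p 3 2) * z 3"
  define v3 where "v3 = (p 1 2 * p 2 3 - p 2 2 * p 1 3) * z 1 + (p 1 3 * p 2 1 - p 2 3 * p 1 1) * z 2 + (p 1 1 * p 2 2 - p 2 1 * p 1 2) * z 3"
  define v where "v i = (if i = 1 then v1 else if i = 2 then v2 else v3)" for i :: nat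
  have v: "v 1 = v1" "v 2 = v2" "v 3 = v3" by (simp_all add: v_def)
  note pe = p_endo[OF m(1) m(1)] p_endo[OF m(1) m(2)] p_endo[OF m(1) m(3)] p_endo[OF m(2) m(1)]
    p_endo[OF m(2) m(2)] p_endo[OF m(2) m(3)] p_endo[OF m(3) m(1)] p_endo[OF m(3) m(2)] p_endo[OF m(3) m(3)]
  have "v1 \<in> H_multiples N" "v2 \<in> H_multiples N" "v3 \<in> H_multiples N"
    unfolding v1_def v2_def v3_def
    by (intro H_multiples_add H_endomorphism_multiples H_endomorphism_mult H_endomorphism_diff pe z m)+
  then have "\<forall>i\<in>{1..3}. v i \<in> H_multiples N" by (simp add: v_def)
  moreover have "(\<Sum>i\<in>{1..3}. p i k * v i) = det3 (\<lambda>i. p i 1) (\<lambda>i. p i 2) (\<lambda>i. p i 3) * z k" if "k \<in> {1..3}" for k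
    using that unfolding index_1_3 sum_1_3 v det3_def v1_def v2_def v3_def
    by (elim disjE) (simp_all add: algebra_simps del: One_nat_def)
  ultimately show ?thesis by blast
qed

end

context independent_linear_forms
begin

lemma common_third_difference_identity:
  assumes det: "\<Delta> \<noteq> 0"
  shows "\<exists>N. \<forall>j\<in>{1..3}. third_difference_free a N (f j)"
proof -
  have "\<forall>j\<in>{1..3}. \<exists>N. third_difference_free a N (f j)"
  proof
    fix j assume j: "j \<in> {1..3::nat}"
    from third_difference_identity[OF det j] obtain N where "N > 0"
      and "\<forall>y\<in>Y. \<forall>x1\<in>H_multiples N. \<forall>x2\<in>H_multiples N. \<forall>x3\<in>H.
        f j (y + (x1 + x2 + x3, 0)) * f j (y + (x1, 0)) * f j (y + (x2, 0)) * f j (y + (x3, 0)) =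
        f j (y + (x1 + x2, 0)) * f j (y + (x1 + x3, 0)) * f j (y + (x2 + x3, 0)) * f j y" by (elim exE conjE)
    then have "third_difference_free a N (f j)"
      by unfold_locales (use char_like_f[OF j] in blast)+
    then show "\<exists>N. third_difference_free a N (f j)" by blast
  qed
  then obtain N where N: "\<And>j. j \<in> {1..3} \<Longrightarrow> third_difference_free a (N j) (f j)" by metis
  have pos: "N j > 0" if "j \<in> {1..3}" for j using N[OF that] by (rule third_difference_free.N_pos)
  define M where "M = (\<Prod>j\<in>{1..3}. N j)"
  have "third_difference_free a M (f j)" if j: "j \<in> {1..3}" for j
  proof -
    define K where "K = (\<Prod>i\<in>{1..3}-{j}. N i)"
    have K: "K > 0" unfolding K_def using pos by (intro prod_pos) blast
    have M: "M = N j * K" unfolding M_def K_def using j by (intro prod.remove) auto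
    have sub: "x \<in> H_multiples (N j)" if "x \<in> H_multiples M" for x
      using H_multiples_of_mult[OF pos[OF j] K] that M by simp
    interpret T: third_difference_free a "N j" "f j" by (rule N[OF j])
    show ?thesis
    proof
      show "M > 0" using M K pos[OF j] by simp
      show "char_like (f j)" by (rule T.f)
    qed (use T.third_difference sub in blast)
  qed
  then show ?thesis by blast
qed

text \<open>The infimum \<open>B\<close> of \<open>psi\<close> over a coset of \<open>N H\<close> is
  even, periodic and nonnegative. It satisfies the averaging inequality because shifts of the
  arguments by elements of \<open>N H\<close> can bring all three column sums near their infima
  simultaneously.\<close>

lemma unit_supremum:
  assumes det: "\<Delta> \<noteq> 0" and N: "\<And>j. j \<in> {1..3} \<Longrightarrow> third_difference_free a N (f j)"
    and j: "j \<in> {1..3}" and y: "y \<in> Y" and "\<epsilon> > 0"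
  shows "\<exists>x\<in>H_multiples N. cmod (f j (y + (x, 0))) > 1 - \<epsilon>"
proof -
  have N_pos: "N > 0" using N[OF j] by (rule third_difference_free.N_pos)
  have Y_shift: "y + (x, 0) \<in> Y" if "y \<in> Y" "x \<in> H_multiples N" for x y
    using that H_multiples_subset[OF N_pos that(2)] by (intro Y_add) auto
  have \<Delta>_endo: "H_endomorphism \<Delta>" unfolding det3_def
    by (intro H_endomorphism_intros p_endo) auto
  have quadratic: "\<exists>b c. \<forall>x\<in>H_multiples N. psi k (z + (x, 0)) = psi k z + b * x + c * x\<^sup>2"
    if "k \<in> {1..3}" "z \<in> Y" for k z
    using third_difference_free.psi_quadratic[OF N[OF that(1)] that(2)]
    by (simp only: third_difference_free.\<psi>_def[OF N[OF that(1)]] psi_def)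
  define B where "B k z = (INF x\<in>H_multiples N. psi k (z + (x, 0)))" for k z
  have nonneg: "0 \<le> psi k (z + (x, 0))" if "k \<in> {1..3}" "z \<in> Y" "x \<in> H_multiples N" for k z x
    using psi_nonneg[OF that(1) Y_shift[OF that(2,3)]] .
  have bdd: "bdd_below ((\<lambda>x. psi k (z + (x, 0))) ` H_multiples N)" if "k \<in> {1..3}" "z \<in> Y" for k z
    using nonneg[OF that] by (intro bdd_belowI[of _ 0]) blast
  have ne: "H_multiples N \<noteq> {}" using H_multiples_0 by blast
  have B_nonneg: "0 \<le> B k z" if "k \<in> {1..3}" "z \<in> Y" for k z
    unfolding B_def by (rule cINF_greatest[OF ne nonneg[OF that]])
  have B_le: "B k z \<le> psi k (z + (x, 0))" if "k \<in> {1..3}" "z \<in> Y" "x \<in> H_multiples N" for k z x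
    unfolding B_def by (rule cINF_lower[OF bdd[OF that(1,2)] that(3)])
  \<comment> \<open>The linear system is solved only for displacements in \<open>\<Delta>\<close>
    times \<open>N H\<close>. This smaller set does not change the infimum: \<open>psi\<close> is a
    quadratic polynomial along the coset, hence continuous there, and such displacements are
    dense.\<close>
  have approx: "\<exists>x\<in>H_multiples N. psi k (z + (\<Delta> * x, 0)) < B k z + \<delta>"
    if k: "k \<in> {1..3}" and z: "z \<in> Y" and \<delta>: "\<delta> > 0" for k z \<delta>
  proof -
    have "B k z < B k z + \<delta>" using \<delta> by simp
    then obtain x0 where x0: "x0 \<in> H_multiples N" "psi k (z + (x0, 0)) < B k z + \<delta>"
      unfolding B_def cINF_less_iff[OF ne bdd[OF k z]] by blast
    obtain b c where bc: "\<And>x. x \<in> H_multiples N \<Longrightarrow> psi k (z + (x, 0)) = psi k z + b * x + c * x\<^sup>2"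
      using quadratic[OF k z] by blast
    obtain w where w: "\<And>n. w n \<in> H_multiples N" "w \<longlonglongrightarrow> x0 / \<Delta>"
      using H_multiples_approx[OF N_pos] by blast
    have "(\<lambda>n. psi k z + b * (\<Delta> * w n) + c * (\<Delta> * w n)\<^sup>2) \<longlonglongrightarrow>
        psi k z + b * (\<Delta> * (x0 / \<Delta>)) + c * (\<Delta> * (x0 / \<Delta>))\<^sup>2"
      by (intro tendsto_intros w)
    moreover have "\<Delta> * (x0 / \<Delta>) = x0" using det by simp
    moreover have "psi k z + b * (\<Delta> * w n) + c * (\<Delta> * w n)\<^sup>2 = psi k (z + (\<Delta> * w n, 0))" for n
      using bc[OF H_endomorphism_multiples[OF \<Delta>_endo w(1)]] by simp
    ultimately have "(\<lambda>n. psi k (z + (\<Delta> * w n, 0))) \<longlonglongrightarrow> psi k (z + (x0, 0))"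
      using bc[OF x0(1)] by simp
    then have "\<forall>\<^sub>F n in sequentially. psi k (z + (\<Delta> * w n, 0)) < B k z + \<delta>"
      by (rule order_tendstoD(2)[OF _ x0(2)])
    then obtain n where "psi k (z + (\<Delta> * w n, 0)) < B k z + \<delta>"
      unfolding eventually_sequentially by blast
    then show ?thesis using w(1) by blast
  qed
  have "B j y = 0"
  proof (rule averaging[OF N_pos, where B = B])
    show "B k (- z) = B k z" if "k \<in> {1..3}" "z \<in> Y" for k z
    proof -
      have "psi k (- z + (- x, 0)) = psi k (z + (x, 0))" if "x \<in> H_multiples N" for x
        using psi_even[OF \<open>k \<in> {1..3}\<close> Y_shift[OF \<open>z \<in> Y\<close> that]] by (cases z) simp
      then have "(\<lambda>x. psi k (z + (x, 0))) ` H_multiples N = (\<lambda>x. psi k (- z + (x, 0))) ` uminus ` H_multiples N"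
        unfolding image_image by (intro image_cong) auto
      also have "uminus ` H_multiples N = H_multiples N"
      proof (intro equalityI subsetI)
        show "x \<in> uminus ` H_multiples N" if "x \<in> H_multiples N" for x
          using H_multiples_minus[OF that] by (intro image_eqI[of _ _ "- x"]) auto
      qed (use H_multiples_minus in auto)
      finally show ?thesis by (simp add: B_def)
    qed
    show "B k (z + (d, 0)) = B k z" if "k \<in> {1..3}" "z \<in> Y" "d \<in> H_multiples N" for k z d
    proof -
      have "(\<lambda>x. psi k (z + (d, 0) + (x, 0))) ` H_multiples N = (\<lambda>x. psi k (z + (x, 0))) ` (+) d ` H_multiples N"
        unfolding image_image by (intro image_cong) (auto simp: add.assoc)
      also have "(+) d ` H_multiples N = H_multiples N"
      proof (intro equalityI subsetI)
        show "x \<in> (+) d ` H_multiples N" if "x \<in> H_multiples N" for x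
          using H_multiples_add[OF H_multiples_minus[OF \<open>d \<in> H_multiples N\<close>] that]
          by (intro image_eqI[of _ _ "- d + x"]) auto
      qed (use H_multiples_add[OF that(3)] in auto)
      finally show ?thesis by (simp add: B_def)
    qed
    show "(\<Sum>i\<in>{1..3}. \<Sum>k\<in>{1..3}. B k (act i k (u i))) \<le> (\<Sum>k\<in>{1..3}. B k (\<Sum>i\<in>{1..3}. act i k (u i)))"
      if u: "\<And>i. i \<in> {1..3} \<Longrightarrow> u i \<in> Y" for u
    proof (rule field_le_epsilon)
      fix \<delta> :: real assume "\<delta> > 0"
      have SY: "(\<Sum>i\<in>{1..3}. act i k (u i)) \<in> Y" if "k \<in> {1..3}" for k
        by (rule sum_Y[OF act_Y[OF _ that u]])
      have "\<forall>k\<in>{1..3}. \<exists>x. x \<in> H_multiples N \<and>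
          psi k ((\<Sum>i\<in>{1..3}. act i k (u i)) + (\<Delta> * x, 0)) < B k (\<Sum>i\<in>{1..3}. act i k (u i)) + \<delta> / 3"
        using approx[OF _ SY, of _ _ "\<delta> / 3"] \<open>\<delta> > 0\<close> by (simp add: Bex_def)
      from bchoice[OF this] obtain z where z: "\<And>k. k \<in> {1..3} \<Longrightarrow> z k \<in> H_multiples N"
        and z_less: "\<And>k. k \<in> {1..3} \<Longrightarrow> psi k ((\<Sum>i\<in>{1..3}. act i k (u i)) + (\<Delta> * z k, 0)) <
          B k (\<Sum>i\<in>{1..3}. act i k (u i)) + \<delta> / 3" by blast
      obtain v where v: "\<And>i. i \<in> {1..3} \<Longrightarrow> v i \<in> H_multiples N"
        and v_eq: "\<And>k. k \<in> {1..3} \<Longrightarrow> (\<Sum>i\<in>{1..3}. p i k * v i) = \<Delta> * z k"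
        using solve_linear_system[of z, OF z] by blast
      define U where "U i = u i + (v i, 0)" for i
      have U: "U i \<in> Y" if "i \<in> {1..3}" for i unfolding U_def by (rule Y_shift[OF u[OF that] v[OF that]])
      have "(\<Sum>i\<in>{1..3}. \<Sum>k\<in>{1..3}. B k (act i k (u i))) \<le> (\<Sum>i\<in>{1..3}. \<Sum>k\<in>{1..3}. psi k (act i k (U i)))"
        unfolding U_def act_add act_pair_0
        by (intro sum_mono B_le act_Y u H_endomorphism_multiples p_endo v)
      also have "\<dots> = (\<Sum>k\<in>{1..3}. psi k (\<Sum>i\<in>{1..3}. act i k (U i)))"
        by (rule psi_functional_equation[of U, OF U, symmetric])
      also have "\<dots> \<le> (\<Sum>k\<in>{1..3}. B k (\<Sum>i\<in>{1..3}. act i k (u i)) + \<delta> / 3)"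
      proof (rule sum_mono)
        fix k assume k: "k \<in> {1..3::nat}"
        have "(\<Sum>i\<in>{1..3}. (p i k * v i, 0 :: int)) = (\<Sum>i\<in>{1..3}. p i k * v i, 0)"
          unfolding sum_1_3 add_Pair by simp
        then have "(\<Sum>i\<in>{1..3}. act i k (U i)) = (\<Sum>i\<in>{1..3}. act i k (u i)) + (\<Delta> * z k, 0)"
          unfolding U_def act_add act_pair_0 sum.distrib v_eq[OF k] by simp
        then show "psi k (\<Sum>i\<in>{1..3}. act i k (U i)) \<le> B k (\<Sum>i\<in>{1..3}. act i k (u i)) + \<delta> / 3"
          using z_less[OF k] by simp
      qed
      also have "\<dots> = (\<Sum>k\<in>{1..3}. B k (\<Sum>i\<in>{1..3}. act i k (u i))) + \<delta>"
        unfolding sum.distrib by simp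
      finally show "(\<Sum>i\<in>{1..3}. \<Sum>k\<in>{1..3}. B k (act i k (u i))) \<le> (\<Sum>k\<in>{1..3}. B k (\<Sum>i\<in>{1..3}. act i k (u i))) + \<delta>" .
    qed
  qed (use B_nonneg j y in auto)
  then have "(INF x\<in>H_multiples N. psi j (y + (x, 0))) < \<epsilon>" using \<open>\<epsilon> > 0\<close> by (simp add: B_def)
  then obtain x where x: "x \<in> H_multiples N" "psi j (y + (x, 0)) < \<epsilon>"
    unfolding cINF_less_iff[OF ne bdd[OF j y]] by blast
  have "cmod (f j (y + (x, 0))) = exp (- psi j (y + (x, 0)))" by (rule norm_f[OF j Y_shift[OF y x(1)]])
  moreover have "exp (- psi j (y + (x, 0))) \<ge> 1 + (- psi j (y + (x, 0)))" by (rule exp_ge_add_one_self)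
  ultimately show ?thesis using x by (intro bexI[of _ x]) auto
qed

lemma unimodular_or_gaussian_like:
  assumes j: "j \<in> {1..3}"
  shows "(\<forall>y\<in>Y. cmod (f j y) = 1) \<or> \<Delta> \<noteq> 0 \<and> (\<exists>s>0. \<exists>t l. gaussian_like (f j) s t l)"
proof (cases "\<Delta> = 0")
  case True
  then show ?thesis using unimodular_of_det_0 j by blast
next
  case False
  obtain N where N: "\<And>j. j \<in> {1..3} \<Longrightarrow> third_difference_free a N (f j)"
    using common_third_difference_identity[OF False] by blast
  interpret T: third_difference_free_sup_one a N "f j"
  proof (intro third_difference_free_sup_one.intro N j third_difference_free_sup_one_axioms.intro)
    show "\<exists>x\<in>H_multiples N. 1 - \<epsilon> < cmod (f j (y + (x, 0)))" if "y \<in> Y" "\<epsilon> > 0" for y \<epsilon>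
      by (rule unit_supremum[OF False N j that])
  qed
  show ?thesis using T.unimodular_or_gaussian_like False by blast
qed

text \<open>The three factors are treated together. Besides the orthogonality of the rows of
  \<open>p\<close>, the cross terms involving the integer coordinate tie each \<open>t k\<close> of
  positive weight to \<open>t j\<close> by an affine relation with rational coefficients, one for
  each row. Irrationality of \<open>t j\<close> forces the slopes of these relations to
  agree.\<close>

lemma gaussian_direction_rational:
  fixes s t :: "nat \<Rightarrow> real"
  assumes det: "\<Delta> \<noteq> 0" and s: "\<And>j. j \<in> {1..3} \<Longrightarrow> 0 \<le> s j"
    and psi: "\<And>j y. j \<in> {1..3} \<Longrightarrow> y \<in> Y \<Longrightarrow> psi j y = s j * (fst y + t j * of_int (snd y))\<^sup>2"
    and j: "j \<in> {1..3}" "s j > 0"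
  shows "t j \<in> \<rat>"
proof (rule ccontr)
  assume irrational: "t j \<notin> \<rat>"
  define lam where "lam k y = fst y + t k * of_int (snd y)" for k and y :: "real \<times> int"
  have psi': "psi k y = s k * (lam k y)\<^sup>2" if "k \<in> {1..3}" "y \<in> Y" for k y
    using psi[OF that] by (simp add: lam_def)
  have lam_add: "lam k (y + z) = lam k y + lam k z" for k y z by (simp add: lam_def algebra_simps)
  \<comment> \<open>Polarisation: only two of the three arguments are nonzero, and the pure squares
    cancel between the two sides of the functional equation.\<close>
  have orth: "(\<Sum>k\<in>{1..3}. s k * (lam k (act i k u) * lam k (act i' k v))) = 0"
    if i: "i \<in> {1..3}" "i' \<in> {1..3}" "i \<noteq> i'" and uv: "u \<in> Y" "v \<in> Y" for i i' u v
  proof -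
    have "\<exists>i''. {i, i', i''} = {1..3} \<and> i \<noteq> i'' \<and> i' \<noteq> i''"
    proof -
      obtain m m' where m: "{i, m, m'} = {1..3}" "i \<noteq> m" "i \<noteq> m'" "m \<noteq> m'"
        using exists_permutation[OF i(1)] by blast
      have "i' \<in> {i, m, m'}" unfolding m(1) by (rule i(2))
      then have "i' = m \<or> i' = m'" using i(3) by auto
      then show ?thesis using m by (elim disjE) (auto simp: insert_commute)
    qed
    then obtain i'' where I: "{i, i', i''} = {1..3}" "i \<noteq> i''" "i' \<noteq> i''" by blast
    define U where "U k = (if k = i then u else if k = i' then v else 0)" for k
    have U: "U i = u" "U i' = v" "U i'' = 0" using i(3) I(2,3) by (auto simp: U_def)
    have UY: "U k \<in> Y" for k using uv zero_Y by (simp only: U_def split: if_split) blast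
    have S: "(\<Sum>l\<in>{1..3}. act l k (U l)) = act i k u + act i' k v" for k
      by (subst sum_permuted[OF I(1) i(3) I(2,3)]) (simp only: U act_0 add_0_right)
    have Z: "(\<Sum>k\<in>{1..3}. psi k (act i'' k (U i''))) = 0"
      unfolding U act_0 by (intro sum.neutral ballI psi_0)
    have "(\<Sum>k\<in>{1..3}. psi k (act i k u + act i' k v)) =
        (\<Sum>k\<in>{1..3}. psi k (act i k u)) + (\<Sum>k\<in>{1..3}. psi k (act i' k v))"
      using psi_functional_equation[of U, OF UY] unfolding S
      by (subst (asm) sum_permuted[OF I(1) i(3) I(2,3), of "\<lambda>i. \<Sum>k\<in>{1..3}. psi k (act i k (U i))"])
        (simp only: U Z[unfolded U] add_0_right)
    then have "(\<Sum>k\<in>{1..3}. psi k (act i k u + act i' k v) - psi k (act i k u) - psi k (act i' k v)) = 0"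
      by (simp only: sum_subtractf)
    also have "(\<Sum>k\<in>{1..3}. psi k (act i k u + act i' k v) - psi k (act i k u) - psi k (act i' k v)) =
      (\<Sum>k\<in>{1..3}. 2 * (s k * (lam k (act i k u) * lam k (act i' k v))))"
    proof (rule sum.cong[OF refl])
      fix k assume k: "k \<in> {1..3::nat}"
      have "act i k u \<in> Y" "act i' k v \<in> Y" by (rule act_Y[OF i(1) k uv(1)], rule act_Y[OF i(2) k uv(2)])
      then show "psi k (act i k u + act i' k v) - psi k (act i k u) - psi k (act i' k v) =
          2 * (s k * (lam k (act i k u) * lam k (act i' k v)))"
        using psi'[OF k] Y_add[of "act i k u" "act i' k v"] by (simp only: lam_add) (simp add: power2_eq_square algebra_simps)
    qed
    finally show ?thesis by (simp add: sum_distrib_left[symmetric])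
  qed
  \<comment> \<open>The value of \<open>lam k\<close> at the image of the generator of the integer
    coordinate, just as \<open>p i k\<close> is its value at the image of
    \<open>(1, 0)\<close>.\<close>
  define w where "w i k = c i k + t k * of_int (e i k)" for i k
  have lam1: "lam k (act i k (1, 0)) = p i k" and lam2: "lam k (act i k (0, 1)) = w i k" for i k
    by (simp_all add: lam_def act_def w_def)
  have Y1: "(1, 0) \<in> Y" "(0, 1) \<in> Y" by simp_all
  have orth_p: "(\<Sum>k\<in>{1..3}. s k * (p i k * p i' k)) = 0" and orth_w: "(\<Sum>k\<in>{1..3}. s k * (p i k * w i' k)) = 0"
    if "i \<in> {1..3}" "i' \<in> {1..3}" "i \<noteq> i'" for i i'
    using orth[OF that Y1(1) Y1(1)] orth[OF that Y1(1) Y1(2)] unfolding lam1 lam2 .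
  \<comment> \<open>\<open>\<kappa>\<close> is the coefficient of the orthogonal projection of row
    \<open>i\<close> of \<open>w\<close> onto row \<open>i\<close> of \<open>p\<close>. The weighted
    remainder \<open>V\<close> is annihilated by every row of \<open>p\<close>, and \<open>p\<close>
    is invertible.\<close>
  have parallel: "\<exists>\<kappa>. \<forall>k\<in>{1..3}. s k \<noteq> 0 \<longrightarrow> w i k = \<kappa> * p i k" if i: "i \<in> {1..3}" for i
  proof -
    define G where "G = (\<Sum>k\<in>{1..3}. s k * (p i k * p i k))"
    have "G > 0" unfolding G_def
    proof (rule sum_pos2[OF finite_atLeastAtMost j(1)])
      show "0 < s j * (p i j * p i j)" using j(2) p_nonzero[OF i j(1)] by (auto simp: zero_less_mult_iff linorder_neq_iff)
    qed (use s in simp)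
    define \<kappa> where "\<kappa> = (\<Sum>k\<in>{1..3}. s k * (p i k * w i k)) / G"
    define V where "V k = s k * (w i k - \<kappa> * p i k)" for k
    have "(\<Sum>k\<in>{1..3}. p l k * V k) = 0" if l: "l \<in> {1..3}" for l
    proof -
      have "(\<Sum>k\<in>{1..3}. p l k * V k) = (\<Sum>k\<in>{1..3}. s k * (p l k * w i k) - \<kappa> * (s k * (p l k * p i k)))"
        by (intro sum.cong refl) (simp add: V_def algebra_simps)
      also have "\<dots> = (\<Sum>k\<in>{1..3}. s k * (p l k * w i k)) - \<kappa> * (\<Sum>k\<in>{1..3}. s k * (p l k * p i k))"
        by (simp only: sum_subtractf sum_distrib_left)
      also have "\<dots> = 0"
      proof (cases "l = i")
        case True
        show ?thesis unfolding True G_def[symmetric] \<kappa>_def using \<open>G > 0\<close> by simp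
      next
        case False
        then show ?thesis using orth_p[OF l i] orth_w[OF l i] by simp
      qed
      finally show ?thesis .
    qed
    then have "V 1 = 0 \<and> V 2 = 0 \<and> V 3 = 0"
      using det3_rows_zero[OF det, of "V 1" "V 2" "V 3"] unfolding sum_1_3 by blast
    then have "V k = 0" if "k \<in> {1..3}" for k using that unfolding index_1_3 by blast
    then have "w i k = \<kappa> * p i k" if "k \<in> {1..3}" "s k \<noteq> 0" for k
      using that unfolding V_def by fastforce
    then show ?thesis by blast
  qed
  have pc_Rats: "p i k \<in> \<rat>" "c i k \<in> \<rat>" if "i \<in> {1..3}" "k \<in> {1..3}" for i k
    using H_endomorphism_Rats[OF p_endo[OF that]] H_Rats[OF c_H[OF that]] by blast+
  define \<epsilon> where "\<epsilon> i k = real_of_int (e i k * e i j)" for i k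
  \<comment> \<open>The slope of the affine relation between \<open>t k\<close> and
    \<open>t j\<close> obtained from row \<open>i\<close>; the sign arises on solving for
    \<open>t k\<close>.\<close>
  define \<alpha> where "\<alpha> i k = \<epsilon> i k * p i k / p i j" for i k
  have \<epsilon>: "\<epsilon> i k = 1 \<or> \<epsilon> i k = - 1" if "i \<in> {1..3}" "k \<in> {1..3}" for i k
    using e_sign[OF that] e_sign[OF that(1) j(1)] by (auto simp: \<epsilon>_def)
  have \<alpha>_const: "\<alpha> i k = \<alpha> i' k" if ik: "i \<in> {1..3}" "i' \<in> {1..3}" "k \<in> {1..3}" "s k \<noteq> 0" for i i' k
  proof -
    have t_eq: "\<exists>\<beta>\<in>\<rat>. t k = \<beta> + \<alpha> l k * t j" if l: "l \<in> {1..3}" for l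
    proof -
      obtain \<kappa> where \<kappa>: "w l k = \<kappa> * p l k" "w l j = \<kappa> * p l j"
        using parallel[OF l] ik(3,4) j by (metis less_irrefl)
      have "w l k = w l j * p l k / p l j" using \<kappa> p_nonzero[OF l j(1)] by simp
      then have "of_int (e l k) * (c l k + t k * of_int (e l k)) =
          of_int (e l k) * ((c l j + t j * of_int (e l j)) * p l k / p l j)" by (simp only: w_def)
      moreover have "of_int (e l k) * (c l k + t k * of_int (e l k)) = of_int (e l k) * c l k + t k"
        using e_sign[OF l ik(3)] by (auto simp: algebra_simps)
      ultimately have "t k = (of_int (e l k) * (c l j * p l k / p l j) - of_int (e l k) * c l k) + \<alpha> l k * t j"
        by (simp add: \<alpha>_def \<epsilon>_def algebra_simps add_divide_distrib)
      moreover have "of_int (e l k) * (c l j * p l k / p l j) - of_int (e l k) * c l k \<in> \<rat>"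
        by (intro Rats_diff Rats_mult Rats_divide Rats_of_int pc_Rats l j(1) ik(3))
      ultimately show ?thesis by blast
    qed
    obtain b b' where b: "b \<in> \<rat>" "b' \<in> \<rat>" "t k = b + \<alpha> i k * t j" "t k = b' + \<alpha> i' k * t j"
      using t_eq[OF ik(1)] t_eq[OF ik(2)] by blast
    show ?thesis
    proof (rule ccontr)
      assume ne: "\<alpha> i k \<noteq> \<alpha> i' k"
      then have "t j = (b' - b) / (\<alpha> i k - \<alpha> i' k)" using b by (simp add: field_simps)
      moreover have "\<alpha> l k \<in> \<rat>" if "l \<in> {1..3}" for l
        unfolding \<alpha>_def \<epsilon>_def by (intro Rats_divide Rats_mult Rats_of_int pc_Rats that ik(3) j(1))
      ultimately have "t j \<in> \<rat>" using b(1,2) ik(1,2) by (simp only: Rats_divide Rats_diff)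
      then show False using irrational by contradiction
    qed
  qed
  \<comment> \<open>The weights left after replacing row \<open>i\<close> of \<open>p\<close> by
    \<open>p i j\<close> times a sign vector: the common factors \<open>\<alpha> 1 k\<close> enter
    squared.\<close>
  define r where "r k = s k * (\<alpha> 1 k)\<^sup>2" for k
  have one: "(1::nat) \<in> {1..3}" by simp
  have orth_signs: "(\<Sum>k\<in>{1..3}. r k * (\<epsilon> i k * \<epsilon> i' k)) = 0" if ii: "i \<in> {1..3}" "i' \<in> {1..3}" "i \<noteq> i'" for i i'
  proof -
    have "s k * (p i k * p i' k) = (p i j * p i' j) * (r k * (\<epsilon> i k * \<epsilon> i' k))" if k: "k \<in> {1..3}" for k
    proof (cases "s k = 0")
      case False
      have pe: "p l k = \<alpha> 1 k * \<epsilon> l k * p l j" if l: "l \<in> {1..3}" for l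
        using \<alpha>_const[OF one l k False] \<epsilon>[OF l k] p_nonzero[OF l j(1)] unfolding \<alpha>_def by auto
      show ?thesis unfolding pe[OF ii(1)] pe[OF ii(2)] by (simp add: r_def power2_eq_square)
    qed (simp add: r_def)
    then have "(\<Sum>k\<in>{1..3}. s k * (p i k * p i' k)) = (\<Sum>k\<in>{1..3}. (p i j * p i' j) * (r k * (\<epsilon> i k * \<epsilon> i' k)))"
      by (intro sum.cong refl) blast
    then have "(p i j * p i' j) * (\<Sum>k\<in>{1..3}. r k * (\<epsilon> i k * \<epsilon> i' k)) = 0"
      using orth_p[OF ii] by (simp only: sum_distrib_left)
    then show ?thesis using p_nonzero[OF ii(1) j(1)] p_nonzero[OF ii(2) j(1)] by simp
  qed
  obtain k k' where K: "{j, k, k'} = {1..3}" "j \<noteq> k" "j \<noteq> k'" "k \<noteq> k'"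
    using exists_permutation[OF j(1)] by blast
  have kk: "k \<in> {1..3}" "k' \<in> {1..3}" using K(1) by blast+
  have \<epsilon>j: "\<epsilon> i j = 1" if "i \<in> {1..3}" for i using e_sign[OF that j(1)] by (auto simp: \<epsilon>_def)
  have rj: "r j = s j" using p_nonzero[OF one j(1)] \<epsilon>j[OF one] by (simp add: r_def \<alpha>_def)
  have r_nonneg: "0 \<le> r l" if "l \<in> {1..3}" for l using s[OF that] by (simp add: r_def)
  have eq: "r j + r k * (\<epsilon> i k * \<epsilon> i' k) + r k' * (\<epsilon> i k' * \<epsilon> i' k') = 0"
    if ii: "i \<in> {1..3}" "i' \<in> {1..3}" "i \<noteq> i'" for i i'
  proof -
    have "r j * (\<epsilon> i j * \<epsilon> i' j) + r k * (\<epsilon> i k * \<epsilon> i' k) + r k' * (\<epsilon> i k' * \<epsilon> i' k') = 0"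
      using orth_signs[OF ii] by (subst (asm) sum_permuted[OF K])
    then show ?thesis by (simp only: \<epsilon>j[OF ii(1)] \<epsilon>j[OF ii(2)] mult_1_right)
  qed
  have m: "1 \<in> {1..3::nat}" "2 \<in> {1..3::nat}" "3 \<in> {1..3::nat}" by auto
  show False
  proof (rule orthogonal_sign_vectors_contradiction[where ?s1.0 = "r j" and ?s2.0 = "r k" and ?s3.0 = "r k'"
        and ?e2.0 = "\<lambda>i. \<epsilon> i k" and ?e3.0 = "\<lambda>i. \<epsilon> i k'"])
    show "r j > 0" using rj j(2) by simp
  qed (use r_nonneg[OF kk(1)] r_nonneg[OF kk(2)] \<epsilon>[OF m(1) kk(1)] \<epsilon>[OF m(2) kk(1)] \<epsilon>[OF m(3) kk(1)]
      \<epsilon>[OF m(1) kk(2)] \<epsilon>[OF m(2) kk(2)] \<epsilon>[OF m(3) kk(2)] eq[OF m(1) m(2)] eq[OF m(1) m(3)] eq[OF m(2) m(3)] in simp_all)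
qed

text \<open>The rationality argument needs a quadratic exponent for all three factors. Unimodular
  factors enter it with weight 0, whatever their \<open>t\<close>.\<close>

theorem unimodular_or_rational_gaussian_like:
  assumes j: "j \<in> {1..3}"
  shows "(\<forall>y\<in>Y. cmod (f j y) = 1) \<or> (\<exists>s>0. \<exists>t\<in>\<rat>. \<exists>l. gaussian_like (f j) s t l)"
proof (cases "\<forall>y\<in>Y. cmod (f j y) = 1")
  case False
  have "\<exists>s t l. k \<in> {1..3} \<longrightarrow> 0 \<le> s \<and> (\<forall>y\<in>Y. cmod (f k y) = exp (- (s * (fst y + t * of_int (snd y))\<^sup>2))) \<and>
      ((\<forall>y\<in>Y. cmod (f k y) = 1) \<or> 0 < s \<and> gaussian_like (f k) s t l)" for k
  proof (cases "k \<in> {1..3}")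
    case k: True
    from unimodular_or_gaussian_like[OF k] show ?thesis
    proof (elim disjE conjE exE)
      assume "\<forall>y\<in>Y. cmod (f k y) = 1"
      then show ?thesis by (intro exI[of _ 0]) simp
    next
      fix s t l assume *: "s > 0" "gaussian_like (f k) s t l"
      then have "\<forall>y\<in>Y. cmod (f k y) = exp (- (s * (fst y + t * of_int (snd y))\<^sup>2))"
        unfolding gaussian_like_def by (simp add: norm_mult)
      then show ?thesis using * by (intro exI[of _ s] exI[of _ t] exI[of _ l]) simp
    qed
  next
    case False
    then show ?thesis by blast
  qed
  then obtain s t l where stl: "\<And>k. k \<in> {1..3} \<Longrightarrow> 0 \<le> s k"
    "\<And>k y. k \<in> {1..3} \<Longrightarrow> y \<in> Y \<Longrightarrow> cmod (f k y) = exp (- (s k * (fst y + t k * of_int (snd y))\<^sup>2))"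
    "\<And>k. k \<in> {1..3} \<Longrightarrow> (\<forall>y\<in>Y. cmod (f k y) = 1) \<or> 0 < s k \<and> gaussian_like (f k) (s k) (t k) (l k)"
    by metis
  have sj: "0 < s j" "gaussian_like (f j) (s j) (t j) (l j)" using stl(3)[OF j] False by blast+
  have "\<Delta> \<noteq> 0" using unimodular_or_gaussian_like[OF j] False by blast
  then have "t j \<in> \<rat>"
    by (rule gaussian_direction_rational[of s t, OF _ stl(1) _ j sj(1)]) (simp_all only: psi_def stl(2) ln_exp minus_minus)
  then show ?thesis using sj by blast
qed blast

end

section \<open>The group of adic integers\<close>

context adic_base
begin

text \<open>The integer with the first \<open>k\<close> mixed-radix digits of \<open>x\<close>. It
  represents \<open>x\<close> modulo \<open>A k\<close> and presents the adic integers as compatible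
  residues, which removes the carries from later arguments.\<close>

definition val :: "nat \<Rightarrow> (nat \<Rightarrow> int) \<Rightarrow> int"
  where "val k x = (\<Sum>i<k. x i * A i)"

abbreviation \<Delta> :: "(nat \<Rightarrow> int) set" where "\<Delta> \<equiv> carrier (adic_group a)"

lemma carrier_adic_group: "x \<in> \<Delta> \<longleftrightarrow> (\<forall>n. 0 \<le> x n \<and> x n < a n)"
  by (auto simp: adic_group_def PiE_iff)

lemma val_0 [simp]: "val 0 x = 0"
  by (simp add: val_def)

lemma val_Suc: "val (Suc k) x = val k x + x k * A k"
  by (simp add: val_def)

lemma val_bounds: assumes "x \<in> \<Delta>" shows "0 \<le> val k x \<and> val k x < A k"
proof (induction k)
  case (Suc k)
  have "0 \<le> x k \<and> x k < a k" using assms unfolding carrier_adic_group by (rule spec)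
  then have x: "0 \<le> x k" "x k + 1 \<le> a k" by linarith+
  have "0 \<le> x k * A k" using x by (simp add: less_imp_le)
  moreover have "(x k + 1) * A k \<le> a k * A k" using x(2) by (intro mult_right_mono) (auto simp: less_imp_le)
  ultimately show ?case using Suc by (simp add: val_Suc A_Suc algebra_simps)
qed simp

lemma val_mod: "x \<in> \<Delta> \<Longrightarrow> val k x mod A k = val k x"
  using val_bounds[of x k] by simp

lemma val_inject:
  assumes "x \<in> \<Delta>" "y \<in> \<Delta>" "\<And>k. A k dvd val k x - val k y"
  shows "x = y"
proof
  fix k
  have eq: "val k x = val k y" for k
    using assms val_mod by (metis mod_eq_dvd_iff)
  have "x k * A k = y k * A k" using eq[of "Suc k"] eq[of k] by (simp add: val_Suc)
  then show "x k = y k" by simp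
qed

text \<open>Surjectivity onto compatible residues: digit \<open>k\<close> is read off the residue of
  \<open>v (Suc k)\<close> modulo \<open>A (Suc k)\<close>, and compatibility ensures that the
  earlier digits agree.\<close>

lemma exists_digits:
  assumes v: "\<And>k. A k dvd v (Suc k) - v k"
  shows "\<exists>x\<in>\<Delta>. \<forall>k. A k dvd val k x - v k"
proof -
  define x where "x k = (v (Suc k) mod A (Suc k)) div A k" for k
  have x: "x \<in> \<Delta>" unfolding carrier_adic_group
  proof
    fix n
    have "0 \<le> v (Suc n) mod A (Suc n)" "v (Suc n) mod A (Suc n) < A n * a n"
      using A_pos[of "Suc n"] by (auto simp flip: A_Suc)
    moreover have "(v (Suc n) mod A (Suc n)) div A n * A n \<le> v (Suc n) mod A (Suc n)"
      using mod_div_mult_eq[of "v (Suc n) mod A (Suc n)" "A n"] pos_mod_sign[OF A_pos, of "v (Suc n) mod A (Suc n)" n] by linarith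
    ultimately have "x n * A n < a n * A n" "0 \<le> v (Suc n) mod A (Suc n)" unfolding x_def by (simp_all only: mult.commute[of "A n"])
    moreover from this(1) have "x n < a n" by (rule mult_right_less_imp_less) (simp add: less_imp_le)
    ultimately show "0 \<le> x n \<and> x n < a n"
      unfolding x_def by (simp add: pos_imp_zdiv_nonneg_iff)
  qed
  have "val k x = v k mod A k" for k
  proof (induction k)
    case (Suc k)
    have "v (Suc k) mod A (Suc k) mod A k = v (Suc k) mod A k"
      by (simp add: A_Suc mod_mod_cancel)
    also have "\<dots> = v k mod A k" using v[of k] by (simp add: mod_eq_dvd_iff)
    finally have "v (Suc k) mod A (Suc k) = v k mod A k + x k * A k"
      using mod_div_mult_eq[of "v (Suc k) mod A (Suc k)" "A k"] by (simp add: x_def)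
    then show ?case using Suc by (simp add: val_Suc)
  qed simp
  then have "\<forall>k. A k dvd val k x - v k" by (simp add: mod_eq_dvd_iff[symmetric])
  then show ?thesis using x by blast
qed

text \<open>The carry out of position \<open>k\<close> has weight \<open>A (Suc k)\<close>, so
  addition with carry is ordinary addition modulo each \<open>A k\<close>.\<close>

lemma val_adic_add_carry:
  "val (Suc k) x + val (Suc k) y = val (Suc k) (adic_add a x y) + adic_carry a x y k * A (Suc k)"
proof (induction k)
  case 0
  show ?case using mod_div_mult_eq[of "x 0 + y 0" "a 0"] by (simp add: val_Suc A_Suc algebra_simps)
next
  case (Suc k)
  define s where "s = x (Suc k) + y (Suc k) + adic_carry a x y k"
  have "val (Suc (Suc k)) x + val (Suc (Suc k)) y = val (Suc k) (adic_add a x y) + s * A (Suc k)"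
    using Suc unfolding val_Suc[of "Suc k"] s_def by (simp add: algebra_simps)
  also have "s * A (Suc k) = (s mod a (Suc k)) * A (Suc k) + (s div a (Suc k)) * A (Suc (Suc k))"
    using mod_div_mult_eq[of s "a (Suc k)"] unfolding A_Suc[of "Suc k"] by (metis distrib_right mult.assoc mult.commute)
  finally show ?case unfolding val_Suc[of "Suc k"] by (simp add: s_def)
qed

lemma val_adic_add: "A k dvd val k (adic_add a x y) - (val k x + val k y)"
proof (cases k)
  case (Suc j)
  show ?thesis using val_adic_add_carry[of j x y] Suc by simp
qed simp

lemma adic_mult [simp]: "x \<otimes>\<^bsub>adic_group a\<^esub> y = adic_add a x y"
  by (simp add: adic_group_def)

lemma adic_one [simp]: "\<one>\<^bsub>adic_group a\<^esub> = (\<lambda>_. 0)"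
  by (simp add: adic_group_def)

lemma val_zero [simp]: "val k (\<lambda>_. 0) = 0"
  by (simp add: val_def)

lemma adic_add_closed: "adic_add a x y \<in> \<Delta>"
  unfolding carrier_adic_group
proof
  fix n
  have "a n > 0" using a_gt_1[of n] by linarith
  then show "0 \<le> adic_add a x y n \<and> adic_add a x y n < a n" by (cases n) simp_all
qed

lemma zero_in_adic: "(\<lambda>_. 0) \<in> \<Delta>"
  using a_gt_1 by (auto simp: carrier_adic_group intro: less_trans[of 0 1])

text \<open>Each group law is checked modulo every \<open>A k\<close>. The inverse is the adic
  integer with the compatible residues \<open>- val k x\<close>.\<close>

lemma adic_comm_group: "comm_group (adic_group a)"
proof (rule comm_groupI)
  fix x y z assume "x \<in> \<Delta>" "y \<in> \<Delta>" "z \<in> \<Delta>"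
  show "x \<otimes>\<^bsub>adic_group a\<^esub> y \<in> \<Delta>" by (simp add: adic_add_closed)
  show "x \<otimes>\<^bsub>adic_group a\<^esub> y \<otimes>\<^bsub>adic_group a\<^esub> z = x \<otimes>\<^bsub>adic_group a\<^esub> (y \<otimes>\<^bsub>adic_group a\<^esub> z)"
    unfolding adic_mult
  proof (rule val_inject[OF adic_add_closed adic_add_closed])
    fix k
    show "A k dvd val k (adic_add a (adic_add a x y) z) - val k (adic_add a x (adic_add a y z))"
      using val_adic_add[of k "adic_add a x y" z] val_adic_add[of k x y]
        val_adic_add[of k x "adic_add a y z"] val_adic_add[of k y z]
      by (simp only: mod_eq_dvd_iff[symmetric]) (metis mod_add_left_eq mod_add_right_eq add.assoc)
  qed
next
  fix x y assume "x \<in> \<Delta>" "y \<in> \<Delta>"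
  show "x \<otimes>\<^bsub>adic_group a\<^esub> y = y \<otimes>\<^bsub>adic_group a\<^esub> x"
    unfolding adic_mult
  proof (rule val_inject[OF adic_add_closed adic_add_closed])
    fix k
    show "A k dvd val k (adic_add a x y) - val k (adic_add a y x)"
      using val_adic_add[of k x y] val_adic_add[of k y x]
      by (simp only: mod_eq_dvd_iff[symmetric] add.commute)
  qed
next
  fix x assume x: "x \<in> \<Delta>"
  show "\<one>\<^bsub>adic_group a\<^esub> \<otimes>\<^bsub>adic_group a\<^esub> x = x" unfolding adic_mult adic_one
    by (rule val_inject[OF adic_add_closed x]) (use val_adic_add[of _ "\<lambda>_. 0" x] in simp)
  have "A k dvd - val (Suc k) x - - val k x" for k by (simp add: val_Suc)
  then obtain y where y: "y \<in> \<Delta>" "\<And>k. A k dvd val k y - - val k x"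
    using exists_digits[of "\<lambda>k. - val k x"] by blast
  have "adic_add a y x = (\<lambda>_. 0)"
  proof (rule val_inject[OF adic_add_closed zero_in_adic])
    fix k
    show "A k dvd val k (adic_add a y x) - val k (\<lambda>_. 0)"
      using dvd_add[OF val_adic_add[of k y x] y(2)[of k]] by simp
  qed
  then show "\<exists>y\<in>\<Delta>. y \<otimes>\<^bsub>adic_group a\<^esub> x = \<one>\<^bsub>adic_group a\<^esub>" using y(1) by auto
qed (simp add: zero_in_adic)

sublocale adic: comm_group "adic_group a"
  by (rule adic_comm_group)

lemma val_adic_inv:
  assumes "x \<in> \<Delta>"
  shows "A k dvd val k (inv\<^bsub>adic_group a\<^esub> x) + val k x"
proof -
  have "adic_add a (inv\<^bsub>adic_group a\<^esub> x) x = (\<lambda>_. 0)" using adic.l_inv[OF assms] by simp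
  then have "A k dvd - (val k (inv\<^bsub>adic_group a\<^esub> x) + val k x)"
    using val_adic_add[of k "inv\<^bsub>adic_group a\<^esub> x" x] by simp
  then show ?thesis by (simp only: dvd_minus_iff)
qed

lemma adic_unit_closed [simp]: "adic_unit \<in> \<Delta>"
  using a_gt_1 by (auto simp: carrier_adic_group adic_unit_def intro: less_trans[of 0 1])

lemma val_adic_unit: "A k dvd val k adic_unit - 1"
proof (cases k)
  case (Suc j)
  have "val (Suc j) adic_unit = 1" by (induction j) (auto simp: val_Suc adic_unit_def)
  then show ?thesis using Suc by simp
qed simp

lemma val_adic_unit_pow: "A k dvd val k (adic_unit [^]\<^bsub>adic_group a\<^esub> (n :: int)) - n"
proof -
  have nat: "A k dvd val k (adic_unit [^]\<^bsub>adic_group a\<^esub> m) - int m" for m :: nat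
  proof (induction m)
    case (Suc m)
    have "A k dvd (val k (adic_add a (adic_unit [^]\<^bsub>adic_group a\<^esub> m) adic_unit) - (val k (adic_unit [^]\<^bsub>adic_group a\<^esub> m) + val k adic_unit))
        + (val k (adic_unit [^]\<^bsub>adic_group a\<^esub> m) - int m) + (val k adic_unit - 1)"
      by (intro dvd_add val_adic_add Suc val_adic_unit)
    then show ?case by (simp add: algebra_simps)
  qed simp
  show ?thesis
  proof (cases "n \<ge> 0")
    case True
    then show ?thesis using nat[of "nat n"] int_pow_int[of "adic_group a" adic_unit "nat n"] by simp
  next
    case False
    define m where "m = nat (- n)"
    have n: "n = - int m" using False by (simp add: m_def)
    have "A k dvd (val k (inv\<^bsub>adic_group a\<^esub> (adic_unit [^]\<^bsub>adic_group a\<^esub> m)) + val k (adic_unit [^]\<^bsub>adic_group a\<^esub> m))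
      - (val k (adic_unit [^]\<^bsub>adic_group a\<^esub> m) - int m)"
      by (intro dvd_diff val_adic_inv nat) simp
    then show ?thesis by (simp add: n adic.int_pow_neg_int)
  qed
qed

end

section \<open>The solenoid and its characters\<close>

lemma cis_2pi_Ints: "z \<in> \<int> \<Longrightarrow> cis (2 * pi * z) = 1"
  by (rule cis_multiple_2pi)

lemma cis_2pi_eq_1:
  assumes "cis (2 * pi * z) = 1" shows "z \<in> \<int>"
proof -
  have "cos (2 * pi * z) = 1" using assms by (simp add: complex_eq_iff)
  then obtain n :: int where "2 * pi * z = of_int n * 2 * pi" using cos_one_2pi_int by blast
  then have "z = of_int n" by simp
  then show ?thesis by simp
qed

lemma circle_carrier [simp]: "z \<in> carrier circle_group \<longleftrightarrow> cmod z = 1"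
  by (simp add: circle_group_def)

lemma circle_mult [simp]: "z \<otimes>\<^bsub>circle_group\<^esub> w = z * w"
  by (simp add: circle_group_def)

lemma circle_one [simp]: "\<one>\<^bsub>circle_group\<^esub> = 1"
  by (simp add: circle_group_def)

lemma circle_comm_group: "comm_group circle_group"
proof (rule comm_groupI)
  show "\<exists>w\<in>carrier circle_group. w \<otimes>\<^bsub>circle_group\<^esub> z = \<one>\<^bsub>circle_group\<^esub>"
    if "z \<in> carrier circle_group" for z
    using that by (intro bexI[of _ "inverse z"]) (cases "z = 0"; auto simp: norm_inverse)+
qed (auto simp: norm_mult)

lemma real_comm_group: "comm_group real_group"
proof (rule comm_groupI)
  show "\<exists>y\<in>carrier real_group. y \<otimes>\<^bsub>real_group\<^esub> x = \<one>\<^bsub>real_group\<^esub>" for x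
    by (intro bexI[of _ "- x"]) (auto simp: real_group_def)
qed (auto simp: real_group_def)

lemma DirProd_comm_group:
  assumes "comm_group G" "comm_group H" shows "comm_group (G \<times>\<times> H)"
proof -
  interpret G: comm_group G by fact
  interpret H: comm_group H by fact
  show ?thesis
    by (rule group.group_comm_groupI[OF DirProd_group]) (auto simp: carrier_DirProd G.is_group H.is_group G.m_comm H.m_comm)
qed

declare carrier_DirProd [simp del]

context adic_base
begin

abbreviation P where "P \<equiv> real_group \<times>\<times> adic_group a"
abbreviation K where "K \<equiv> solenoid_kernel a"

sublocale P: comm_group P
  by (rule DirProd_comm_group[OF real_comm_group adic_comm_group])

lemma P_carrier: "g \<in> carrier P \<longleftrightarrow> snd g \<in> \<Delta>"
  by (cases g) (simp add: real_group_def carrier_DirProd)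

lemma P_mult: "g \<otimes>\<^bsub>P\<^esub> h = (fst g + fst h, adic_add a (snd g) (snd h))"
  by (simp add: mult_DirProd' real_group_def)

lemma P_one: "\<one>\<^bsub>P\<^esub> = (0, \<lambda>_. 0)"
  by (simp add: real_group_def)

lemma val_dvd: "j \<le> k \<Longrightarrow> A j dvd val k x - val j x"
proof (induction k rule: dec_induct)
  case (step k)
  have "A j dvd (val k x - val j x) + x k * A k" by (intro dvd_add step dvd_mult A_dvd)
  then show ?case by (simp add: val_Suc algebra_simps)
qed simp

text \<open>A character of the product of the line and the adic integers. Only the residue of the
  adic part modulo \<open>A k\<close> matters once \<open>r * A k\<close> is an integer, and the
  minus sign makes it trivial on the pairs \<open>(n, n u)\<close>, with \<open>u\<close> the adic
  unit, that form the kernel.\<close>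

definition pre_chi :: "real \<Rightarrow> real \<times> (nat \<Rightarrow> int) \<Rightarrow> complex"
  where "pre_chi r g = cis (2 * pi * (r * (fst g - of_int (val (SOME k. r * of_int (A k) \<in> \<int>) (snd g)))))"

lemma H_level: "r \<in> H \<Longrightarrow> \<exists>k0. \<forall>k\<ge>k0. r * of_int (A k) \<in> \<int>"
  using adic_rationals_denominator[of r] by (metis A_nonzero Ints_of_int nonzero_divide_eq_eq of_int_eq_0_iff)

lemma Ints_mult_dvd:
  assumes "r * of_int d \<in> \<int>" "d dvd m"
  shows "r * of_int m \<in> \<int>"
  using assms by (auto elim!: dvdE simp: mult.assoc[symmetric])

lemma cis_2pi_cong: "r * of_int (m - m') \<in> \<int> \<Longrightarrow> cis (2 * pi * (r * (t - of_int m))) = cis (2 * pi * (r * (t - of_int m')))"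
proof -
  assume "r * of_int (m - m') \<in> \<int>"
  then have "cis (2 * pi * (r * (t - of_int m))) * cis (2 * pi * (r * of_int (m - m'))) = cis (2 * pi * (r * (t - of_int m)))"
    by (simp only: cis_2pi_Ints mult_1_right)
  then show ?thesis by (simp add: cis_mult algebra_simps)
qed

text \<open>Frees the definition from the chosen level: between two admissible levels
  \<open>val\<close> changes by a multiple of the smaller \<open>A\<close>, and \<open>r\<close>
  times such a multiple is an integer.\<close>

lemma pre_chi_at:
  assumes "r * of_int (A k) \<in> \<int>"
  shows "pre_chi r g = cis (2 * pi * (r * (fst g - of_int (val k (snd g)))))"
proof -
  define j where "j = (SOME k. r * of_int (A k) \<in> \<int>)"
  have j: "r * of_int (A j) \<in> \<int>" unfolding j_def by (rule someI[of _ k]) (rule assms)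
  have "r * of_int (val j (snd g) - val k (snd g)) \<in> \<int>"
  proof (cases "j \<le> k")
    case True
    show ?thesis using val_dvd[OF True, of "snd g"] by (intro Ints_mult_dvd[OF j]) (simp add: dvd_diff_commute)
  next
    case False
    then show ?thesis using val_dvd[of k j "snd g"] by (intro Ints_mult_dvd[OF assms]) simp
  qed
  then show ?thesis unfolding pre_chi_def j_def[symmetric] by (rule cis_2pi_cong)
qed

lemma norm_pre_chi: "cmod (pre_chi r g) = 1"
  by (simp add: pre_chi_def)

lemma pre_chi_mult:
  assumes "r \<in> H"
  shows "pre_chi r (g \<otimes>\<^bsub>P\<^esub> h) = pre_chi r g * pre_chi r h"
proof -
  obtain k where k: "r * of_int (A k) \<in> \<int>" using H_level[OF assms] by blast
  have "pre_chi r (g \<otimes>\<^bsub>P\<^esub> h) = cis (2 * pi * (r * ((fst g + fst h) - of_int (val k (adic_add a (snd g) (snd h))))))"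
    unfolding pre_chi_at[OF k] P_mult by simp
  also have "\<dots> = cis (2 * pi * (r * ((fst g + fst h) - of_int (val k (snd g) + val k (snd h)))))"
    by (rule cis_2pi_cong[OF Ints_mult_dvd[OF k val_adic_add]])
  also have "\<dots> = pre_chi r g * pre_chi r h"
    unfolding pre_chi_at[OF k] cis_mult by (simp add: algebra_simps)
  finally show ?thesis .
qed

lemma pre_chi_add:
  assumes "r \<in> H" "s \<in> H"
  shows "pre_chi (r + s) g = pre_chi r g * pre_chi s g"
proof -
  obtain k1 k2 where "\<forall>k\<ge>k1. r * of_int (A k) \<in> \<int>" "\<forall>k\<ge>k2. s * of_int (A k) \<in> \<int>"
    using H_level assms by blast
  then have k: "r * of_int (A (max k1 k2)) \<in> \<int>" "s * of_int (A (max k1 k2)) \<in> \<int>" by simp_all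
  then have "(r + s) * of_int (A (max k1 k2)) \<in> \<int>" by (simp add: distrib_right)
  from pre_chi_at[OF this] pre_chi_at[OF k(1)] pre_chi_at[OF k(2)] show ?thesis
    by (simp add: cis_mult algebra_simps)
qed

lemma pre_chi_of_int_0: "pre_chi r (t, \<lambda>_. 0) = cis (2 * pi * (r * t))"
  by (simp add: pre_chi_def)

text \<open>For the converse, \<open>r = 1\<close> forces the real part to be an integer
  \<open>n\<close>, and \<open>r = 1 / A k\<close> forces the adic part to be congruent to
  \<open>n\<close> modulo \<open>A k\<close>, for every \<open>k\<close>. So characters with index
  in \<open>H\<close> separate points of the quotient.\<close>

lemma K_iff:
  "g \<in> K \<longleftrightarrow> g \<in> carrier P \<and> (\<forall>r\<in>H. pre_chi r g = 1)"
proof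
  assume "g \<in> K"
  then obtain n where g: "g = (of_int n, adic_unit [^]\<^bsub>adic_group a\<^esub> (n :: int))"
    by (auto simp: solenoid_kernel_def)
  have "pre_chi r g = 1" if "r \<in> H" for r
  proof -
    obtain k where k: "r * of_int (A k) \<in> \<int>" using H_level[OF \<open>r \<in> H\<close>] by blast
    have "r * of_int (n - val k (snd g)) \<in> \<int>"
      using val_adic_unit_pow[of k n] by (intro Ints_mult_dvd[OF k]) (simp add: g dvd_diff_commute)
    then show ?thesis unfolding pre_chi_at[OF k] by (simp only: g fst_conv of_int_diff[symmetric] cis_2pi_Ints)
  qed
  then show "g \<in> carrier P \<and> (\<forall>r\<in>H. pre_chi r g = 1)" by (simp add: P_carrier g)
next
  assume g: "g \<in> carrier P \<and> (\<forall>r\<in>H. pre_chi r g = 1)"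
  have level: "1 / of_int (A k) * of_int (A k) \<in> (\<int> :: real set)" for k by simp
  have "pre_chi 1 g = cis (2 * pi * (1 * (fst g - of_int (val 0 (snd g)))))"
    by (rule pre_chi_at) simp
  then have "cis (2 * pi * fst g) = 1" using g by simp
  then obtain n where n: "fst g = of_int n" using cis_2pi_eq_1 by (auto elim: Ints_cases)
  have "A k dvd val k (snd g) - n" for k
  proof -
    have "1 / of_int (A k) \<in> H" using H_I[of 1 k] by simp
    then have "cis (2 * pi * (1 / of_int (A k) * (fst g - of_int (val k (snd g))))) = 1"
      using g pre_chi_at[OF level[of k], of g] by simp
    then have "1 / of_int (A k) * (fst g - of_int (val k (snd g))) \<in> (\<int> :: real set)" by (rule cis_2pi_eq_1)
    then obtain m where "1 / of_int (A k) * (of_int n - of_int (val k (snd g))) = (of_int m :: real)"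
      unfolding n by (rule Ints_cases)
    then have "(of_int (n - val k (snd g)) :: real) = of_int (m * A k)" by (simp add: field_simps)
    then have "n - val k (snd g) = m * A k" by (simp only: of_int_eq_iff)
    then show ?thesis by (metis dvd_diff_commute dvd_triv_right)
  qed
  then have "snd g = adic_unit [^]\<^bsub>adic_group a\<^esub> n"
    using g val_adic_unit_pow
    by (intro val_inject) (auto simp: P_carrier mod_eq_dvd_iff[symmetric])
  then show "g \<in> K" using n by (cases g) (auto simp: solenoid_kernel_def)
qed

lemma pre_chi_one: "r \<in> H \<Longrightarrow> pre_chi r \<one>\<^bsub>P\<^esub> = 1"
  by (simp only: P_one pre_chi_of_int_0) simp

lemma pre_chi_inv:
  assumes "r \<in> H" "g \<in> carrier P"
  shows "pre_chi r (inv\<^bsub>P\<^esub> g) = inverse (pre_chi r g)"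
proof -
  have "pre_chi r (inv\<^bsub>P\<^esub> g) * pre_chi r g = 1"
    using pre_chi_mult[OF assms(1), of "inv\<^bsub>P\<^esub> g" g] pre_chi_one[OF assms(1)] P.l_inv[OF assms(2)] by simp
  then show ?thesis by (metis inverse_unique mult.commute)
qed

lemma K_subgroup: "subgroup K P"
proof (rule P.subgroupI)
  show "K \<noteq> {}" using K_iff[of "\<one>\<^bsub>P\<^esub>"] pre_chi_one by blast
  show "inv\<^bsub>P\<^esub> g \<in> K" if "g \<in> K" for g
    using that P.inv_closed[of g] unfolding K_iff by (auto simp: pre_chi_inv)
  show "g \<otimes>\<^bsub>P\<^esub> h \<in> K" if "g \<in> K" "h \<in> K" for g h
    using that P.m_closed[of g h] unfolding K_iff by (auto simp: pre_chi_mult)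
  show "K \<subseteq> carrier P" using K_iff by blast
qed

lemma K_normal: "K \<lhd> P"
  using P.normal_iff_subgroup K_subgroup by blast

definition q :: "real \<times> (nat \<Rightarrow> int) \<Rightarrow> (real \<times> (nat \<Rightarrow> int)) set"
  where "q g = K #>\<^bsub>P\<^esub> g"

lemma q_eq_iff:
  assumes g: "g \<in> carrier P" and h: "h \<in> carrier P"
  shows "q g = q h \<longleftrightarrow> (\<forall>r\<in>H. pre_chi r g = pre_chi r h)"
proof
  assume "q g = q h"
  then have "g \<in> K #>\<^bsub>P\<^esub> h" using P.rcos_self[OF g K_subgroup] by (simp add: q_def)
  then obtain k where "k \<in> K" "g = k \<otimes>\<^bsub>P\<^esub> h" unfolding r_coset_def by blast
  then show "\<forall>r\<in>H. pre_chi r g = pre_chi r h" using pre_chi_mult K_iff by simp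
next
  assume *: "\<forall>r\<in>H. pre_chi r g = pre_chi r h"
  have "pre_chi r (g \<otimes>\<^bsub>P\<^esub> inv\<^bsub>P\<^esub> h) = 1" if "r \<in> H" for r
  proof -
    have "pre_chi r h \<noteq> 0" using norm_pre_chi[of r h] by auto
    then show ?thesis using pre_chi_mult[OF that, of g "inv\<^bsub>P\<^esub> h"] pre_chi_inv[OF that h] * that by simp
  qed
  then have k: "g \<otimes>\<^bsub>P\<^esub> inv\<^bsub>P\<^esub> h \<in> K" unfolding K_iff using P.m_closed[OF g P.inv_closed[OF h]] by blast
  have "g = g \<otimes>\<^bsub>P\<^esub> inv\<^bsub>P\<^esub> h \<otimes>\<^bsub>P\<^esub> h" using P.inv_solve_right'[OF _ g h] g h P.m_closed P.inv_closed by (metis P.inv_solve_right')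
  then have "g \<in> K #>\<^bsub>P\<^esub> h" unfolding r_coset_def using k by blast
  then show "q g = q h" unfolding q_def using P.repr_independence[OF _ h K_subgroup] by metis
qed

definition chi :: "real \<Rightarrow> (real \<times> (nat \<Rightarrow> int)) set \<Rightarrow> complex"
  where "chi r C = pre_chi r (SOME g. g \<in> carrier P \<and> q g = C)"

lemma chi_q:
  assumes "g \<in> carrier P" "r \<in> H"
  shows "chi r (q g) = pre_chi r g"
proof -
  define h where "h = (SOME h. h \<in> carrier P \<and> q h = q g)"
  have "h \<in> carrier P \<and> q h = q g" unfolding h_def by (rule someI[of _ g]) (simp only: assms simp_thms)
  then show ?thesis using q_eq_iff[of h g] assms unfolding chi_def h_def[symmetric] by blast
qed

abbreviation \<Sigma> where "\<Sigma> \<equiv> solenoid_group a"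

lemma \<Sigma>_carrier: "carrier \<Sigma> = q ` carrier P"
  unfolding solenoid_group_def carrier_FactGroup q_def[abs_def] ..

lemma \<Sigma>_mult:
  "g \<in> carrier P \<Longrightarrow> h \<in> carrier P \<Longrightarrow> q g \<otimes>\<^bsub>\<Sigma>\<^esub> q h = q (g \<otimes>\<^bsub>P\<^esub> h)"
  unfolding solenoid_group_def mult_FactGroup q_def by (rule normal.rcos_sum[OF K_normal])

lemma \<Sigma>_comm_group: "comm_group \<Sigma>"
  unfolding solenoid_group_def by (rule P.abelian_FactGroup[OF K_subgroup])

section \<open>The pairing of \<open>X\<close> with \<open>Y\<close>\<close>

abbreviation X where "X \<equiv> \<Sigma> \<times>\<times> circle_group"

sublocale X: comm_group X
  by (rule DirProd_comm_group[OF \<Sigma>_comm_group circle_comm_group])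

lemma X_carrier: "x \<in> carrier X \<longleftrightarrow> (\<exists>g z. x = (q g, z) \<and> g \<in> carrier P \<and> cmod z = 1)"
  unfolding carrier_DirProd \<Sigma>_carrier by (cases x) auto

definition E :: "(real \<times> (nat \<Rightarrow> int)) set \<times> complex \<Rightarrow> real \<times> int \<Rightarrow> complex"
  where "E x y = chi (fst y) (fst x) * snd x powi snd y"

lemma E_q: "g \<in> carrier P \<Longrightarrow> r \<in> H \<Longrightarrow> E (q g, z) (r, n) = pre_chi r g * z powi n"
  by (simp add: E_def chi_q)

lemma norm_powi_1: "cmod z = 1 \<Longrightarrow> cmod (z powi n) = 1"
  by (simp add: norm_power_int)

lemma norm_E: "x \<in> carrier X \<Longrightarrow> cmod (E x y) = 1"
  by (auto simp only: X_carrier E_def chi_def norm_mult norm_pre_chi norm_powi_1 snd_conv mult_1)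

lemma E_mult:
  assumes "x \<in> carrier X" "x' \<in> carrier X" "y \<in> Y"
  shows "E (x \<otimes>\<^bsub>X\<^esub> x') y = E x y * E x' y"
proof -
  obtain g z where x: "x = (q g, z)" "g \<in> carrier P" using assms(1) X_carrier by blast
  obtain g' z' where x': "x' = (q g', z')" "g' \<in> carrier P" using assms(2) X_carrier by blast
  obtain r n where y: "y = (r, n)" "r \<in> H" using assms(3) by blast
  have "x \<otimes>\<^bsub>X\<^esub> x' = (q (g \<otimes>\<^bsub>P\<^esub> g'), z * z')"
    by (simp only: x x' mult_DirProd \<Sigma>_mult circle_mult)
  then show ?thesis
    using E_q[OF P.m_closed[OF x(2) x'(2)] y(2)] E_q[OF x(2) y(2)] E_q[OF x'(2) y(2)] pre_chi_mult[OF y(2)]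
    by (simp only: x(1) x'(1) y(1) power_int_mult_distrib mult_ac)
qed

lemma E_add:
  assumes "x \<in> carrier X" "y \<in> Y" "y' \<in> Y"
  shows "E x (y + y') = E x y * E x y'"
proof -
  obtain g z where x: "x = (q g, z)" "g \<in> carrier P" "cmod z = 1" using assms(1) X_carrier by blast
  obtain r n where y: "y = (r, n)" "r \<in> H" using assms(2) by blast
  obtain r' n' where y': "y' = (r', n')" "r' \<in> H" using assms(3) by blast
  have "z \<noteq> 0" using x(3) by auto
  then show ?thesis
    using E_q[OF x(2) H_add[OF y(2) y'(2)]] E_q[OF x(2) y(2)] E_q[OF x(2) y'(2)] pre_chi_add[OF y(2) y'(2)]
    by (simp only: x(1) y(1) y'(1) add_Pair power_int_add mult_ac simp_thms)
qed

lemma E_inject: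
  assumes "x \<in> carrier X" "x' \<in> carrier X" "\<And>y. y \<in> Y \<Longrightarrow> E x y = E x' y"
  shows "x = x'"
proof -
  obtain g z where x: "x = (q g, z)" "g \<in> carrier P" using assms(1) X_carrier by blast
  obtain g' z' where x': "x' = (q g', z')" "g' \<in> carrier P" using assms(2) X_carrier by blast
  have pc0: "pre_chi 0 h = 1" for h by (simp add: pre_chi_def)
  have "E x (0, 1) = E x' (0, 1)" by (rule assms(3)) simp
  then have "z = z'" unfolding x(1) x'(1) E_q[OF x(2) H_0] E_q[OF x'(2) H_0] pc0 by simp
  moreover have "pre_chi r g = pre_chi r g'" if "r \<in> H" for r
    using assms(3)[of "(r, 0)"] that unfolding x(1) x'(1) E_q[OF x(2) that] E_q[OF x'(2) that] by simp
  then have "q g = q g'" using q_eq_iff[OF x(2) x'(2)] by blast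
  ultimately show ?thesis by (simp only: x x')
qed

lemma hom_multiple:
  fixes h :: "real \<times> int \<Rightarrow> complex"
  assumes h: "\<And>y y'. y \<in> Y \<Longrightarrow> y' \<in> Y \<Longrightarrow> h (y + y') = h y * h y'" "\<And>y. y \<in> Y \<Longrightarrow> cmod (h y) = 1"
    and r: "r \<in> H"
  shows "h (of_int m * r, m * n) = h (r, n) powi m"
proof -
  have "h 0 * h 0 = h 0" using h(1)[of 0 0] by (simp add: zero_prod_def)
  moreover have "h 0 \<noteq> 0" using h(2)[of 0] by (auto simp: zero_prod_def)
  ultimately have h0: "h 0 = 1" by simp
  have nat: "h (of_nat k * r, int k * n) = h (r, n) ^ k" for k
  proof (induction k)
    case (Suc k)
    have "(of_nat (Suc k) * r, int (Suc k) * n) = (of_nat k * r, int k * n) + (r, n)"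
      by (simp add: algebra_simps)
    moreover have "of_nat k * r \<in> H" using H_mult[OF r, of "int k"] by simp
    ultimately show ?case using h(1)[of "(of_nat k * r, int k * n)" "(r, n)"] r Suc by simp
  qed (use h0 in \<open>simp add: zero_prod_def\<close>)
  show ?thesis
  proof (cases "m \<ge> 0")
    case True
    then show ?thesis using nat[of "nat m"] by (simp add: power_int_def)
  next
    case False
    have mr: "(of_int m * r, m * n) \<in> Y" "(- (of_int m * r), - (m * n)) \<in> Y" using H_mult[OF r, of m] H_minus by auto
    have "h (of_int m * r, m * n) * h (r, n) ^ nat (- m) = 1"
      using h(1)[OF mr] nat[of "nat (- m)"] False h0 by (simp add: zero_prod_def)
    then show ?thesis using False by (simp add: power_int_def) (metis inverse_unique mult.commute power_inverse)
  qed
qed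

text \<open>A homomorphism determines real numbers \<open>\<theta>\<^sub>k\<close>, unique modulo \<open>A k\<close>, by its values at \<open>1 / A k\<close>;
  the integers \<open>\<theta>\<^sub>0 - \<theta>\<^sub>k\<close> are compatible and so give an adic integer.\<close>

lemma E_surj:
  assumes h: "\<And>y y'. y \<in> Y \<Longrightarrow> y' \<in> Y \<Longrightarrow> h (y + y') = h y * h y'" "\<And>y. y \<in> Y \<Longrightarrow> cmod (h y) = 1"
  shows "\<exists>x\<in>carrier X. \<forall>y\<in>Y. E x y = h y"
proof -
  define w where "w k = h (1 / of_int (A k), 0)" for k
  have AH: "1 / of_int (A k) \<in> H" for k using H_I[of 1 k] by simp
  have "\<exists>\<theta>. cis (2 * pi * (\<theta> / of_int (A k))) = w k" for k
  proof -
    have "cmod (w k) = 1" unfolding w_def using AH by (intro h(2)) simp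
    then obtain \<phi> where "w k = cis \<phi>" by (metis cis_Arg norm_zero zero_neq_one complex_sgn_def divide_self_if sgn_eq div_by_1 of_real_1)
    then show ?thesis by (intro exI[of _ "\<phi> / (2 * pi) * of_int (A k)"]) simp
  qed
  then obtain \<theta> where \<theta>: "\<And>k. cis (2 * pi * (\<theta> k / of_int (A k))) = w k" by metis
  have step: "\<exists>m. \<theta> k - \<theta> (Suc k) = of_int (A k * m)" for k
  proof -
    have "h (of_int (a k) * (1 / of_int (A (Suc k))), a k * 0) = h (1 / of_int (A (Suc k)), 0) powi (a k)"
      by (rule hom_multiple[OF h AH])
    moreover have "a k \<noteq> 0" using a_gt_1[of k] by linarith
    ultimately have "w k = w (Suc k) powi (a k)" by (simp add: w_def A_Suc)
    also have "\<dots> = cis (2 * pi * (\<theta> (Suc k) / of_int (A k)))"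
      using \<open>a k \<noteq> 0\<close> by (simp add: \<theta>[symmetric] cis_power_int A_Suc)
    finally have "cis (2 * pi * (\<theta> k / of_int (A k))) / cis (2 * pi * (\<theta> (Suc k) / of_int (A k))) = 1"
      using \<theta>[of k] by simp
    then have "cis (2 * pi * ((\<theta> k - \<theta> (Suc k)) / of_int (A k))) = 1"
      by (simp add: cis_divide diff_divide_distrib right_diff_distrib)
    then have "(\<theta> k - \<theta> (Suc k)) / of_int (A k) \<in> \<int>" by (rule cis_2pi_eq_1)
    then obtain m where "(\<theta> k - \<theta> (Suc k)) / of_int (A k) = of_int m" by (auto elim: Ints_cases)
    then have "\<theta> k - \<theta> (Suc k) = of_int (A k * m)" by (simp add: field_simps)
    then show ?thesis by blast
  qed
  then obtain m where m: "\<And>k. \<theta> k - \<theta> (Suc k) = of_int (A k * m k)" by metis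
  define v where "v k = (\<Sum>i<k. A i * m i)" for k
  have v: "\<theta> 0 - \<theta> k = of_int (v k)" for k
  proof (induction k)
    case (Suc k)
    then show ?case using m[of k] by (simp add: v_def)
  qed (simp add: v_def)
  have "A k dvd v (Suc k) - v k" for k by (simp add: v_def)
  then obtain d where d: "d \<in> \<Delta>" "\<And>k. A k dvd val k d - v k" using exists_digits[of v] by blast
  define x where "x = (q (\<theta> 0, d), h (0, 1))"
  have P: "(\<theta> 0, d) \<in> carrier P" using d(1) by (simp only: P_carrier snd_conv)
  have x: "x \<in> carrier X" unfolding X_carrier x_def using P h(2)[of "(0, 1)"] by auto
  have chi_w: "pre_chi (1 / of_int (A k)) (\<theta> 0, d) = w k" for k
  proof -
    have lev: "1 / of_int (A k) * of_int (A k) \<in> (\<int> :: real set)" by simp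
    have "pre_chi (1 / of_int (A k)) (\<theta> 0, d) = cis (2 * pi * (1 / of_int (A k) * (\<theta> 0 - of_int (val k d))))"
      unfolding pre_chi_at[OF lev] by simp
    also have "\<dots> = cis (2 * pi * (1 / of_int (A k) * (\<theta> 0 - of_int (v k))))"
      by (rule cis_2pi_cong[OF Ints_mult_dvd[OF lev d(2)]])
    also have "\<dots> = w k" using v[of k] \<theta>[of k] by (simp flip: v)
    finally show ?thesis .
  qed
  have "E x y = h y" if yY: "y \<in> Y" for y
  proof -
    obtain k n m where y: "y = (of_int m / of_int (A k), n)"
      using yY by (auto simp: adic_rationals_def)
    have split: "y = (of_int m * (1 / of_int (A k)), m * 0) + (of_int n * 0, n * 1)" by (simp add: y)
    have mem: "(of_int m * (1 / of_int (A k)), m * 0) \<in> Y" "(of_int n * 0, n * 1) \<in> Y"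
      using H_mult[OF AH, of m k] by simp_all
    have pc0: "pre_chi 0 g = 1" for g by (simp add: pre_chi_def)
    have e1: "E x (1 / of_int (A k), 0) = h (1 / of_int (A k), 0)"
      unfolding x_def E_q[OF P AH] chi_w by (simp add: w_def)
    have e2: "E x (0, 1) = h (0, 1)" unfolding x_def E_q[OF P H_0] pc0 by simp
    have Ex: "E x (of_int l * r, l * n') = E x (r, n') powi l" if "r \<in> H" for l r n'
      by (rule hom_multiple[OF _ _ that]) (simp_all add: E_add[OF x] norm_E[OF x])
    have hx: "h (of_int l * r, l * n') = h (r, n') powi l" if "r \<in> H" for l r n'
      by (rule hom_multiple[OF _ _ that]) (simp_all add: h)
    have "E x y = E x (1 / of_int (A k), 0) powi m * E x (0, 1) powi n"
      unfolding split E_add[OF x mem] by (simp only: Ex[OF AH] Ex[OF H_0])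
    also have "\<dots> = h y"
      unfolding e1 e2 split h(1)[OF mem] by (simp only: hx[OF AH] hx[OF H_0])
    finally show ?thesis .
  qed
  then show ?thesis using x by blast
qed

end

section \<open>Topology of the solenoid\<close>

lemma continuous_map_compose_on:
  assumes "continuous_map T euclidean f" "continuous_on S g" "f ` topspace T \<subseteq> S"
  shows "continuous_map T euclidean (\<lambda>x. g (f x))"
proof -
  have "continuous_map T (top_of_set S) f" using assms by (auto simp: continuous_map_in_subtopology)
  moreover have "continuous_map (top_of_set S) euclidean g" using assms(2) by simp
  ultimately have "continuous_map T euclidean (g \<circ> f)" by (rule continuous_map_compose)
  then show ?thesis by (simp add: comp_def)
qed

lemma continuous_map_complex_mult:
  fixes f g :: "'a \<Rightarrow> complex"
  shows "continuous_map T euclidean f \<Longrightarrow> continuous_map T euclidean g \<Longrightarrow> continuous_map T euclidean (\<lambda>x. f x * g x)"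
  by (simp add: continuous_map_atin tendsto_mult)

text \<open>The complement of \<open>U\<close> is compact and every point of it is distinguished
  from \<open>x\<close> by some \<open>f i\<close> with a margin. Finitely many of these open
  conditions cover the complement.\<close>

lemma compact_separating_base:
  fixes f :: "'i \<Rightarrow> 'a \<Rightarrow> complex"
  assumes compact: "compact_space T"
    and cont: "\<And>i. i \<in> I \<Longrightarrow> continuous_map T euclidean (f i)"
    and separating: "\<And>x x'. x \<in> topspace T \<Longrightarrow> x' \<in> topspace T \<Longrightarrow> (\<And>i. i \<in> I \<Longrightarrow> f i x = f i x') \<Longrightarrow> x = x'"
    and U: "openin T U" "x \<in> U"
  shows "\<exists>F \<epsilon>. finite F \<and> F \<subseteq> I \<and> \<epsilon> > 0 \<and>
    (\<forall>x'\<in>topspace T. (\<forall>i\<in>F. cmod (f i x' - f i x) < \<epsilon>) \<longrightarrow> x' \<in> U)"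
proof -
  have xT: "x \<in> topspace T" using U openin_subset by blast
  define C where "C = topspace T - U"
  have "\<exists>i. i \<in> I \<and> f i x' \<noteq> f i x" if "x' \<in> C" for x'
    using separating[of x' x] that xT U(2) unfolding C_def by blast
  then obtain j where j: "\<And>x'. x' \<in> C \<Longrightarrow> j x' \<in> I \<and> f (j x') x' \<noteq> f (j x') x" by metis
  define \<delta> where "\<delta> x' = cmod (f (j x') x' - f (j x') x) / 2" for x'
  have \<delta>: "\<delta> x' > 0" if "x' \<in> C" for x' using j[OF that] by (simp add: \<delta>_def)
  define V where "V x' = {x'' \<in> topspace T. f (j x') x'' \<in> {w. \<delta> x' < cmod (w - f (j x') x)}}" for x'
  have "openin T (V x')" if "x' \<in> C" for x'
  proof -
    have "open {w. \<delta> x' < cmod (w - f (j x') x)}" by (intro open_Collect_less continuous_intros)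
    then show ?thesis unfolding V_def using cont[of "j x'"] j[OF that]
      by (intro openin_continuous_map_preimage[where Y = euclidean]) auto
  qed
  moreover have "C \<subseteq> \<Union>(V ` C)"
  proof
    fix x' assume "x' \<in> C"
    then have "x' \<in> V x'" using \<delta>[of x'] by (auto simp: V_def C_def \<delta>_def)
    then show "x' \<in> \<Union>(V ` C)" using \<open>x' \<in> C\<close> by blast
  qed
  moreover have "compactin T C"
    unfolding C_def by (intro closedin_compact_space[OF compact] closedin_diff closedin_topspace U)
  ultimately obtain \<F> where \<F>: "finite \<F>" "\<F> \<subseteq> V ` C" "C \<subseteq> \<Union>\<F>"
    using compactinD[of T C "V ` C"] by blast
  then obtain D where D: "finite D" "D \<subseteq> C" "\<F> = V ` D" using finite_subset_image by metis
  \<comment> \<open>Inserting 1 keeps the minimum meaningful when \<open>U\<close> is the whole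
    space.\<close>
  define \<epsilon> where "\<epsilon> = Min (insert 1 (\<delta> ` D))"
  have "\<epsilon> > 0" unfolding \<epsilon>_def using D(1,2) \<delta> by (subst Min_gr_iff) auto
  moreover have "x' \<in> U" if x': "x' \<in> topspace T" and close: "\<forall>i\<in>j ` D. cmod (f i x' - f i x) < \<epsilon>" for x'
  proof (rule ccontr)
    assume "x' \<notin> U"
    then have "x' \<in> C" using x' by (simp add: C_def)
    then obtain d where d: "d \<in> D" "x' \<in> V d" using \<F>(3) D(3) by blast
    have "\<epsilon> \<le> \<delta> d" unfolding \<epsilon>_def using D(1) d(1) by (intro Min_le) auto
    moreover have "\<delta> d < cmod (f (j d) x' - f (j d) x)" using d(2) by (simp add: V_def)
    moreover have "cmod (f (j d) x' - f (j d) x) < \<epsilon>" using close d(1) by blast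
    ultimately show False by linarith
  qed
  moreover have "j ` D \<subseteq> I" using D(2) j by blast
  ultimately show ?thesis using D(1) by (intro exI[of _ "j ` D"] exI[of _ \<epsilon>]) blast
qed

context adic_base
begin

abbreviation TP where "TP \<equiv> prod_topology euclideanreal (adic_topology a)"
abbreviation TS where "TS \<equiv> solenoid_topology a"
abbreviation TX where "TX \<equiv> prod_topology TS circle_topology"

lemma topspace_adic [simp]: "topspace (adic_topology a) = \<Delta>"
  by (simp add: adic_topology_def adic_group_def)

lemma topspace_TP: "topspace TP = carrier P"
  by (simp add: carrier_DirProd real_group_def)

lemma quotient_q: "quotient_map TP TS q"
proof -
  have "q = (\<lambda>g. K #>\<^bsub>P\<^esub> g)" by (simp add: q_def fun_eq_iff)
  then show ?thesis unfolding solenoid_topology_def using quotient_map_quotient_topology by metis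
qed

lemma topspace_TS [simp]: "topspace TS = carrier \<Sigma>"
  using quotient_imp_surjective_map[OF quotient_q] unfolding topspace_TP \<Sigma>_carrier by simp

lemma topspace_TX: "topspace TX = carrier X"
proof -
  have "carrier circle_group = sphere 0 1" by (simp add: circle_group_def)
  then show ?thesis by (simp add: carrier_DirProd)
qed

lemma continuous_q: "continuous_map TP TS q"
  by (rule quotient_imp_continuous_map[OF quotient_q])

text \<open>At a fixed admissible level the character depends on the real coordinate and on finitely
  many digits only.\<close>

lemma continuous_pre_chi:
  assumes "r \<in> H" shows "continuous_map TP euclidean (pre_chi r)"
proof -
  obtain k where k: "r * of_int (A k) \<in> \<int>" using H_level[OF assms] by blast
  have proj: "continuous_map TP euclideanreal (\<lambda>g. of_int (snd g i))" for i
  proof -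
    have "continuous_map (adic_topology a) (discrete_topology {0..<a i}) (\<lambda>x. x i)"
      unfolding adic_topology_def by (rule continuous_map_product_projection) simp
    then have "continuous_map TP (discrete_topology {0..<a i}) ((\<lambda>x. x i) \<circ> snd)"
      by (rule continuous_map_compose[OF continuous_map_snd])
    moreover have "continuous_map (discrete_topology {0..<a i}) euclideanreal of_int" by simp
    ultimately have "continuous_map TP euclideanreal (of_int \<circ> ((\<lambda>x. x i) \<circ> snd))"
      by (rule continuous_map_compose)
    then show ?thesis by (simp add: comp_def)
  qed
  have fst: "continuous_map TP euclideanreal fst" by (rule continuous_map_fst)
  have "continuous_map TP euclideanreal (\<lambda>g. 2 * pi * (r * (fst g - (\<Sum>i<k. of_int (snd g i) * of_int (A i)))))"
    by (intro continuous_map_real_mult_left continuous_map_diff continuous_map_sum continuous_map_real_mult_right proj fst)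
      simp
  then have "continuous_map TP euclidean (\<lambda>g. cis (2 * pi * (r * (fst g - (\<Sum>i<k. of_int (snd g i) * of_int (A i))))))"
    by (rule continuous_map_compose_on[where S = UNIV]) (auto intro: continuous_intros)
  moreover have "pre_chi r = (\<lambda>g. cis (2 * pi * (r * (fst g - (\<Sum>i<k. of_int (snd g i) * of_int (A i))))))"
    unfolding pre_chi_at[OF k, abs_def] val_def by simp
  ultimately show ?thesis by simp
qed

lemma continuous_chi:
  assumes "r \<in> H" shows "continuous_map TS euclidean (chi r)"
proof (rule continuous_compose_quotient_map[OF quotient_q])
  show "continuous_map TP euclidean (chi r \<circ> q)"
    by (rule continuous_map_eq[OF continuous_pre_chi[OF assms]])
      (simp only: topspace_TP comp_apply chi_q[OF _ assms])
qed

lemma continuous_E: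
  assumes "y \<in> Y" shows "continuous_map TX euclidean (\<lambda>x. E x y)"
proof -
  have "continuous_map TX euclidean (chi (fst y) \<circ> fst)"
    using assms by (intro continuous_map_compose[OF continuous_map_fst] continuous_chi) auto
  moreover have "continuous_map TX euclidean ((\<lambda>z. z powi snd y) \<circ> snd)"
    by (intro continuous_map_compose[OF continuous_map_snd]) (auto intro!: continuous_intros)
  ultimately have "continuous_map TX euclidean (\<lambda>x. (chi (fst y) \<circ> fst) x * ((\<lambda>z. z powi snd y) \<circ> snd) x)"
    by (rule continuous_map_complex_mult)
  then show ?thesis by (simp add: E_def comp_def)
qed

text \<open>Subtracting the integer part of the real coordinate by an element of the kernel shows
  that the unit interval times the adic integers covers the solenoid, whence its
  compactness.\<close>

lemma q_shift:
  assumes "g \<in> carrier P"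
  shows "\<exists>g'\<in>carrier P. fst g' \<in> {0..1} \<and> q g' = q g"
proof -
  define n where "n = - \<lfloor>fst g\<rfloor>"
  define h where "h = (real_of_int n, adic_unit [^]\<^bsub>adic_group a\<^esub> n)"
  have "h \<in> K" by (auto simp: h_def solenoid_kernel_def)
  then have h: "h \<in> carrier P" "\<And>r. r \<in> H \<Longrightarrow> pre_chi r h = 1" using K_iff by blast+
  have hg: "h \<otimes>\<^bsub>P\<^esub> g \<in> carrier P" by (rule P.m_closed[OF h(1) assms])
  have "q (h \<otimes>\<^bsub>P\<^esub> g) = q g" unfolding q_eq_iff[OF hg assms] using pre_chi_mult h(2) by simp
  moreover have "fst (h \<otimes>\<^bsub>P\<^esub> g) = frac (fst g)" unfolding P_mult by (simp add: h_def n_def frac_def)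
  then have "fst (h \<otimes>\<^bsub>P\<^esub> g) \<in> {0..1}" using frac_lt_1[of "fst g"] by (simp add: less_imp_le)
  ultimately show ?thesis using hg by blast
qed

lemma compact_TS: "compact_space TS"
proof -
  have "compact_space (adic_topology a)"
    unfolding adic_topology_def by (auto simp: compact_space_product_topology compact_space_discrete_topology)
  then have "compactin TP ({0..1} \<times> \<Delta>)"
    by (simp add: compactin_Times compact_space_def)
  then have "compactin TS (q ` ({0..1} \<times> \<Delta>))" by (rule image_compactin[OF _ continuous_q])
  moreover have "q ` ({0..1} \<times> \<Delta>) = carrier \<Sigma>"
  proof
    show "q ` ({0..1} \<times> \<Delta>) \<subseteq> carrier \<Sigma>" unfolding \<Sigma>_carrier by (intro image_mono) (auto simp: P_carrier)
    show "carrier \<Sigma> \<subseteq> q ` ({0..1} \<times> \<Delta>)"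
    proof
      fix C assume "C \<in> carrier \<Sigma>"
      then obtain g where g: "g \<in> carrier P" "C = q g" unfolding \<Sigma>_carrier by blast
      obtain g' where g': "g' \<in> carrier P" "fst g' \<in> {0..1}" "q g' = q g" using q_shift[OF g(1)] by blast
      then have "g' \<in> {0..1} \<times> \<Delta>" by (cases g') (simp add: P_carrier)
      then show "C \<in> q ` ({0..1} \<times> \<Delta>)" using g(2) g'(3) by (intro image_eqI[of _ _ g']) auto
    qed
  qed
  ultimately show ?thesis by (simp add: compact_space_def)
qed

lemma compact_TX: "compact_space TX"
  unfolding compact_space_prod_topology using compact_TS by (simp add: compact_space_subtopology)

lemma \<Sigma>_separating:
  assumes "s \<in> carrier \<Sigma>" "s' \<in> carrier \<Sigma>" "\<And>r. r \<in> H \<Longrightarrow> chi r s = chi r s'"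
  shows "s = s'"
proof -
  obtain g g' where g: "g \<in> carrier P" "s = q g" "g' \<in> carrier P" "s' = q g'"
    using assms(1,2) unfolding \<Sigma>_carrier by blast
  then show ?thesis using assms(3) chi_q q_eq_iff by simp
qed

lemma TX_base:
  assumes "openin TX U" "x \<in> U"
  shows "\<exists>F \<epsilon>. finite F \<and> F \<subseteq> Y \<and> \<epsilon> > 0 \<and> (\<forall>x'\<in>carrier X. (\<forall>y\<in>F. cmod (E x' y - E x y) < \<epsilon>) \<longrightarrow> x' \<in> U)"
  using compact_separating_base[OF compact_TX continuous_E _ assms, of Y "\<lambda>y. y"] E_inject
  unfolding topspace_TX by blast

lemma TS_base:
  assumes "openin TS U" "s \<in> U"
  shows "\<exists>F \<epsilon>. finite F \<and> F \<subseteq> H \<and> \<epsilon> > 0 \<and> (\<forall>s'\<in>carrier \<Sigma>. (\<forall>r\<in>F. cmod (chi r s' - chi r s) < \<epsilon>) \<longrightarrow> s' \<in> U)"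
  using compact_separating_base[OF compact_TS continuous_chi _ assms, of H "\<lambda>y. y"] \<Sigma>_separating
  unfolding topspace_TS by blast

end

section \<open>Classification of characters\<close>

text \<open>If \<open>z \<noteq> 1\<close>, the quantity \<open>1 - Re z\<close> at least doubles under squaring while \<open>Re z\<close> stays positive.\<close>

lemma no_small_subgroup:
  assumes z: "cmod z = 1" and pos: "\<And>n :: nat. 0 < Re (z ^ n)"
  shows "z = 1"
proof (rule ccontr)
  assume "z \<noteq> 1"
  have norm: "cmod (z ^ m) = 1" for m using z by (simp add: norm_power)
  have sq: "(Re w)\<^sup>2 + (Im w)\<^sup>2 = 1" if "cmod w = 1" for w
    using that cmod_power2[of w] by simp
  have "Re z \<noteq> 1"
  proof
    assume "Re z = 1"
    then have "Im z = 0" using sq[OF z] by simp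
    then show False using \<open>Re z = 1\<close> \<open>z \<noteq> 1\<close> by (simp add: complex_eq_iff)
  qed
  then have z1: "1 - Re z > 0" using complex_Re_le_cmod[of z] z by linarith
  have "2 ^ n * (1 - Re z) \<le> 1 - Re (z ^ (2 ^ n))" for n
  proof (induction n)
    case (Suc n)
    define w where "w = z ^ (2 ^ n)"
    have w: "cmod w = 1" "0 < Re w" "Re w \<le> 1" using norm pos complex_Re_le_cmod[of w] by (auto simp: w_def)
    have "1 - Re (w * w) = 2 * (1 - Re w) * (1 + Re w)"
      using sq[OF w(1)] by (simp add: power2_eq_square algebra_simps)
    moreover have "2 * (1 - Re w) * 1 \<le> 2 * (1 - Re w) * (1 + Re w)"
      using w by (intro mult_left_mono) auto
    ultimately have "2 * (1 - Re w) \<le> 1 - Re (w * w)" by simp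
    moreover have "z ^ (2 ^ Suc n) = w * w" by (simp add: w_def mult_2 power_add)
    ultimately show ?case using Suc by (simp add: w_def)
  qed simp
  moreover have "1 - Re (z ^ (2 ^ n)) < 1" for n using pos[of "2 ^ n"] by simp
  ultimately have "2 ^ n * (1 - Re z) < 1" for n by (meson le_less_trans)
  moreover obtain n where "1 / (1 - Re z) < 2 ^ n" using real_arch_pow[of 2 "1 / (1 - Re z)"] by auto
  then have "1 < 2 ^ n * (1 - Re z)" using z1 by (simp add: field_simps)
  ultimately show False by (meson less_asym)
qed

lemma cis_exists: "cmod z = 1 \<Longrightarrow> \<exists>\<phi>. - pi < \<phi> \<and> \<phi> \<le> pi \<and> z = cis \<phi>"
  using cis_Arg[of z] Arg_bounded[of z] by (metis div_by_1 norm_zero of_real_1 sgn_eq zero_neq_one)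

text \<open>Halving a small argument repeatedly determines the homomorphism on dyadic multiples of a
  small \<open>\<delta>\<close>, and these are dense.\<close>

lemma continuous_real_character:
  fixes f :: "real \<Rightarrow> complex"
  assumes cont: "continuous_on UNIV f" and mult: "\<And>s t. f (s + t) = f s * f t" and norm: "\<And>t. cmod (f t) = 1"
  shows "\<exists>r. \<forall>t. f t = cis (2 * pi * (r * t))"
proof -
  have f0: "f 0 = 1" using mult[of 0 0] norm[of 0] by auto
  have "isCont f 0" using cont by (simp add: continuous_on_eq_continuous_at)
  then obtain d where d: "d > 0" "\<And>t. \<bar>t\<bar> < d \<Longrightarrow> cmod (f t - 1) < 1"
    unfolding continuous_at_eps_delta using f0 by (metis dist_norm dist_0_norm dist_commute real_norm_def zero_less_one)
  have Re_pos: "0 < Re (f t)" if "\<bar>t\<bar> < d" for t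
    using d(2)[OF that] abs_Re_le_cmod[of "f t - 1"] by simp
  define \<delta> where "\<delta> = d / 2"
  have \<delta>: "\<delta> > 0" "\<delta> < d" using d(1) by (auto simp: \<delta>_def)
  obtain \<theta> where \<theta>: "- pi < \<theta>" "\<theta> \<le> pi" "f \<delta> = cis \<theta>" using cis_exists[OF norm] by blast
  have half: "f (\<delta> / 2 ^ n) = cis (\<theta> / 2 ^ n)" for n
  proof (induction n)
    case (Suc n)
    define w where "w = f (\<delta> / 2 ^ Suc n)"
    define c where "c = cis (\<theta> / 2 ^ Suc n)"
    have "w * w = c * c"
      unfolding w_def c_def using Suc by (simp add: mult[symmetric] cis_mult)
    then have "w = c \<or> w = - c" using square_eq_iff by blast
    moreover have "Re w > 0"
    proof -
      have "(1 :: real) \<le> 2 ^ Suc n" by (rule one_le_power) simp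
      then have "\<delta> / 2 ^ Suc n \<le> \<delta> / 1" using \<delta> by (intro divide_left_mono) auto
      then show ?thesis unfolding w_def using \<delta> by (intro Re_pos) auto
    qed
    moreover have "Re c \<ge> 0"
    proof -
      have "\<bar>\<theta> / 2 ^ Suc n\<bar> \<le> pi / 2"
      proof -
        have "\<bar>\<theta>\<bar> / 2 ^ Suc n \<le> pi / 2 ^ Suc n" using \<theta> by (intro divide_right_mono) auto
        also have "\<dots> \<le> pi / 2" by (intro divide_left_mono) auto
        finally show ?thesis by simp
      qed
      then have "- (pi / 2) \<le> \<theta> / 2 ^ Suc n" "\<theta> / 2 ^ Suc n \<le> pi / 2" by linarith+
      then show ?thesis unfolding c_def cis.sel by (rule cos_ge_zero)
    qed
    ultimately show ?case by (auto simp: w_def c_def)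
  qed (simp add: \<theta>)
  define g where "g t = f t * cis (- (\<theta> / \<delta> * t))" for t
  have g_mult: "g (s + t) = g s * g t" for s t
  proof -
    have "- (\<theta> / \<delta> * (s + t)) = - (\<theta> / \<delta> * s) + - (\<theta> / \<delta> * t)" by (simp add: distrib_left)
    then show ?thesis unfolding g_def mult by (simp only: cis_mult[symmetric] mult_ac)
  qed
  have g0: "g 0 = 1" by (simp add: g_def f0)
  have g_half: "g (\<delta> / 2 ^ n) = 1" for n using \<delta> half[of n] by (simp add: g_def cis_mult)
  have g_nat: "g (real m * (\<delta> / 2 ^ n)) = 1" for m n
  proof (induction m)
    case (Suc m)
    then show ?case using g_mult[of "real m * (\<delta> / 2 ^ n)" "\<delta> / 2 ^ n"] g_half[of n] by (simp add: algebra_simps add_divide_distrib)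
  qed (simp add: g0)
  have g_minus: "g (- t) * g t = 1" for t using g_mult[of "- t" t] g0 by simp
  have g_int: "g (of_int m * (\<delta> / 2 ^ n)) = 1" for m n
  proof (cases "m \<ge> 0")
    case True then show ?thesis using g_nat[of "nat m" n] by simp
  next
    case False then show ?thesis using g_nat[of "nat (- m)" n] g_minus[of "of_int m * (\<delta> / 2 ^ n)"] by simp
  qed
  have "g t = 1" for t
  proof -
    define u where "u n = of_int \<lfloor>t / \<delta> * 2 ^ n\<rfloor> * (\<delta> / 2 ^ n)" for n :: nat
    have "u \<longlonglongrightarrow> t"
    proof (rule LIM_zero_cancel, rule Lim_null_comparison)
      show "(\<lambda>n. \<delta> * (1 / 2) ^ n) \<longlonglongrightarrow> 0" by (intro tendsto_mult_right_zero LIMSEQ_power_zero) simp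
      have "\<bar>u n - t\<bar> \<le> \<delta> * (1 / 2) ^ n" for n
      proof -
        define w where "w = of_int \<lfloor>t / \<delta> * 2 ^ n\<rfloor> - t / \<delta> * 2 ^ n"
        have "u n - t = w * (\<delta> / 2 ^ n)"
          using \<delta> by (simp add: u_def w_def field_simps)
        then have "\<bar>u n - t\<bar> = \<bar>w\<bar> * (\<delta> / 2 ^ n)" using \<delta> by (simp add: abs_mult)
        moreover have "\<bar>w\<bar> \<le> 1" unfolding w_def by linarith
        then have "\<bar>w\<bar> * (\<delta> / 2 ^ n) \<le> 1 * (\<delta> / 2 ^ n)" using \<delta> by (intro mult_right_mono) auto
        ultimately have "\<bar>u n - t\<bar> \<le> 1 * (\<delta> / 2 ^ n)" by (simp only:)
        moreover have "\<delta> * (1 / 2) ^ n = 1 * (\<delta> / 2 ^ n)" by (simp add: power_divide)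
        ultimately show ?thesis by (simp only:)
      qed
      then show "\<forall>\<^sub>F n in sequentially. norm (u n - t) \<le> \<delta> * (1 / 2) ^ n" by simp
    qed
    moreover have "continuous_on UNIV g" unfolding g_def by (intro continuous_intros cont)
    then have "isCont g t" by (simp add: continuous_on_eq_continuous_at)
    ultimately have "(\<lambda>n. g (u n)) \<longlonglongrightarrow> g t" using isCont_tendsto_compose by blast
    then show ?thesis using g_int by (simp add: u_def LIMSEQ_const_iff)
  qed
  note g_1 = this
  have "f t = cis (\<theta> / \<delta> * t)" for t
  proof -
    have "f t = g t * cis (\<theta> / \<delta> * t)" by (simp add: g_def mult.assoc cis_mult)
    then show ?thesis using g_1 by simp
  qed
  then show ?thesis by (intro exI[of _ "\<theta> / \<delta> / (2 * pi)"]) simp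
qed

text \<open>A compact-open neighbourhood of \<open>c\<close> keeps \<open>c' / c\<close> in the
  right half plane at every point, hence also at all powers of the point. The circle has no
  nontrivial subgroup there, so \<open>c' = c\<close>.\<close>

lemma characters_discrete:
  assumes G: "group G" and T: "compact_space T" "topspace T = carrier G" and c: "c \<in> characters G T"
  shows "openin (character_topology G T) {c}"
proof -
  interpret group G by (rule G)
  have char: "c \<in> hom G circle_group" "c \<in> extensional (carrier G)" "continuous_map T circle_topology c"
    if "c \<in> characters G T" for c using that by (auto simp: characters_def)
  have norm: "cmod (c x) = 1" if "c \<in> characters G T" "x \<in> carrier G" for c x
    using hom_in_carrier[OF char(1)[OF that(1)] that(2)] by simp
  have pow: "c (x [^]\<^bsub>G\<^esub> n) = c x ^ n" if "c \<in> characters G T" "x \<in> carrier G" for c x and n :: nat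
  proof (induction n)
    case 0
    interpret H: group circle_group using circle_comm_group by (simp add: comm_group_def)
    show ?case using hom_one[OF char(1)[OF that(1)] G H.is_group] by simp
  next
    case (Suc n)
    then show ?case using hom_mult[OF char(1)[OF that(1)] nat_pow_closed[OF that(2)] that(2)] by simp
  qed
  \<comment> \<open>The radii 1/4 for \<open>c\<close> and 1/2 for \<open>c'\<close> add up to less
    than 1, which puts \<open>c' x / c x\<close> at distance less than 1 from 1.\<close>
  obtain W where W: "finite W" "W \<subseteq> sphere (0 :: complex) 1" "sphere 0 1 \<subseteq> (\<Union>w\<in>W. ball w (1 / 4))"
    using compactE_image[OF compact_sphere, of "sphere (0::complex) 1" "\<lambda>w. ball w (1 / 4)" 0 1] by force
  define Kw where "Kw w = {x \<in> topspace T. c x \<in> cball w (1 / 4)}" for w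
  define Uw where "Uw w = sphere 0 1 \<inter> ball w (1 / 2)" for w :: complex
  define B where "B w = {y \<in> characters G T. y ` Kw w \<subseteq> Uw w}" for w
  have cT: "continuous_map T euclidean c" using char(3)[OF c] continuous_map_into_fulltopology by blast
  have "openin (character_topology G T) (B w)" for w
  proof -
    have "closedin T (Kw w)" unfolding Kw_def
      by (rule closedin_continuous_map_preimage[OF cT]) simp
    then have "compactin T (Kw w)" by (rule closedin_compact_space[OF T(1)])
    moreover have "openin circle_topology (Uw w)" unfolding Uw_def by (intro openin_open_Int) simp
    ultimately show ?thesis unfolding character_topology_def B_def
      by (intro topology_generated_by_Basis) blast
  qed
  moreover have "W \<noteq> {}"
  proof
    assume "W = {}"
    then have "(1::complex) \<in> {}" using W(3) by (metis Union_empty image_empty mem_sphere_0 norm_one subsetD)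
    then show False by simp
  qed
  ultimately have "openin (character_topology G T) (\<Inter>w\<in>W. B w)" using W(1) by (intro openin_Inter) auto
  moreover have "(\<Inter>w\<in>W. B w) = {c}"
  proof (intro equalityI subsetI)
    fix c' assume "c' \<in> (\<Inter>w\<in>W. B w)"
    then have c': "c' \<in> characters G T" "\<And>w. w \<in> W \<Longrightarrow> c' ` Kw w \<subseteq> Uw w"
      using \<open>W \<noteq> {}\<close> by (auto simp: B_def)
    have Re_pos: "0 < Re (c' x / c x)" if x: "x \<in> carrier G" for x
    proof -
      obtain w where w: "w \<in> W" "c x \<in> ball w (1 / 4)" using W(3) norm[OF c x] by force
      then have "x \<in> Kw w" using x T(2) by (simp add: Kw_def less_imp_le)
      then have "dist w (c' x) < 1 / 2" using c'(2)[OF w(1)] by (auto simp: Uw_def)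
      moreover have "dist w (c x) < 1 / 4" using w(2) by simp
      ultimately have "cmod (c' x - c x) < 1"
        using dist_triangle3[of "c' x" "c x" w] by (simp add: dist_norm[of "c' x" "c x"])
      moreover have nz: "c x \<noteq> 0" using norm[OF c x] by auto
      have "c' x / c x - 1 = (c' x - c x) / c x" using nz by (simp add: diff_divide_distrib)
      ultimately have "cmod (c' x / c x - 1) < 1" using norm[OF c x] by (simp add: norm_divide)
      then show ?thesis using abs_Re_le_cmod[of "c' x / c x - 1"] by simp
    qed
    have "c' x = c x" if x: "x \<in> carrier G" for x
    proof -
      have nz: "c x \<noteq> 0" using norm[OF c x] by auto
      have "c' x / c x = 1"
      proof (rule no_small_subgroup)
        show "cmod (c' x / c x) = 1" using norm[OF c x] norm[OF c'(1) x] by (simp add: norm_divide)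
        show "0 < Re ((c' x / c x) ^ n)" for n
          using Re_pos[of "x [^]\<^bsub>G\<^esub> n"] pow[OF c x] pow[OF c'(1) x] x by (simp add: power_divide)
      qed
      then show ?thesis using nz by simp
    qed
    then have "c' = c" using char(2)[OF c] char(2)[OF c'(1)] by (intro extensionalityI)
    then show "c' \<in> {c}" by simp
  next
    fix c' assume "c' \<in> {c}"
    have "c ` Kw w \<subseteq> Uw w" for w
      using norm[OF c] T(2) by (auto simp: Kw_def Uw_def)
    then show "c' \<in> (\<Inter>w\<in>W. B w)" using c \<open>c' \<in> {c}\<close> by (auto simp: B_def)
  qed
  ultimately show ?thesis by simp
qed

text \<open>The dual of a compact group is discrete. This settles the continuity demanded of the
  quadratic function in the definition of a Gaussian distribution.\<close>

lemma continuous_map_character_topology: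
  fixes \<phi> :: "('a \<Rightarrow> complex) \<Rightarrow> real"
  assumes "group G" "compact_space T" "topspace T = carrier G"
  shows "continuous_map (character_topology G T) euclideanreal \<phi>"
proof -
  have top: "topspace (character_topology G T) \<subseteq> characters G T"
    unfolding character_topology_def topology_generated_by_topspace by blast
  have "openin (character_topology G T) S" if "S \<subseteq> topspace (character_topology G T)" for S
  proof -
    have "openin (character_topology G T) (\<Union>c\<in>S. {c})"
      using characters_discrete[OF assms] that top by (intro openin_Union) blast
    then show ?thesis by simp
  qed
  then show ?thesis unfolding continuous_map_def by auto
qed

section \<open>Characters of \<open>X\<close> and adjoints of its automorphisms\<close>

context adic_base
begin

text \<open>Restricted to the carrier because characters are required to be extensional.\<close>

definition evaluation :: "real \<times> int \<Rightarrow> (real \<times> (nat \<Rightarrow> int)) set \<times> complex \<Rightarrow> complex"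
  where "evaluation y = restrict (\<lambda>x. E x y) (carrier X)"

lemma evaluation_eq [simp]: "x \<in> carrier X \<Longrightarrow> evaluation y x = E x y"
  by (simp add: evaluation_def)

lemma evaluation_character:
  assumes y: "y \<in> Y" shows "evaluation y \<in> characters X TX"
proof -
  have "evaluation y \<in> hom X circle_group"
    by (rule homI) (simp_all add: norm_E E_mult y X.m_closed)
  moreover have "continuous_map TX euclidean (evaluation y)"
    by (rule continuous_map_eq[OF continuous_E[OF y]]) (simp only: topspace_TX evaluation_eq)
  then have "continuous_map TX circle_topology (evaluation y)"
    by (auto simp: continuous_map_in_subtopology topspace_TX norm_E simp del: topspace_prod_topology)
  ultimately show ?thesis by (simp add: characters_def evaluation_def)
qed

lemma zero_P: "(t, \<lambda>_. 0) \<in> carrier P"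
  using zero_in_adic by (simp add: P_carrier)

lemma pair_X: "g \<in> carrier P \<Longrightarrow> cmod z = 1 \<Longrightarrow> (q g, z) \<in> carrier X"
  using X_carrier by blast

text \<open>The elements with vanishing first \<open>k\<close> digits form a subgroup, which for
  large \<open>k\<close> lies in a neighbourhood of 0 where \<open>f\<close> has positive real part.
  Its image is a subgroup of the circle in the right half plane, hence trivial.\<close>

lemma character_vanishing_level:
  assumes f: "continuous_map (adic_topology a) euclidean f"
    and mult: "\<And>d d'. d \<in> \<Delta> \<Longrightarrow> d' \<in> \<Delta> \<Longrightarrow> f (adic_add a d d') = f d * f d'"
    and norm: "\<And>d. d \<in> \<Delta> \<Longrightarrow> cmod (f d) = 1"
  shows "\<exists>k. \<forall>d\<in>\<Delta>. val k d = 0 \<longrightarrow> f d = (1 :: complex)"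
proof -
  let ?z = "\<lambda>_::nat. 0::int"
  have zz: "adic_add a ?z ?z = ?z" using adic.l_one[OF zero_in_adic] by simp
  have f0: "f ?z = 1"
    using mult[OF zero_in_adic zero_in_adic] norm[OF zero_in_adic] unfolding zz by auto
  define U where "U = {d \<in> topspace (adic_topology a). f d \<in> {w. 0 < Re w}}"
  have "openin (adic_topology a) U"
    unfolding U_def by (rule openin_continuous_map_preimage[OF f]) (simp add: open_halfspace_Re_gt)
  moreover have "?z \<in> U" using f0 zero_in_adic by (simp add: U_def)
  ultimately obtain W where W: "finite {i. W i \<noteq> topspace (discrete_topology {0..<a i})}" "?z \<in> Pi\<^sub>E UNIV W" "Pi\<^sub>E UNIV W \<subseteq> U"
    unfolding adic_topology_def openin_product_topology_alt by (metis (no_types, lifting) Collect_cong UNIV_I)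
  obtain k where k: "\<And>i. W i \<noteq> {0..<a i} \<Longrightarrow> i < k"
    using W(1) unfolding topspace_discrete_topology finite_nat_set_iff_bounded by blast
  have small: "d \<in> U" if d: "d \<in> \<Delta>" "val k d = 0" for d
  proof -
    have nonneg: "0 \<le> d i * A i" for i using d(1) by (simp add: carrier_adic_group less_imp_le)
    have "d i = 0" if "i < k" for i
    proof -
      have "d i * A i = 0"
        by (rule sum_nonneg_0[of "{..<k}" "\<lambda>i. d i * A i"]) (use nonneg d(2) that in \<open>auto simp: val_def\<close>)
      then show ?thesis by simp
    qed
    moreover have "W i = {0..<a i}" if "\<not> i < k" for i using k that by blast
    ultimately have "d i \<in> W i" for i
      using W(2) d(1) by (cases "i < k") (auto simp: PiE_iff carrier_adic_group)
    then show ?thesis using W(3) by (auto simp: PiE_iff)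
  qed
  have "f d = 1" if d: "d \<in> \<Delta>" "val k d = 0" for d
  proof (rule no_small_subgroup)
    show "cmod (f d) = 1" using norm[OF d(1)] .
    have pow: "d [^]\<^bsub>adic_group a\<^esub> n \<in> \<Delta> \<and> val k (d [^]\<^bsub>adic_group a\<^esub> n) = 0 \<and> f (d [^]\<^bsub>adic_group a\<^esub> n) = f d ^ n" for n :: nat
    proof (induction n)
      case (Suc n)
      define u where "u = adic_add a (d [^]\<^bsub>adic_group a\<^esub> n) d"
      have "A k dvd val k u" using val_adic_add[of k "d [^]\<^bsub>adic_group a\<^esub> n" d] Suc d(2) by (simp add: u_def)
      then have "val k u = 0" using val_mod[of u k] adic_add_closed by (simp add: u_def dvd_eq_mod_eq_0)
      then show ?case using Suc mult[of "d [^]\<^bsub>adic_group a\<^esub> n" d] d(1) adic_add_closed by (simp add: u_def mult.commute)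
    qed (simp add: f0 zero_in_adic)
    show "0 < Re (f d ^ n)" for n using small[of "d [^]\<^bsub>adic_group a\<^esub> n"] pow[of n] by (simp add: U_def)
  qed
  then show ?thesis by blast
qed

text \<open>A character is split into its restrictions \<open>f1\<close>, \<open>f3\<close>,
  \<open>f2\<close> to the line, the adic integers and the circle. Triviality on the kernel of the
  quotient ties \<open>f3\<close> to \<open>f1\<close>, and since \<open>f3\<close> ignores late
  digits, this forces the frequency \<open>r\<close> of \<open>f1\<close> into
  \<open>H\<close>.\<close>

theorem character_classification:
  assumes c: "c \<in> characters X TX"
  shows "\<exists>y\<in>Y. \<forall>x\<in>carrier X. c x = E x y"
proof -
  have hom: "c (x \<otimes>\<^bsub>X\<^esub> x') = c x * c x'" if "x \<in> carrier X" "x' \<in> carrier X" for x x'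
    using c hom_mult[of c X circle_group x x'] that by (simp add: characters_def)
  have norm: "cmod (c x) = 1" if "x \<in> carrier X" for x
    using c hom_in_carrier[of c X circle_group x] that by (simp add: characters_def)
  have cont: "continuous_map TX euclidean c"
    using c continuous_map_into_fulltopology unfolding characters_def by blast
  let ?z = "\<lambda>_::nat. 0::int"
  have zz: "adic_add a ?z ?z = ?z" using adic.l_one[OF zero_in_adic] by simp
  have XI: "(q (t, d), z) \<in> carrier X" if "d \<in> \<Delta>" "cmod z = 1" for t d z
    using that by (intro pair_X) (simp_all add: P_carrier)
  have Xm: "(q (t, d), z) \<otimes>\<^bsub>X\<^esub> (q (t', d'), z') = (q (t + t', adic_add a d d'), z * z')"
    if "d \<in> \<Delta>" "d' \<in> \<Delta>" for t d z t' d' z'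
    using that by (simp only: mult_DirProd[where G = \<Sigma>] \<Sigma>_mult P_carrier P_mult fst_conv snd_conv circle_mult)
  define f1 where "f1 t = c (q (t, ?z), 1)" for t
  \<comment> \<open>The circle is parametrised by the line, so that its characters come from the
    real ones; equality of the values at 0 and 1 makes the frequency an integer.\<close>
  define f2 where "f2 t = c (q (0, ?z), cis (2 * pi * t))" for t
  define f3 where "f3 d = c (q (0, d), 1)" for d
  have split: "c (q (t, d), cis (2 * pi * s)) = f1 t * f3 d * f2 s" if "d \<in> \<Delta>" for t d s
  proof -
    have zd: "adic_add a ?z d = d" using adic.l_one[OF that] by simp
    have dz: "adic_add a d ?z = d" using adic.r_one[OF that] by simp
    have "(q (t, d), cis (2 * pi * s)) = (q (t, ?z), 1) \<otimes>\<^bsub>X\<^esub> (q (0, d), 1) \<otimes>\<^bsub>X\<^esub> (q (0, ?z), cis (2 * pi * s))"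
      using that zero_in_adic by (simp only: Xm[OF zero_in_adic that] zd Xm[OF that zero_in_adic] dz) simp
    then show ?thesis unfolding f1_def f2_def f3_def
      using that zero_in_adic by (simp only: hom X.m_closed XI norm_one norm_cis)
  qed
  have cm1: "continuous_map euclideanreal TX (\<lambda>t. (q (t, ?z), 1))"
  proof -
    have "continuous_map euclideanreal TP (\<lambda>t. (t, ?z))"
      using zero_in_adic by (simp add: continuous_map_pairedI)
    then have "continuous_map euclideanreal TS (q \<circ> (\<lambda>t. (t, ?z)))"
      by (rule continuous_map_compose[OF _ continuous_q])
    then show ?thesis by (intro continuous_map_pairedI) (simp_all add: comp_def)
  qed
  have "\<exists>r. \<forall>t. f1 t = cis (2 * pi * (r * t))"
  proof (rule continuous_real_character)
    have "continuous_map euclideanreal euclidean (c \<circ> (\<lambda>t. (q (t, ?z), 1)))"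
      by (rule continuous_map_compose[OF cm1 cont])
    then show "continuous_on UNIV f1" by (simp add: f1_def[abs_def] comp_def)
    show "f1 (s + t) = f1 s * f1 t" for s t
      unfolding f1_def using hom[OF XI[OF zero_in_adic] XI[OF zero_in_adic], of 1 1 s t]
      unfolding Xm[OF zero_in_adic zero_in_adic] zz by simp
  qed (simp add: f1_def norm XI zero_in_adic)
  then obtain r where r: "\<And>t. f1 t = cis (2 * pi * (r * t))" by blast
  have "\<exists>r. \<forall>t. f2 t = cis (2 * pi * (r * t))"
  proof (rule continuous_real_character)
    have "continuous_map euclideanreal TX (\<lambda>t. (q (0, ?z), cis (2 * pi * t)))"
    proof (rule continuous_map_pairedI)
      show "continuous_map euclideanreal TS (\<lambda>t. q (0, ?z))" using zero_P unfolding continuous_map_const topspace_TS \<Sigma>_carrier by blast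
      show "continuous_map euclideanreal circle_topology (\<lambda>t. cis (2 * pi * t))"
        unfolding continuous_map_in_subtopology by (auto intro!: continuous_intros)
    qed
    then have "continuous_map euclideanreal euclidean (c \<circ> (\<lambda>t. (q (0, ?z), cis (2 * pi * t))))"
      by (rule continuous_map_compose[OF _ cont])
    then show "continuous_on UNIV f2" by (simp add: f2_def[abs_def] comp_def)
    show "f2 (s + t) = f2 s * f2 t" for s t
      unfolding f2_def using hom[OF XI[OF zero_in_adic] XI[OF zero_in_adic], of "cis (2 * pi * s)" "cis (2 * pi * t)" 0 0]
      unfolding Xm[OF zero_in_adic zero_in_adic] zz by (simp add: cis_mult distrib_left)
  qed (simp add: f2_def norm XI zero_in_adic)
  then obtain s where s: "\<And>t. f2 t = cis (2 * pi * (s * t))" by blast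
  have "f2 1 = f2 0" by (simp add: f2_def)
  then have "cis (2 * pi * s) = 1" using s[of 1] s[of 0] by simp
  then have "s \<in> \<int>" by (rule cis_2pi_eq_1)
  then obtain n where n: "s = of_int n" by (rule Ints_cases)
  have f3_mult: "f3 (adic_add a d d') = f3 d * f3 d'" if "d \<in> \<Delta>" "d' \<in> \<Delta>" for d d'
    unfolding f3_def using hom[OF XI[OF that(1)] XI[OF that(2)], of 1 1 0 0]
    unfolding Xm[OF that] by simp
  have f3_norm: "cmod (f3 d) = 1" if "d \<in> \<Delta>" for d unfolding f3_def using that by (simp add: norm XI)
  have "continuous_map (adic_topology a) euclidean f3"
  proof -
    have "continuous_map (adic_topology a) TP (\<lambda>d. (0, d))" by (simp add: continuous_map_pairedI)
    then have "continuous_map (adic_topology a) TS (q \<circ> (\<lambda>d. (0, d)))"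
      by (rule continuous_map_compose[OF _ continuous_q])
    then have "continuous_map (adic_topology a) TX (\<lambda>d. (q (0, d), 1))"
      by (intro continuous_map_pairedI) (simp_all add: comp_def)
    then have "continuous_map (adic_topology a) euclidean (c \<circ> (\<lambda>d. (q (0, d), 1)))"
      by (rule continuous_map_compose[OF _ cont])
    then show ?thesis by (simp add: f3_def[abs_def] comp_def)
  qed
  from character_vanishing_level[OF this f3_mult f3_norm]
  obtain k where k: "\<And>d. d \<in> \<Delta> \<Longrightarrow> val k d = 0 \<Longrightarrow> f3 d = 1" by blast
  have vanish: "f3 d = 1" if "d \<in> \<Delta>" "A k dvd val k d" for d
    using k[OF that(1)] val_mod[OF that(1), of k] that(2) by (simp add: dvd_eq_mod_eq_0)
  define u where "u m = adic_unit [^]\<^bsub>adic_group a\<^esub> (m :: int)" for m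
  have u: "u m \<in> \<Delta>" for m by (simp add: u_def)
  \<comment> \<open>The pair \<open>(m, u m)\<close> lies in the kernel, so the contributions of the
    line and of the adic integers cancel on it.\<close>
  have f3_u: "cis (2 * pi * (r * of_int m)) * f3 (u m) = 1" for m
  proof -
    have "(of_int m, u m) \<in> K" by (auto simp: solenoid_kernel_def u_def)
    then have "q (of_int m, u m) = q (0, ?z)"
      using q_eq_iff[of "(of_int m, u m)" "(0, ?z)"] K_iff[of "(of_int m, u m)"] zero_P u
      by (simp add: P_carrier pre_chi_of_int_0)
    then have "c (q (of_int m, u m), cis (2 * pi * 0)) = c (q (0, ?z), cis (2 * pi * 0))" by simp
    also have "\<dots> = 1" using s[of 0] by (simp add: f2_def)
    finally show ?thesis using split[OF u, of "of_int m" m 0] r[of "of_int m"] s[of 0] by simp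
  qed
  \<comment> \<open>\<open>A k\<close> times the unit has vanishing first \<open>k\<close> digits,
    so \<open>f3\<close> is 1 there and the kernel relation makes \<open>r * A k\<close> an
    integer.\<close>
  have "A k dvd val k (u (A k))"
    using dvd_add[OF val_adic_unit_pow[of k "A k"] dvd_refl] by (simp add: u_def)
  then have "cis (2 * pi * (r * of_int (A k))) = 1" using f3_u[of "A k"] vanish[OF u] by simp
  then have rA: "r * of_int (A k) \<in> \<int>" by (rule cis_2pi_eq_1)
  then obtain m where m: "r * of_int (A k) = of_int m" by (rule Ints_cases)
  then have "r = of_int m / of_int (A k)" by (simp add: field_simps)
  then have rH: "r \<in> H" using H_I by simp
  have "c x = E x (r, n)" if x: "x \<in> carrier X" for x
  proof -
    obtain g z where gz: "x = (q g, z)" "g \<in> carrier P" "cmod z = 1" using x X_carrier by blast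
    obtain t d where td: "g = (t, d)" by (cases g)
    have d: "d \<in> \<Delta>" using gz(2) by (simp add: td P_carrier)
    obtain \<phi> where \<phi>: "z = cis \<phi>" using cis_exists[OF gz(3)] by blast
    have z: "z = cis (2 * pi * (\<phi> / (2 * pi)))" by (simp add: \<phi>)
    define v where "v = val k d"
    \<comment> \<open>\<open>d\<close> differs from the integer multiple \<open>u v\<close> of the
      unit with the same residue \<open>v\<close> modulo \<open>A k\<close> by an element on which
      \<open>f3\<close> is trivial.\<close>
    define d' where "d' = adic_add a d (inv\<^bsub>adic_group a\<^esub> (u v))"
    have d': "d' \<in> \<Delta>" by (simp add: d'_def adic_add_closed)
    have dd: "d = adic_add a d' (u v)"
      using adic.m_assoc[OF d adic.inv_closed[OF u] u, of v v] adic.l_inv[OF u, of v] adic.r_one[OF d]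
      by (simp add: d'_def)
    have "A k dvd val k d' - (val k d + val k (inv\<^bsub>adic_group a\<^esub> (u v)))
        + (val k (inv\<^bsub>adic_group a\<^esub> (u v)) + val k (u v)) - (val k (u v) - v)"
      unfolding d'_def u_def by (intro dvd_add dvd_diff val_adic_add val_adic_inv val_adic_unit_pow) simp
    then have "A k dvd val k d'" by (simp add: v_def)
    then have "f3 d = f3 (u v)" using vanish[OF d'] f3_mult[OF d' u, of v] dd by simp
    also have "\<dots> = cis (- (2 * pi * (r * of_int v)))"
      using f3_u[of v] by (metis cis_inverse inverse_unique)
    finally have "f1 t * f3 d = pre_chi r g"
      by (simp add: r pre_chi_at[OF rA] td v_def cis_mult algebra_simps)
    moreover have "f2 (\<phi> / (2 * pi)) = z powi n" by (simp add: s n \<phi> cis_power_int)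
    ultimately have "c x = pre_chi r g * z powi n"
      using split[OF d, of t "\<phi> / (2 * pi)"] unfolding gz(1) td z[symmetric] by simp
    then show ?thesis unfolding gz(1) E_q[OF gz(2) rH] .
  qed
  then show ?thesis using rH by (intro bexI[of _ "(r, n)"]) auto
qed

lemma E_faithful:
  assumes y: "y \<in> Y" "y' \<in> Y" and eq: "\<And>x. x \<in> carrier X \<Longrightarrow> E x y = E x y'"
  shows "y = y'"
proof -
  obtain r n where rn: "y = (r, n)" "r \<in> H" using y(1) by blast
  obtain r' n' where rn': "y' = (r', n')" "r' \<in> H" using y(2) by blast
  have "cis (2 * pi * ((r - r') * t)) = 1" for t
  proof -
    have "E (q (t, \<lambda>_. 0), 1) y = E (q (t, \<lambda>_. 0), 1) y'" by (intro eq pair_X zero_P) simp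
    then have "cis (2 * pi * (r * t)) = cis (2 * pi * (r' * t))"
      unfolding rn(1) rn'(1) E_q[OF zero_P rn(2)] E_q[OF zero_P rn'(2)] pre_chi_of_int_0 by simp
    then have "cis (2 * pi * (r * t)) / cis (2 * pi * (r' * t)) = 1" by simp
    then show ?thesis by (simp add: cis_divide algebra_simps)
  qed
  note cis_1 = this
  have "r = r'"
  proof (rule ccontr)
    assume "r \<noteq> r'"
    then have "(r - r') * (1 / (2 * (r - r'))) = 1 / 2" by simp
    then have "cis (2 * pi * (1 / 2)) = 1" using cis_1[of "1 / (2 * (r - r'))"] by (simp only:)
    then show False by simp
  qed
  moreover have "n = n'"
  proof (rule ccontr)
    assume "n \<noteq> n'"
    \<comment> \<open>With this \<open>z\<close> the power with exponent \<open>n - n'\<close> is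
      -1.\<close>
    define z where "z = cis (pi / of_int (n - n'))"
    have "E (q (0, \<lambda>_. 0), z) y = E (q (0, \<lambda>_. 0), z) y'" by (intro eq pair_X zero_P) (simp add: z_def)
    then have "z powi n = z powi n'"
      unfolding rn(1) rn'(1) E_q[OF zero_P rn(2)] E_q[OF zero_P rn'(2)] pre_chi_of_int_0 by simp
    then have "z powi (n - n') = 1" by (simp add: z_def power_int_diff)
    then show False using \<open>n \<noteq> n'\<close> by (simp add: z_def cis_power_int)
  qed
  ultimately show ?thesis by (simp add: rn rn')
qed

lemma int_additive:
  fixes F :: "int \<Rightarrow> 'b :: ring_1"
  assumes "\<And>m n. F (m + n) = F m + F n"
  shows "F n = of_int n * F 1"
proof -
  have F0: "F 0 = 0" using assms[of 0 0] by simp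
  have nat: "F (int m) = of_nat m * F 1" for m
  proof (induction m)
    case (Suc m)
    have "F (int m + 1) = F (int m) + F 1" by (rule assms)
    then show ?case using Suc by (simp add: algebra_simps)
  qed (simp add: F0)
  show ?thesis
  proof (cases "n \<ge> 0")
    case True
    then show ?thesis using nat[of "nat n"] by simp
  next
    case False
    have "F n + F (- n) = 0" using assms[of n "- n"] F0 by simp
    then show ?thesis using nat[of "nat (- n)"] False by (simp add: add_eq_0_iff)
  qed
qed

text \<open>Pulling characters back along the automorphism gives an additive bijection
  \<open>T\<close> of \<open>Y\<close>. It is triangular because \<open>H\<close> has no nonzero
  homomorphism into the integers; surjectivity then yields \<open>p H = H\<close> and that
  \<open>e\<close> is a unit.\<close>

lemma automorphism_adjoint:
  assumes \<alpha>: "\<alpha> \<in> topological_aut X TX"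
  shows "\<exists>p c e. p \<noteq> 0 \<and> (\<lambda>x. p * x) ` H = H \<and> c \<in> H \<and> (e = 1 \<or> e = - 1) \<and>
    (\<forall>x\<in>carrier X. \<forall>r\<in>H. \<forall>n. E (\<alpha> x) (r, n) = E x (p * r + c * of_int n, e * n))"
proof -
  have iso: "\<alpha> \<in> iso X X" and homeo: "homeomorphic_map TX TX \<alpha>"
    using \<alpha> by (auto simp: topological_iso_def)
  have \<alpha>_hom: "\<alpha> \<in> hom X X" using iso by (simp add: iso_def)
  obtain \<beta> where \<beta>: "homeomorphic_maps TX TX \<alpha> \<beta>" using homeo unfolding homeomorphic_map_maps by blast
  have cont: "continuous_map TX TX \<alpha>" "continuous_map TX TX \<beta>"
    and inv: "\<And>x. x \<in> carrier X \<Longrightarrow> \<beta> (\<alpha> x) = x" "\<And>x. x \<in> carrier X \<Longrightarrow> \<alpha> (\<beta> x) = x"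
    using \<beta> unfolding homeomorphic_maps_def topspace_TX by blast+
  have \<alpha>X: "\<alpha> x \<in> carrier X" and \<beta>X: "\<beta> x \<in> carrier X" if "x \<in> carrier X" for x
    using cont that continuous_map_image_subset_topspace unfolding topspace_TX[symmetric] by blast+
  have \<beta>_hom: "\<beta> \<in> hom X X"
  proof (rule homI)
    fix x x' assume x: "x \<in> carrier X" "x' \<in> carrier X"
    show "\<beta> x \<in> carrier X" using \<beta>X[OF x(1)] .
    have "\<alpha> (\<beta> x \<otimes>\<^bsub>X\<^esub> \<beta> x') = x \<otimes>\<^bsub>X\<^esub> x'"
      using hom_mult[OF \<alpha>_hom \<beta>X[OF x(1)] \<beta>X[OF x(2)]] inv x by simp
    then show "\<beta> (x \<otimes>\<^bsub>X\<^esub> x') = \<beta> x \<otimes>\<^bsub>X\<^esub> \<beta> x'"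
      using inv(1)[OF X.m_closed[OF \<beta>X[OF x(1)] \<beta>X[OF x(2)]]] by simp
  qed
  have pullback: "\<exists>y'\<in>Y. \<forall>x\<in>carrier X. E (\<gamma> x) y = E x y'"
    if \<gamma>: "\<gamma> \<in> hom X X" "continuous_map TX TX \<gamma>" and y: "y \<in> Y" for \<gamma> y
  proof -
    define h where "h = restrict (\<lambda>x. E (\<gamma> x) y) (carrier X)"
    have \<gamma>X: "\<gamma> x \<in> carrier X" if "x \<in> carrier X" for x using hom_in_carrier[OF \<gamma>(1) that] .
    have "h \<in> hom X circle_group"
      by (rule homI) (simp_all add: h_def X.m_closed \<gamma>X norm_E hom_mult[OF \<gamma>(1)] E_mult y)
    moreover have "continuous_map TX euclidean ((\<lambda>x. E x y) \<circ> \<gamma>)"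
      by (rule continuous_map_compose[OF \<gamma>(2) continuous_E[OF y]])
    then have "continuous_map TX euclidean h"
      by (rule continuous_map_eq) (simp add: topspace_TX h_def del: topspace_prod_topology)
    then have "continuous_map TX circle_topology h"
      by (auto simp: continuous_map_in_subtopology topspace_TX norm_E \<gamma>X h_def simp del: topspace_prod_topology)
    ultimately have "h \<in> characters X TX" by (simp add: characters_def h_def)
    from character_classification[OF this] show ?thesis by (simp add: h_def)
  qed
  have "\<exists>y'. y' \<in> Y \<and> (\<forall>x\<in>carrier X. E (\<alpha> x) y = E x y')" if "y \<in> Y" for y
    using pullback[OF \<alpha>_hom cont(1) that] by blast
  then obtain T where T: "\<And>y. y \<in> Y \<Longrightarrow> T y \<in> Y" "\<And>y x. y \<in> Y \<Longrightarrow> x \<in> carrier X \<Longrightarrow> E (\<alpha> x) y = E x (T y)"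
    by metis
  have T_add: "T (y + y') = T y + T y'" if y: "y \<in> Y" "y' \<in> Y" for y y'
  proof (rule E_faithful)
    fix x assume x: "x \<in> carrier X"
    have "E (\<alpha> x) (y + y') = E (\<alpha> x) y * E (\<alpha> x) y'" by (rule E_add[OF \<alpha>X[OF x] y])
    then have "E x (T (y + y')) = E x (T y) * E x (T y')"
      by (simp only: T(2)[OF Y_add[OF y] x] T(2)[OF y(1) x] T(2)[OF y(2) x])
    then show "E x (T (y + y')) = E x (T y + T y')" by (simp only: E_add[OF x T(1)[OF y(1)] T(1)[OF y(2)]])
  qed (use T(1) Y_add y in blast)+
  have T_surj: "\<exists>y'\<in>Y. T y' = y" if y: "y \<in> Y" for y
  proof -
    obtain y' where y': "y' \<in> Y" "\<And>x. x \<in> carrier X \<Longrightarrow> E (\<beta> x) y = E x y'"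
      using pullback[OF \<beta>_hom cont(2) y] by blast
    have "T y' = y"
    proof (rule E_faithful[OF T(1)[OF y'(1)] y])
      fix x assume x: "x \<in> carrier X"
      show "E x (T y') = E x y" using T(2)[OF y'(1) x] y'(2)[OF \<alpha>X[OF x]] inv(1)[OF x] by simp
    qed
    then show ?thesis using y'(1) by blast
  qed
  define p where "p = fst (T (1, 0))"
  define c where "c = fst (T (0, 1))"
  define e where "e = snd (T (0, 1))"
  have H1: "x \<in> H_multiples 1 \<longleftrightarrow> x \<in> H" for x by (simp add: H_multiples_def)
  have Tadd: "T (r + r', n + n') = T (r, n) + T (r', n')" if "r \<in> H" "r' \<in> H" for r r' n n'
    using T_add[of "(r, n)" "(r', n')"] that by simp
  have fst_r: "fst (T (r, 0)) = p * r" if "r \<in> H" for r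
  proof -
    have "fst (T (r, 0)) = fst (T (of_int 1, 0)) / of_int 1 * r"
      by (rule additive_on_H_multiples[where L = "\<lambda>r. fst (T (r, 0))"])
        (use that Tadd[of _ _ 0 0] in \<open>simp_all add: H1\<close>)
    then show ?thesis by (simp add: p_def)
  qed
  have snd_r: "snd (T (r, 0)) = 0" if "r \<in> H" for r
  proof -
    have lin: "real_of_int (snd (T (s, 0))) = real_of_int (snd (T (of_int 1, 0))) / of_int 1 * s" if "s \<in> H" for s
      by (rule additive_on_H_multiples[where L = "\<lambda>r. real_of_int (snd (T (r, 0)))"])
        (use that Tadd[of _ _ 0 0] in \<open>simp_all add: H1\<close>)
    define m where "m = snd (T (1, 0))"
    have "m = 0"
    proof (rule ccontr)
      assume "m \<noteq> 0"
      \<comment> \<open>The image of 1 would be divisible by every \<open>A k\<close>; already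
        \<open>k\<close> equal to its absolute value is too large, as \<open>A k\<close> exceeds
        \<open>k\<close>.\<close>
      define k where "k = nat \<bar>m\<bar>"
      have "real_of_int (snd (T (1 / of_int (A k), 0))) = of_int m * (1 / of_int (A k))"
        using lin[of "1 / of_int (A k)"] H_I[of 1 k] by (simp add: m_def)
      then have "real_of_int (snd (T (1 / of_int (A k), 0)) * A k) = of_int m" by (simp add: field_simps)
      then have "m = snd (T (1 / of_int (A k), 0)) * A k" by (simp only: of_int_eq_iff)
      then have "A k dvd m" by simp
      then have "A k \<le> \<bar>m\<bar>" using \<open>m \<noteq> 0\<close> by (intro zdvd_imp_le) simp_all
      then show False using A_ge[of k] by (simp add: k_def)
    qed
    then show ?thesis using lin[OF that] by (simp add: m_def)
  qed
  have fst_n: "fst (T (0, n)) = of_int n * c" for n unfolding c_def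
    by (rule int_additive) (use Tadd[of 0 0] in simp)
  have snd_n: "snd (T (0, n)) = n * e" for n
    using int_additive[of "\<lambda>n. snd (T (0, n))" n] Tadd[of 0 0] by (simp add: e_def)
  have T_eq: "T (r, n) = (p * r + c * of_int n, e * n)" if "r \<in> H" for r n
  proof -
    have "T (r, n) = T (r, 0) + T (0, n)" using Tadd[OF that H_0, of 0 n] by simp
    also have "\<dots> = (p * r + c * of_int n, e * n)"
      using fst_r[OF that] snd_r[OF that] fst_n[of n] snd_n[of n] by (simp add: prod_eq_iff mult.commute)
    finally show ?thesis .
  qed
  have e: "e = 1 \<or> e = - 1"
  proof -
    obtain r n where "r \<in> H" "T (r, n) = (0, 1)" using T_surj[of "(0, 1)"] by auto
    then have "e * n = 1" using T_eq[of r n] by simp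
    then show ?thesis using zmult_eq_1_iff by blast
  qed
  have solve: "\<exists>r'\<in>H. p * r' = r" if "r \<in> H" for r
  proof -
    obtain r' n where "r' \<in> H" "T (r', n) = (r, 0)" using T_surj[of "(r, 0)"] \<open>r \<in> H\<close> by auto
    then show ?thesis using T_eq[of r' n] e by auto
  qed
  have pH: "p * r \<in> H" if "r \<in> H" for r using T(1)[of "(r, 0)"] T_eq[OF that, of 0] that by simp
  have "(\<lambda>x. p * x) ` H = H"
  proof (intro equalityI subsetI)
    fix r assume "r \<in> H"
    then obtain r' where "r' \<in> H" "p * r' = r" using solve by blast
    then show "r \<in> (\<lambda>x. p * x) ` H" by (intro image_eqI[of _ _ r']) simp_all
  qed (use pH in blast)
  moreover have "p \<noteq> 0" using solve[OF H_1] by auto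
  moreover have "c \<in> H" using T(1)[of "(0, 1)"] by (auto simp: c_def mem_Times_iff)
  moreover have "E (\<alpha> x) (r, n) = E x (p * r + c * of_int n, e * n)" if "x \<in> carrier X" "r \<in> H" for x r n
    using T(2)[of "(r, n)" x] that T_eq by simp
  ultimately show ?thesis using e by (intro exI[of _ p] exI[of _ c] exI[of _ e]) simp
qed

end

section \<open>Probability distributions and their characteristic functions\<close>

lemma space_borel_of [simp]: "space (borel_of T) = topspace T"
  unfolding borel_of_def by (rule space_measure_of) (auto dest: openin_subset)

lemma sets_borel_of: "sets (borel_of T) = sigma_sets (topspace T) {U. openin T U}"
  unfolding borel_of_def by (rule sets_measure_of) (auto dest: openin_subset)

lemma openin_borel_of: "openin T U \<Longrightarrow> U \<in> sets (borel_of T)"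
  by (simp add: sets_borel_of)

lemma measurable_borel_of:
  assumes "continuous_map T euclidean f"
  shows "f \<in> borel_measurable (borel_of T)"
proof (rule borel_measurableI)
  fix S :: "'b set" assume "open S"
  then have "openin T {x \<in> topspace T. f x \<in> S}"
    using openin_continuous_map_preimage[OF assms] by simp
  then show "f -` S \<inter> space (borel_of T) \<in> sets (borel_of T)"
    by (auto simp: Int_def conj_commute vimage_def intro!: openin_borel_of)
qed

lemma measurable_into_borel_of:
  fixes g :: "'b :: topological_space \<Rightarrow> 'a"
  assumes "continuous_map euclidean T g"
  shows "g \<in> borel \<rightarrow>\<^sub>M borel_of T"
  unfolding borel_of_def
proof (rule measurable_measure_of)
  show "{U. openin T U} \<subseteq> Pow (topspace T)" by (auto dest: openin_subset)
  show "g \<in> space borel \<rightarrow> topspace T" using continuous_map_image_subset_topspace[OF assms] by auto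
  show "g -` U \<inter> space borel \<in> sets borel" if "U \<in> {U. openin T U}" for U
    using openin_continuous_map_preimage[OF assms] that by (auto simp: vimage_def)
qed

text \<open>The Cauchy-Schwarz inequality in disguise; the degenerate case \<open>A = 0\<close> is
  included because the variance of a unimodular function can vanish.\<close>

lemma nonneg_quadratic_discriminant:
  fixes A B C :: real
  assumes "\<And>t. 0 \<le> t\<^sup>2 * A - 2 * t * C + B" "A \<ge> 0"
  shows "C\<^sup>2 \<le> A * B"
proof (cases "A = 0")
  case True
  have "C = 0"
  proof (rule ccontr)
    assume "C \<noteq> 0"
    then show False using assms(1)[of "(B + 1) / (2 * C)"] True by simp
  qed
  then show ?thesis using True by simp
next
  case False
  then have "0 \<le> B - C\<^sup>2 / A"
    using assms(1)[of "C / A"] by (simp add: power2_eq_square field_simps)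
  then show ?thesis using False assms(2) by (simp add: field_simps)
qed

context prob_space
begin

lemma unimodular_integrable:
  fixes u :: "'a \<Rightarrow> complex"
  assumes "u \<in> borel_measurable M" "\<And>x. x \<in> space M \<Longrightarrow> cmod (u x) = 1"
  shows "integrable M u"
  using assms by (intro integrable_const_bound[where B = 1]) auto

lemma unimodular_variance:
  fixes u :: "'a \<Rightarrow> complex"
  assumes u: "u \<in> borel_measurable M" "\<And>x. x \<in> space M \<Longrightarrow> cmod (u x) = 1"
  shows "integrable M (\<lambda>x. (cmod (u x - (LINT x|M. u x)))\<^sup>2)"
    and "(LINT x|M. (cmod (u x - (LINT x|M. u x)))\<^sup>2) = 1 - (cmod (LINT x|M. u x))\<^sup>2"
proof -
  define m where "m = (LINT x|M. u x)"
  have int: "integrable M u" by (rule unimodular_integrable[OF u])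
  define R where "R x = Re (u x * cnj m)" for x
  have eq: "(cmod (u x - m))\<^sup>2 = (1 + (cmod m)\<^sup>2) - 2 * R x" if "x \<in> space M" for x
  proof -
    have "(cmod (u x - m))\<^sup>2 = (cmod (u x))\<^sup>2 + (cmod m)\<^sup>2 - 2 * R x"
      unfolding cmod_power2 R_def by (simp add: power2_eq_square algebra_simps)
    then show ?thesis using u(2)[OF that] by simp
  qed
  have int2: "integrable M R" unfolding R_def using int by (intro integrable_Re integrable_mult_left)
  have i1: "integrable M (\<lambda>x. (1 + (cmod m)\<^sup>2) - 2 * R x)" using int2 by simp
  show "integrable M (\<lambda>x. (cmod (u x - (LINT x|M. u x)))\<^sup>2)"
    unfolding m_def[symmetric] by (rule iffD2[OF Bochner_Integration.integrable_cong[OF refl eq] i1])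
  have "(LINT x|M. (cmod (u x - m))\<^sup>2) = (LINT x|M. (1 + (cmod m)\<^sup>2) - 2 * R x)"
    by (rule Bochner_Integration.integral_cong[OF refl eq])
  also have "\<dots> = (1 + (cmod m)\<^sup>2) - 2 * (LINT x|M. R x)"
    using int2 by (simp add: prob_space)
  also have "(LINT x|M. R x) = Re ((LINT x|M. u x) * cnj m)"
    unfolding R_def using int by (subst integral_Re) (auto intro!: integrable_mult_left simp del: times_complex.sel)
  also have "\<dots> = (cmod m)\<^sup>2" unfolding m_def[symmetric] cmod_power2 by (simp add: power2_eq_square)
  finally show "(LINT x|M. (cmod (u x - (LINT x|M. u x)))\<^sup>2) = 1 - (cmod (LINT x|M. u x))\<^sup>2"
    unfolding m_def by simp
qed

text \<open>The left side is the squared modulus of the integral of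
  \<open>(u - m) * (v - n)\<close>, with \<open>m\<close> and \<open>n\<close> the means. It is at
  most the product of the variances by Cauchy-Schwarz, and a unimodular function with mean
  \<open>m\<close> has variance 1 - |m|^2.\<close>

lemma krein_inequality:
  fixes u v :: "'a \<Rightarrow> complex"
  assumes u: "u \<in> borel_measurable M" "\<And>x. x \<in> space M \<Longrightarrow> cmod (u x) = 1"
    and v: "v \<in> borel_measurable M" "\<And>x. x \<in> space M \<Longrightarrow> cmod (v x) = 1"
  shows "(cmod ((LINT x|M. u x * v x) - (LINT x|M. u x) * (LINT x|M. v x)))\<^sup>2
    \<le> (1 - (cmod (LINT x|M. u x))\<^sup>2) * (1 - (cmod (LINT x|M. v x))\<^sup>2)"
proof -
  define m where "m = (LINT x|M. u x)"
  define n where "n = (LINT x|M. v x)"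
  have iu: "integrable M u" and iv: "integrable M v" using unimodular_integrable[OF u] unimodular_integrable[OF v] by simp_all
  have iuv: "integrable M (\<lambda>x. u x * v x)"
    by (rule unimodular_integrable) (use u v in \<open>auto simp: norm_mult\<close>)
  define p where "p x = cmod (u x - m)" for x
  define r where "r x = cmod (v x - n)" for x
  have p2: "integrable M (\<lambda>x. (p x)\<^sup>2)" "(LINT x|M. (p x)\<^sup>2) = 1 - (cmod m)\<^sup>2"
    using unimodular_variance[OF u] by (simp_all add: p_def m_def)
  have r2: "integrable M (\<lambda>x. (r x)\<^sup>2)" "(LINT x|M. (r x)\<^sup>2) = 1 - (cmod n)\<^sup>2"
    using unimodular_variance[OF v] by (simp_all add: r_def n_def)
  have uv: "u x * v x - m * v x - n * u x + m * n = (u x - m) * (v x - n)" for x by (simp add: algebra_simps)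
  have i0: "integrable M (\<lambda>x. u x * v x - m * v x - n * u x + m * n)" using iu iv iuv by simp
  then have ipr: "integrable M (\<lambda>x. p x * r x)"
    using integrable_norm[OF i0] by (simp add: uv norm_mult p_def r_def)
  have "(LINT x|M. u x * v x - m * v x - n * u x + m * n) = (LINT x|M. u x * v x) - m * n"
    using iu iv iuv by (simp add: prob_space m_def[symmetric] n_def[symmetric])
  then have "cmod ((LINT x|M. u x * v x) - m * n) \<le> (LINT x|M. p x * r x)"
    using integral_norm_bound[of M "\<lambda>x. u x * v x - m * v x - n * u x + m * n"] by (simp add: uv norm_mult p_def r_def)
  then have 1: "(cmod ((LINT x|M. u x * v x) - m * n))\<^sup>2 \<le> (LINT x|M. p x * r x)\<^sup>2" by (intro power_mono) auto
  have "(LINT x|M. p x * r x)\<^sup>2 \<le> (1 - (cmod m)\<^sup>2) * (1 - (cmod n)\<^sup>2)"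
  proof (rule nonneg_quadratic_discriminant)
    fix t :: real
    have "0 \<le> (LINT x|M. (t * p x - r x)\<^sup>2)" by (rule integral_nonneg_AE) simp
    also have "\<dots> = (LINT x|M. t\<^sup>2 * (p x)\<^sup>2 - 2 * t * (p x * r x) + (r x)\<^sup>2)"
      by (intro Bochner_Integration.integral_cong refl) (simp add: power2_eq_square algebra_simps)
    also have "\<dots> = t\<^sup>2 * (1 - (cmod m)\<^sup>2) - 2 * t * (LINT x|M. p x * r x) + (1 - (cmod n)\<^sup>2)"
      using p2 r2 ipr by simp
    finally show "0 \<le> t\<^sup>2 * (1 - (cmod m)\<^sup>2) - 2 * t * (LINT x|M. p x * r x) + (1 - (cmod n)\<^sup>2)" .
    show "0 \<le> 1 - (cmod m)\<^sup>2" unfolding p2(2)[symmetric] by (rule integral_nonneg_AE) simp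
  qed
  then show ?thesis using 1 by (simp add: m_def n_def)
qed

text \<open>A unimodular function whose mean has modulus 1 has variance 0.\<close>

lemma AE_constant_of_unimodular_mean:
  fixes u :: "'a \<Rightarrow> complex"
  assumes u: "u \<in> borel_measurable M" "\<And>x. x \<in> space M \<Longrightarrow> cmod (u x) = 1"
    and one: "cmod (LINT x|M. u x) = 1"
  shows "AE x in M. u x = (LINT x|M. u x)"
proof -
  have "AE x in M. (cmod (u x - (LINT x|M. u x)))\<^sup>2 = 0"
    using unimodular_variance[OF u] one by (subst integral_nonneg_eq_0_iff_AE[symmetric]) auto
  then show ?thesis by eventually_elim simp
qed

end

context adic_base
begin

lemma E_measurable: "y \<in> Y \<Longrightarrow> (\<lambda>x. E x y) \<in> borel_measurable (borel_of TX)"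
  by (rule measurable_borel_of[OF continuous_E])

lemma countable_Y: "countable Y"
proof -
  have "H = (\<lambda>(m, k). of_int m / of_int (A k)) ` UNIV" by (auto simp: adic_rationals_def)
  then have "countable H" by (metis countable_image countableI_type)
  then show ?thesis by simp
qed

lemma E_0: "x \<in> carrier X \<Longrightarrow> E x 0 = 1"
  using E_add[of x 0 0] norm_E[of x 0] by (auto simp: zero_prod_def)

lemma E_minus: "x \<in> carrier X \<Longrightarrow> y \<in> Y \<Longrightarrow> E x (- y) = cnj (E x y)"
proof -
  assume x: "x \<in> carrier X" and y: "y \<in> Y"
  have "E x (- y) * E x y = 1" using E_add[OF x Y_minus[OF y] y] E_0[OF x] by simp
  moreover have "cnj (E x y) * E x y = 1" using norm_E[OF x, of y] complex_norm_square[of "E x y"] by (simp add: mult.commute)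
  ultimately show ?thesis using norm_E[OF x, of y] by (metis mult_right_cancel norm_zero zero_neq_one)
qed

end

locale solenoid_distribution = adic_base + prob_space \<mu>
  for \<mu> :: "((real \<times> (nat \<Rightarrow> int)) set \<times> complex) measure" +
  assumes sets_mu: "sets \<mu> = sets (borel_of TX)"
begin

lemma space_mu: "space \<mu> = carrier X"
  using sets_eq_imp_space_eq[OF sets_mu] unfolding space_borel_of topspace_TX .

lemma E_meas: "y \<in> Y \<Longrightarrow> (\<lambda>x. E x y) \<in> borel_measurable \<mu>"
  using E_measurable measurable_cong_sets[OF sets_mu refl] by blast

definition ft :: "real \<times> int \<Rightarrow> complex" where "ft y = (LINT x|\<mu>. E x y)"

lemma char_like_ft:
  assumes nz: "\<And>y. y \<in> Y \<Longrightarrow> ft y \<noteq> 0"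
  shows "char_like ft"
  unfolding char_like_def
proof (intro conjI ballI)
  have "ft 0 = (LINT x|\<mu>. 1)" unfolding ft_def
    by (intro Bochner_Integration.integral_cong refl) (simp add: space_mu E_0)
  then show "ft 0 = 1" by (simp add: prob_space)
  fix y assume y: "y \<in> Y"
  have int: "integrable \<mu> (\<lambda>x. E x y)"
    by (rule unimodular_integrable[OF E_meas[OF y]]) (simp add: space_mu norm_E)
  have "ft (- y) = (LINT x|\<mu>. cnj (E x y))" unfolding ft_def
    by (intro Bochner_Integration.integral_cong refl) (simp add: space_mu E_minus y)
  then show "ft (- y) = cnj (ft y)" by (simp add: ft_def)
  have "cmod (ft y) \<le> (LINT x|\<mu>. cmod (E x y))" unfolding ft_def by (rule integral_norm_bound)
  also have "\<dots> = (LINT x|\<mu>. 1)" by (intro Bochner_Integration.integral_cong refl) (simp add: space_mu norm_E)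
  finally show "cmod (ft y) \<le> 1" by (simp add: prob_space)
  fix z assume z: "z \<in> Y"
  have "ft (y + z) = (LINT x|\<mu>. E x y * E x z)" unfolding ft_def
    by (intro Bochner_Integration.integral_cong refl) (simp add: space_mu E_add y z del: mem_Times_iff)
  then show "(cmod (ft (y + z) - ft y * ft z))\<^sup>2 \<le> (1 - (cmod (ft y))\<^sup>2) * (1 - (cmod (ft z))\<^sup>2)"
    using krein_inequality[OF E_meas[OF y] _ E_meas[OF z]] by (simp add: space_mu norm_E ft_def)
qed (use nz in blast)

lemma char_function_evaluation: "char_function \<mu> (evaluation y) = ft y"
  unfolding char_function_def ft_def
  by (intro Bochner_Integration.integral_cong refl) (simp add: space_mu)

lemma AE_E_constant:
  assumes "y \<in> Y" "cmod (ft y) = 1"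
  shows "AE x in \<mu>. E x y = ft y"
  using AE_constant_of_unimodular_mean[OF E_meas[OF assms(1)]] assms(2)
  by (simp add: ft_def space_mu norm_E)

text \<open>Each character is almost surely constant. As \<open>Y\<close> is countable this holds
  for all of them at once, and characters separate points, so the measure sits at a single
  point.\<close>

lemma degenerate_of_unimodular:
  assumes one: "\<And>y. y \<in> Y \<Longrightarrow> cmod (ft y) = 1"
  shows "degenerate_distribution TX \<mu>"
proof -
  have AE: "AE x in \<mu>. \<forall>y\<in>Y. E x y = ft y"
    using AE_E_constant one countable_Y by (subst AE_ball_countable) blast+
  have "\<exists>x\<in>space \<mu>. \<forall>y\<in>Y. E x y = ft y"
  proof (rule ccontr)
    assume "\<not> ?thesis"
    then have "AE x in \<mu>. False" by (intro AE_mp[OF AE AE_I2]) blast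
    then show False by simp
  qed
  then obtain x0 where x0: "x0 \<in> carrier X" "\<And>y. y \<in> Y \<Longrightarrow> E x0 y = ft y" unfolding space_mu by blast
  have eq: "{x0} = {x \<in> space \<mu>. \<forall>y\<in>Y. E x y = ft y}"
  proof (intro equalityI subsetI)
    fix x assume "x \<in> {x \<in> space \<mu>. \<forall>y\<in>Y. E x y = ft y}"
    then have x: "x \<in> carrier X" "\<And>y. y \<in> Y \<Longrightarrow> E x y = ft y" unfolding space_mu by blast+
    have "x = x0" by (rule E_inject[OF x(1) x0(1)]) (simp only: x(2) x0(2))
    then show "x \<in> {x0}" by simp
  qed (use x0 in \<open>simp add: space_mu\<close>)
  have ne: "Y \<noteq> {}" using H_0 by blast
  have "(\<Inter>y\<in>Y. {x \<in> space \<mu>. E x y = ft y}) \<in> sets \<mu>"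
  proof (rule sets.countable_INT'[OF countable_Y ne], rule image_subsetI)
    fix y assume "y \<in> Y"
    have "{x \<in> space \<mu>. E x y = ft y} = (\<lambda>x. E x y) -` {ft y} \<inter> space \<mu>" by auto
    then show "{x \<in> space \<mu>. E x y = ft y} \<in> sets \<mu>"
      using measurable_sets[OF E_meas[OF \<open>y \<in> Y\<close>], of "{ft y}"] by simp
  qed
  also have "(\<Inter>y\<in>Y. {x \<in> space \<mu>. E x y = ft y}) = {x \<in> space \<mu>. \<forall>y\<in>Y. E x y = ft y}"
    using ne by blast
  finally have "{x \<in> space \<mu>. \<forall>y\<in>Y. E x y = ft y} \<in> sets \<mu>" .
  then have "prob {x0} = 1" unfolding eq using AE by (subst prob_Collect_eq_1) auto
  then show ?thesis
    unfolding degenerate_distribution_def prob_distribution_on_def topspace_TX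
    using x0(1) sets_mu prob_space_axioms by blast
qed

end

section \<open>Gaussian distributions and their supports\<close>

text \<open>The base condition says that the functions \<open>g i\<close> determine the topology of
  the target, so continuity can be tested after composing with them.\<close>

lemma continuous_map_into_base:
  fixes g :: "'i \<Rightarrow> 'b \<Rightarrow> complex"
  assumes base: "\<And>U x. openin T' U \<Longrightarrow> x \<in> U \<Longrightarrow> \<exists>F \<epsilon>. finite F \<and> F \<subseteq> I \<and> \<epsilon> > 0 \<and>
      (\<forall>x'\<in>topspace T'. (\<forall>i\<in>F. cmod (g i x' - g i x) < \<epsilon>) \<longrightarrow> x' \<in> U)"
    and f: "\<And>x. x \<in> topspace T \<Longrightarrow> f x \<in> topspace T'"
    and cont: "\<And>i. i \<in> I \<Longrightarrow> continuous_map T euclidean (\<lambda>x. g i (f x))"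
  shows "continuous_map T T' f"
  unfolding continuous_map_def
proof (intro conjI allI impI)
  show "f \<in> topspace T \<rightarrow> topspace T'" using f by blast
  fix U assume U: "openin T' U"
  show "openin T {x \<in> topspace T. f x \<in> U}"
  proof (subst openin_subopen, intro ballI)
    fix x assume "x \<in> {x \<in> topspace T. f x \<in> U}"
    then have x: "x \<in> topspace T" "f x \<in> U" by auto
    from base[OF U x(2)] obtain F \<epsilon> where F': "finite F \<and> F \<subseteq> I \<and> \<epsilon> > 0 \<and>
      (\<forall>x'\<in>topspace T'. (\<forall>i\<in>F. cmod (g i x' - g i (f x)) < \<epsilon>) \<longrightarrow> x' \<in> U)" by (elim exE)
    have F: "finite F" "F \<subseteq> I" "\<epsilon> > 0" using F' by simp_all
    have F4: "x' \<in> U" if "x' \<in> topspace T'" "\<And>i. i \<in> F \<Longrightarrow> cmod (g i x' - g i (f x)) < \<epsilon>" for x'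
      using F' that by simp
    define V where "V = (\<Inter>i\<in>F. {x' \<in> topspace T. g i (f x') \<in> ball (g i (f x)) \<epsilon>}) \<inter> topspace T"
    have "openin T V" unfolding V_def
      using F(1,2) by (intro openin_INT openin_continuous_map_preimage[OF cont]) auto
    moreover have "x \<in> V" using x(1) F(3) by (simp add: V_def)
    moreover have "V \<subseteq> {x \<in> topspace T. f x \<in> U}"
    proof
      fix x' assume x': "x' \<in> V"
      then have "f x' \<in> U" using f by (intro F4) (auto simp: V_def dist_norm norm_minus_commute)
      then show "x' \<in> {x \<in> topspace T. f x \<in> U}" using x' by (simp add: V_def)
    qed
    ultimately show "\<exists>V. openin T V \<and> x \<in> V \<and> V \<subseteq> {x \<in> topspace T. f x \<in> U}" by blast
  qed
qed

context adic_base
begin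

lemma continuous_map_into_TX:
  assumes "\<And>x. x \<in> topspace T \<Longrightarrow> f x \<in> carrier X"
    and "\<And>y. y \<in> Y \<Longrightarrow> continuous_map T euclidean (\<lambda>x. E (f x) y)"
  shows "continuous_map T TX f"
  by (rule continuous_map_into_base[where g = "\<lambda>y x. E x y" and I = Y])
    (simp_all only: topspace_TX TX_base assms)

lemma continuous_map_into_TS:
  assumes "\<And>x. x \<in> topspace T \<Longrightarrow> f x \<in> carrier \<Sigma>"
    and "\<And>r. r \<in> H \<Longrightarrow> continuous_map T euclidean (\<lambda>x. chi r (f x))"
  shows "continuous_map T TS f"
  by (rule continuous_map_into_base[where g = chi and I = H])
    (simp_all only: topspace_TS TS_base assms)

abbreviation CG where "CG \<equiv> character_group X TX"

lemma CG_carrier: "carrier CG = evaluation ` Y"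
proof
  show "evaluation ` Y \<subseteq> carrier CG" using evaluation_character by (auto simp: character_group_def)
  show "carrier CG \<subseteq> evaluation ` Y"
  proof
    fix c assume "c \<in> carrier CG"
    then have c: "c \<in> characters X TX" by (simp add: character_group_def)
    obtain y where y: "y \<in> Y" "\<And>x. x \<in> carrier X \<Longrightarrow> c x = E x y" using character_classification[OF c] by blast
    have "c \<in> extensional (carrier X)" using c by (simp add: characters_def)
    then have "c = evaluation y" unfolding evaluation_def
      by (rule extensionalityI[OF _ restrict_extensional]) (simp add: y(2))
    then show "c \<in> evaluation ` Y" using y(1) by blast
  qed
qed

lemma evaluation_mult:
  assumes "y \<in> Y" "y' \<in> Y"
  shows "evaluation y \<otimes>\<^bsub>CG\<^esub> evaluation y' = evaluation (y + y')"
  by (simp add: character_group_def evaluation_def restrict_def E_add[OF _ assms] fun_eq_iff)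

lemma evaluation_one: "\<one>\<^bsub>CG\<^esub> = evaluation 0"
  by (simp add: character_group_def evaluation_def restrict_def E_0 fun_eq_iff)

lemma CG_group: "group CG"
proof (rule groupI)
  show "x \<otimes>\<^bsub>CG\<^esub> y \<in> carrier CG" if "x \<in> carrier CG" "y \<in> carrier CG" for x y
    using that unfolding CG_carrier by (elim imageE) (simp only: evaluation_mult imageI[OF Y_add])
  show "\<one>\<^bsub>CG\<^esub> \<in> carrier CG" unfolding CG_carrier evaluation_one by (rule imageI[OF zero_Y])
  show "x \<otimes>\<^bsub>CG\<^esub> y \<otimes>\<^bsub>CG\<^esub> z = x \<otimes>\<^bsub>CG\<^esub> (y \<otimes>\<^bsub>CG\<^esub> z)"
    if "x \<in> carrier CG" "y \<in> carrier CG" "z \<in> carrier CG" for x y z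
    using that unfolding CG_carrier by (elim imageE) (simp only: evaluation_mult Y_add add.assoc)
  show "\<one>\<^bsub>CG\<^esub> \<otimes>\<^bsub>CG\<^esub> x = x" if "x \<in> carrier CG" for x
    using that zero_Y unfolding CG_carrier evaluation_one by (elim imageE) (simp only: evaluation_mult add_0)
  show "\<exists>y\<in>carrier CG. y \<otimes>\<^bsub>CG\<^esub> x = \<one>\<^bsub>CG\<^esub>" if "x \<in> carrier CG" for x
  proof -
    obtain y where y: "y \<in> Y" "x = evaluation y" using \<open>x \<in> carrier CG\<close> unfolding CG_carrier by blast
    then show ?thesis unfolding CG_carrier evaluation_one
      by (intro bexI[of _ "evaluation (- y)"] imageI Y_minus) (simp_all only: evaluation_mult[OF Y_minus] left_minus)
  qed
qed

lemma evaluation_inv: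
  assumes y: "y \<in> Y"
  shows "inv\<^bsub>CG\<^esub> (evaluation y) = evaluation (- y)"
  by (rule group.inv_equality[OF CG_group])
    (simp_all only: evaluation_mult[OF Y_minus[OF y] y] evaluation_one CG_carrier left_minus imageI y Y_minus[OF y])

lemma evaluation_inject: "y \<in> Y \<Longrightarrow> y' \<in> Y \<Longrightarrow> evaluation y = evaluation y' \<Longrightarrow> y = y'"
  by (rule E_faithful) (metis evaluation_eq)+

lemma norm_chi: "cmod (chi r s) = 1"
  by (simp add: chi_def norm_pre_chi)

lemma chi_add: "s \<in> carrier \<Sigma> \<Longrightarrow> r \<in> H \<Longrightarrow> r' \<in> H \<Longrightarrow> chi (r + r') s = chi r s * chi r' s"
  unfolding \<Sigma>_carrier by (elim imageE) (simp only: chi_q H_add pre_chi_add)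

lemma chi_mult: "s \<in> carrier \<Sigma> \<Longrightarrow> s' \<in> carrier \<Sigma> \<Longrightarrow> r \<in> H \<Longrightarrow> chi r (s \<otimes>\<^bsub>\<Sigma>\<^esub> s') = chi r s * chi r s'"
  unfolding \<Sigma>_carrier by (elim imageE) (simp only: \<Sigma>_mult chi_q P.m_closed pre_chi_mult)

text \<open>Here \<open>d\<close> is the order of \<open>t\<close> modulo \<open>H\<close>. By minimality it is coprime to the numerator of \<open>h\<close> over
  every common denominator \<open>A k\<close>, and Bezout's identity gives the representation of \<open>w\<close>.\<close>

lemma rational_direction:
  assumes "t \<in> \<rat>"
  shows "\<exists>d h. d > 0 \<and> h \<in> H \<and> h = of_int d * t \<and> (\<forall>w\<in>H. \<exists>r\<in>H. \<exists>n. w = of_int d * r + h * of_int n)"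
proof -
  define Q where "Q d \<longleftrightarrow> d > 0 \<and> of_nat d * t \<in> H" for d :: nat
  obtain m n where mn: "t = of_int m / of_int n" "n > 0" using assms by (metis Rats_cases')
  then have "of_nat (nat n) * t = of_int m" by simp
  then have "Q (nat n)" using mn(2) by (simp add: Q_def)
  define d where "d = (LEAST d. Q d)"
  have "Q d" unfolding d_def by (rule LeastI[of Q]) fact
  then have d: "d > 0" "of_nat d * t \<in> H" by (auto simp: Q_def)
  define h where "h = of_nat d * t"
  have "\<exists>r\<in>H. \<exists>n. w = of_nat d * r + h * of_int n" if w: "w \<in> H" for w
  proof -
    have hH: "h \<in> H" using d(2) by (simp add: h_def)
    obtain k where "\<forall>x\<in>{w, h}. \<exists>m. x = of_int m / of_int (A k)"
      using adic_rationals_common_denominator[of "{w, h}"] w hH by auto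
    then obtain u v where u: "w = of_int u / of_int (A k)" and v: "h = of_int v / of_int (A k)" by blast
    have "coprime (int d) v"
    proof (rule ccontr)
      assume "\<not> coprime (int d) v"
      define g where "g = gcd (int d) v"
      have g: "g > 0" "g \<noteq> 1" "g dvd int d" "g dvd v"
        using d(1) \<open>\<not> coprime (int d) v\<close> unfolding g_def coprime_iff_gcd_eq_1 by (auto simp: gcd_pos_int)
      obtain d' where d': "int d = g * d'" using g(3) by (auto elim: dvdE)
      obtain v' where v': "v = g * v'" using g(4) by (auto elim: dvdE)
      have "d' > 0" using d' d(1) g(1) by (metis of_nat_0_less_iff zero_less_mult_pos)
      have rd: "real d = of_int g * of_int d'" using arg_cong[OF d', of real_of_int] by simp
      have "real_of_int g * (of_int d' * t) = of_int g * (of_int v' / of_int (A k))"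
        using v unfolding h_def v' rd by (simp add: mult.assoc)
      then have "of_int d' * t = of_int v' / of_int (A k)"
        by (rule mult_left_cancel[THEN iffD1, rotated]) (use g(1) in simp)
      then have "Q (nat d')" using \<open>d' > 0\<close> H_I[of v' k] by (simp add: Q_def)
      then have "d \<le> nat d'" unfolding d_def by (rule Least_le)
      then have "int d \<le> d'" using \<open>d' > 0\<close> by (simp add: le_nat_iff)
      moreover have "1 * d' < g * d'" using g(1,2) \<open>d' > 0\<close> by (intro mult_strict_right_mono) auto
      ultimately show False using d' by simp
    qed
    then obtain x y where xy: "x * int d + y * v = 1" using bezout_int[of "int d" v] by (auto simp: coprime_iff_gcd_eq_1)
    have "u = int d * (u * x) + v * (u * y)" using arg_cong[OF xy, of "\<lambda>z. u * z"] by (simp add: algebra_simps)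
    then have "real_of_int u = real d * real_of_int (u * x) + real_of_int v * real_of_int (u * y)"
      by (metis of_int_add of_int_mult of_int_of_nat_eq)
    then have "w = of_nat d * (of_int (u * x) / of_int (A k)) + h * of_int (u * y)"
      unfolding u v by (simp only: add_divide_distrib times_divide_eq_left times_divide_eq_right)
    then show ?thesis using H_I by blast
  qed
  then show ?thesis using d by (intro exI[of _ "int d"] exI[of _ h]) (simp add: h_def)
qed

end

text \<open>The data of a homomorphism \<open>(r, n)\<close> to \<open>d r + h n\<close> from
  \<open>Y\<close> onto \<open>H\<close>. Its dual \<open>\<tau>\<close> maps the solenoid into
  \<open>X\<close>; surjectivity of the homomorphism makes \<open>\<tau>\<close> injective.\<close>

locale solenoid_embedding = adic_base +
  fixes d :: int and h :: real
  assumes d_pos: "d > 0" and h_H: "h \<in> H"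
    and generate: "\<And>w. w \<in> H \<Longrightarrow> \<exists>r\<in>H. \<exists>n. w = of_int d * r + h * of_int n"
begin

lemma lin_H: "r \<in> H \<Longrightarrow> of_int d * r + h * of_int n \<in> H"
  using H_mult[of r d] H_mult[OF h_H, of n] by (simp add: H_add mult.commute)

definition \<tau> :: "(real \<times> (nat \<Rightarrow> int)) set \<Rightarrow> (real \<times> (nat \<Rightarrow> int)) set \<times> complex"
  where "\<tau> s = (SOME x. x \<in> carrier X \<and> (\<forall>y\<in>Y. E x y = chi (of_int d * fst y + h * of_int (snd y)) s))"

lemma tau:
  assumes s: "s \<in> carrier \<Sigma>"
  shows "\<tau> s \<in> carrier X" and "r \<in> H \<Longrightarrow> E (\<tau> s) (r, n) = chi (of_int d * r + h * of_int n) s"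
proof -
  have "\<exists>x\<in>carrier X. \<forall>y\<in>Y. E x y = chi (of_int d * fst y + h * of_int (snd y)) s"
  proof (rule E_surj)
    fix y y' assume y: "y \<in> Y" "y' \<in> Y"
    have "of_int d * fst (y + y') + h * of_int (snd (y + y')) =
        (of_int d * fst y + h * of_int (snd y)) + (of_int d * fst y' + h * of_int (snd y'))"
      by (simp add: algebra_simps)
    then show "chi (of_int d * fst (y + y') + h * of_int (snd (y + y'))) s =
       chi (of_int d * fst y + h * of_int (snd y)) s * chi (of_int d * fst y' + h * of_int (snd y')) s"
      using chi_add[OF s lin_H lin_H] y by auto
  qed (simp add: norm_chi)
  then have "\<exists>x. x \<in> carrier X \<and> (\<forall>y\<in>Y. E x y = chi (of_int d * fst y + h * of_int (snd y)) s)" by blast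
  from someI_ex[OF this] have "\<tau> s \<in> carrier X \<and> (\<forall>y\<in>Y. E (\<tau> s) y = chi (of_int d * fst y + h * of_int (snd y)) s)"
    unfolding \<tau>_def .
  then show "\<tau> s \<in> carrier X" "r \<in> H \<Longrightarrow> E (\<tau> s) (r, n) = chi (of_int d * r + h * of_int n) s" by auto
qed

lemma tau_mult:
  assumes "s \<in> carrier \<Sigma>" "s' \<in> carrier \<Sigma>"
  shows "\<tau> (s \<otimes>\<^bsub>\<Sigma>\<^esub> s') = \<tau> s \<otimes>\<^bsub>X\<^esub> \<tau> s'"
proof -
  interpret S: comm_group \<Sigma> by (rule \<Sigma>_comm_group)
  have ss: "s \<otimes>\<^bsub>\<Sigma>\<^esub> s' \<in> carrier \<Sigma>" by (rule S.m_closed[OF assms])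
  show ?thesis
  proof (rule E_inject[OF tau(1)[OF ss] X.m_closed[OF tau(1)[OF assms(1)] tau(1)[OF assms(2)]]])
    fix y assume y: "y \<in> Y"
    then obtain r n where rn: "y = (r, n)" "r \<in> H" by blast
    show "E (\<tau> (s \<otimes>\<^bsub>\<Sigma>\<^esub> s')) y = E (\<tau> s \<otimes>\<^bsub>X\<^esub> \<tau> s') y"
      unfolding E_mult[OF tau(1)[OF assms(1)] tau(1)[OF assms(2)] y] unfolding rn(1) tau(2)[OF ss rn(2)]
        tau(2)[OF assms(1) rn(2)] tau(2)[OF assms(2) rn(2)]
      by (rule chi_mult[OF assms lin_H[OF rn(2)]])
  qed
qed

lemma tau_inject:
  assumes "s \<in> carrier \<Sigma>" "s' \<in> carrier \<Sigma>" "\<tau> s = \<tau> s'"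
  shows "s = s'"
proof (rule \<Sigma>_separating[OF assms(1,2)])
  fix w assume "w \<in> H"
  then obtain r n where "r \<in> H" "w = of_int d * r + h * of_int n" using generate by blast
  then show "chi w s = chi w s'" using tau(2)[OF assms(1), of r n] tau(2)[OF assms(2), of r n] assms(3) by simp
qed

abbreviation S where "S \<equiv> \<tau> ` carrier \<Sigma>"

lemma S_carrier: "S \<subseteq> carrier X"
  using tau(1) by blast

lemma S_subgroup: "subgroup S X"
proof -
  interpret S: comm_group \<Sigma> by (rule \<Sigma>_comm_group)
  interpret group_hom \<Sigma> X \<tau>
    by unfold_locales (auto intro!: homI tau(1) tau_mult)
  show ?thesis by (rule img_is_subgroup)
qed

text \<open>The image of the dual map is the annihilator of the kernel. If \<open>x\<close>
  annihilates the kernel, its pairing with \<open>Y\<close> factors through the surjection onto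
  \<open>H\<close>, and the resulting character of \<open>H\<close> is a point of the
  solenoid.\<close>

lemma S_iff:
  "x \<in> S \<longleftrightarrow> x \<in> carrier X \<and> (\<forall>r\<in>H. \<forall>n. of_int d * r + h * of_int n = 0 \<longrightarrow> E x (r, n) = 1)"
proof
  assume "x \<in> S"
  then obtain s where s: "s \<in> carrier \<Sigma>" "x = \<tau> s" by blast
  have "chi 0 s = 1" by (simp add: chi_def pre_chi_def)
  then show "x \<in> carrier X \<and> (\<forall>r\<in>H. \<forall>n. of_int d * r + h * of_int n = 0 \<longrightarrow> E x (r, n) = 1)"
    using tau[OF s(1)] s(2) by metis
next
  assume x: "x \<in> carrier X \<and> (\<forall>r\<in>H. \<forall>n. of_int d * r + h * of_int n = 0 \<longrightarrow> E x (r, n) = 1)"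
  then have xX: "x \<in> carrier X" by blast
  have "\<exists>g. g \<in> Y \<and> (w \<in> H \<longrightarrow> w = of_int d * fst g + h * of_int (snd g))" for w
  proof (cases "w \<in> H")
    case True
    then obtain r n where "r \<in> H" "w = of_int d * r + h * of_int n" using generate by blast
    then show ?thesis by (intro exI[of _ "(r, n)"]) simp
  next
    case False then show ?thesis using zero_Y by blast
  qed
  then obtain g where g: "\<And>w. g w \<in> Y" "\<And>w. w \<in> H \<Longrightarrow> w = of_int d * fst (g w) + h * of_int (snd (g w))" by metis
  have well: "E x y = E x y'" if y: "y \<in> Y" "y' \<in> Y"
    and eq: "of_int d * fst y + h * of_int (snd y) = of_int d * fst y' + h * of_int (snd y')" for y y'
  proof -
    have "y - y' \<in> Y" using Y_add[OF y(1) Y_minus[OF y(2)]] by simp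
    moreover have "of_int d * fst (y - y') + h * of_int (snd (y - y')) = 0" using eq by (simp add: algebra_simps)
    ultimately have "E x (y - y') = 1" using x by (cases "y - y'") auto
    then show ?thesis using E_add[OF xX \<open>y - y' \<in> Y\<close> y(2)] by simp
  qed
  have gw: "of_int d * fst (g (of_int d * fst y + h * of_int (snd y))) + h * of_int (snd (g (of_int d * fst y + h * of_int (snd y))))
    = of_int d * fst y + h * of_int (snd y)" if "y \<in> Y" for y
    using g(2)[OF lin_H[of "fst y" "snd y"]] that by auto
  \<comment> \<open>The character of \<open>H\<close> is extended to \<open>Y\<close> by ignoring
    the integer coordinate; the point of \<open>X\<close> representing it has the desired point of
    the solenoid as first component. \<open>g\<close> selects preimages in \<open>Y\<close>.\<close>
  have "\<exists>x'\<in>carrier X. \<forall>y\<in>Y. E x' y = E x (g (fst y))"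
  proof (rule E_surj)
    fix y y' assume y: "y \<in> Y" "y' \<in> Y"
    have H: "fst y \<in> H" "fst y' \<in> H" using y by auto
    have "of_int d * fst (g (fst y + fst y')) + h * of_int (snd (g (fst y + fst y'))) = fst y + fst y'"
      using g(2)[OF H_add[OF H]] by simp
    also have "\<dots> = of_int d * fst (g (fst y) + g (fst y')) + h * of_int (snd (g (fst y) + g (fst y')))"
      using g(2)[OF H(1)] g(2)[OF H(2)] by (simp add: algebra_simps)
    finally have "E x (g (fst y + fst y')) = E x (g (fst y) + g (fst y'))"
      by (rule well[OF g(1) Y_add[OF g(1) g(1)]])
    then show "E x (g (fst (y + y'))) = E x (g (fst y)) * E x (g (fst y'))"
      using E_add[OF xX g(1) g(1)] by simp
  qed (rule norm_E[OF xX])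
  then obtain x' where x': "x' \<in> carrier X" "\<And>y. y \<in> Y \<Longrightarrow> E x' y = E x (g (fst y))" by blast
  then obtain s where s: "s \<in> carrier \<Sigma>" "\<And>r n. E x' (r, 0) = chi r s"
    unfolding carrier_DirProd by (auto simp: E_def)
  have "x = \<tau> s"
  proof (rule E_inject[OF xX tau(1)[OF s(1)]])
    fix y assume y: "y \<in> Y"
    then obtain r n where rn: "y = (r, n)" "r \<in> H" by blast
    have "E (\<tau> s) y = E x' (of_int d * r + h * of_int n, 0)" unfolding rn(1) tau(2)[OF s(1) rn(2)] s(2) ..
    also have "\<dots> = E x (g (of_int d * r + h * of_int n))" using x'(2)[of "(of_int d * r + h * of_int n, 0)"] lin_H[OF rn(2)] by simp
    also have "\<dots> = E x y" by (rule well[OF g(1) y]) (use gw[OF y] in \<open>simp add: rn(1)\<close>)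
    finally show "E x y = E (\<tau> s) y" by simp
  qed
  then show "x \<in> S" using s(1) by blast
qed

lemma continuous_tau: "continuous_map TS TX \<tau>"
proof (rule continuous_map_into_TX)
  fix y assume "y \<in> Y"
  then obtain r n where rn: "y = (r, n)" "r \<in> H" by blast
  show "continuous_map TS euclidean (\<lambda>s. E (\<tau> s) y)"
    by (rule continuous_map_eq[OF continuous_chi[OF lin_H[OF rn(2), of n]]]) (simp add: rn tau(2))
qed (simp add: tau(1))

text \<open>The inverse is continuous because each \<open>chi w\<close> composed with it is the
  restriction of a character of \<open>X\<close>, namely of one mapped to \<open>w\<close> by the
  surjection.\<close>

lemma topological_iso_S:
  "topological_iso (X\<lparr>carrier := S\<rparr>) (subtopology TX S) \<Sigma> TS \<noteq> {}"
proof -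
  interpret \<Sigma>: comm_group \<Sigma> by (rule \<Sigma>_comm_group)
  define \<rho> where "\<rho> = inv_into (carrier \<Sigma>) \<tau>"
  have inj: "inj_on \<tau> (carrier \<Sigma>)" by (intro inj_onI tau_inject)
  have \<rho>_tau: "\<rho> (\<tau> s) = s" if "s \<in> carrier \<Sigma>" for s unfolding \<rho>_def by (rule inv_into_f_f[OF inj that])
  have top: "topspace (subtopology TX S) = S"
    using S_carrier unfolding topspace_subtopology topspace_TX by blast
  have "\<rho> \<in> iso (X\<lparr>carrier := S\<rparr>) \<Sigma>"
  proof (rule isoI)
    show "\<rho> \<in> hom (X\<lparr>carrier := S\<rparr>) \<Sigma>"
    proof (rule homI)
      show "\<rho> x \<in> carrier \<Sigma>" if "x \<in> carrier (X\<lparr>carrier := S\<rparr>)" for x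
        using that \<rho>_tau by auto
      show "\<rho> (x \<otimes>\<^bsub>X\<lparr>carrier := S\<rparr>\<^esub> x') = \<rho> x \<otimes>\<^bsub>\<Sigma>\<^esub> \<rho> x'"
        if xx: "x \<in> carrier (X\<lparr>carrier := S\<rparr>)" "x' \<in> carrier (X\<lparr>carrier := S\<rparr>)" for x x'
      proof -
        obtain s s' where s: "s \<in> carrier \<Sigma>" "x = \<tau> s" "s' \<in> carrier \<Sigma>" "x' = \<tau> s'" using xx by auto
        have "x \<otimes>\<^bsub>X\<lparr>carrier := S\<rparr>\<^esub> x' = \<tau> (s \<otimes>\<^bsub>\<Sigma>\<^esub> s')" using tau_mult[OF s(1,3)] s(2,4) by simp
        then show ?thesis using \<rho>_tau \<Sigma>.m_closed[OF s(1,3)] s by simp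
      qed
    qed
    show "bij_betw \<rho> (carrier (X\<lparr>carrier := S\<rparr>)) (carrier \<Sigma>)"
      unfolding \<rho>_def by (simp add: bij_betw_inv_into inj_on_imp_bij_betw[OF inj])
  qed
  moreover have "homeomorphic_maps (subtopology TX S) TS \<rho> \<tau>"
    unfolding homeomorphic_maps_def
  proof (intro conjI ballI)
    show "continuous_map (subtopology TX S) TS \<rho>"
    proof (rule continuous_map_into_TS)
      show "\<rho> x \<in> carrier \<Sigma>" if "x \<in> topspace (subtopology TX S)" for x using that \<rho>_tau unfolding top by auto
      fix w assume "w \<in> H"
      then obtain r n where rn: "r \<in> H" "w = of_int d * r + h * of_int n" using generate by blast
      have "(r, n) \<in> Y" using rn(1) by simp
      then have "continuous_map (subtopology TX S) euclidean (\<lambda>x. E x (r, n))"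
        by (intro continuous_map_from_subtopology continuous_E)
      then show "continuous_map (subtopology TX S) euclidean (\<lambda>x. chi w (\<rho> x))"
      proof (rule continuous_map_eq)
        fix x assume "x \<in> topspace (subtopology TX S)"
        then obtain s where s: "s \<in> carrier \<Sigma>" "x = \<tau> s" unfolding top by blast
        show "E x (r, n) = chi w (\<rho> x)" unfolding s(2) \<rho>_tau[OF s(1)] tau(2)[OF s(1) rn(1)] rn(2) ..
      qed
    qed
    show "continuous_map TS (subtopology TX S) \<tau>"
      using continuous_tau by (auto simp: continuous_map_in_subtopology)
    show "\<tau> (\<rho> x) = x" if "x \<in> topspace (subtopology TX S)" for x using that \<rho>_tau unfolding top by auto
    show "\<rho> (\<tau> s) = s" if "s \<in> topspace TS" for s using that \<rho>_tau by simp
  qed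
  then have "homeomorphic_map (subtopology TX S) TS \<rho>" unfolding homeomorphic_map_maps by blast
  ultimately have "\<rho> \<in> topological_iso (X\<lparr>carrier := S\<rparr>) (subtopology TX S) \<Sigma> TS"
    by (simp add: topological_iso_def)
  then show ?thesis by blast
qed

end

lemma (in solenoid_distribution) gaussian_of_gaussian_like:
  assumes g: "gaussian_like ft s t l" and s: "s \<ge> 0"
  shows "gaussian_distribution X TX \<mu>"
proof -
  have l: "\<And>y z. y \<in> Y \<Longrightarrow> z \<in> Y \<Longrightarrow> l (y + z) = l y * l z" "\<And>y. y \<in> Y \<Longrightarrow> cmod (l y) = 1"
    and ft: "\<And>y. y \<in> Y \<Longrightarrow> ft y = l y * exp (- (s * (fst y + t * of_int (snd y))\<^sup>2))"
    using g unfolding gaussian_like_def by blast+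
  \<comment> \<open>The phase is a character of \<open>Y\<close>, so it is evaluation at a point,
    which becomes the shift of the Gaussian distribution.\<close>
  obtain x0 where x0: "x0 \<in> carrier X" "\<And>y. y \<in> Y \<Longrightarrow> E x0 y = l y" using E_surj[OF l] by blast
  define pt where "pt c = (SOME y. y \<in> Y \<and> c = evaluation y)" for c
  have pt: "pt (evaluation y) = y" if "y \<in> Y" for y
    unfolding pt_def by (rule some_equality) (use that evaluation_inject in blast)+
  define \<phi> where "\<phi> c = s * (fst (pt c) + t * of_int (snd (pt c)))\<^sup>2" for c
  have ev: "\<exists>y\<in>Y. c = evaluation y" if "c \<in> carrier CG" for c using that unfolding CG_carrier by blast
  have "prob_distribution_on TX \<mu>"
    unfolding prob_distribution_on_def using sets_mu prob_space_axioms by blast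
  moreover have "continuous_map (character_topology X TX) euclideanreal \<phi>"
    by (rule continuous_map_character_topology[OF X.is_group compact_TX topspace_TX])
  moreover have "\<phi> u \<ge> 0" for u using s by (simp add: \<phi>_def)
  moreover have "\<phi> (u \<otimes>\<^bsub>CG\<^esub> v) + \<phi> (u \<otimes>\<^bsub>CG\<^esub> inv\<^bsub>CG\<^esub> v) = 2 * (\<phi> u + \<phi> v)"
    if uv: "u \<in> carrier CG" "v \<in> carrier CG" for u v
  proof -
    obtain y z where y: "y \<in> Y" "u = evaluation y" and z: "z \<in> Y" "v = evaluation z" using ev uv by blast
    have e1: "pt (u \<otimes>\<^bsub>CG\<^esub> v) = y + z" unfolding y(2) z(2) evaluation_mult[OF y(1) z(1)] by (rule pt[OF Y_add[OF y(1) z(1)]])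
    have e2: "pt (u \<otimes>\<^bsub>CG\<^esub> inv\<^bsub>CG\<^esub> v) = y + - z"
      unfolding y(2) z(2) evaluation_inv[OF z(1)] evaluation_mult[OF y(1) Y_minus[OF z(1)]]
      by (rule pt[OF Y_add[OF y(1) Y_minus[OF z(1)]]])
    have e3: "pt u = y" "pt v = z" using pt y z by simp_all
    show ?thesis unfolding \<phi>_def e1 e2 e3 by (simp add: power2_eq_square algebra_simps)
  qed
  moreover have "char_function \<mu> u = u x0 * complex_of_real (exp (- \<phi> u))" if u: "u \<in> carrier CG" for u
  proof -
    obtain y where y: "y \<in> Y" "u = evaluation y" using ev u by blast
    show ?thesis unfolding y(2) char_function_evaluation \<phi>_def pt[OF y(1)] evaluation_eq[OF x0(1)] x0(2)[OF y(1)] ft[OF y(1)]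
      by simp
  qed
  ultimately show ?thesis unfolding gaussian_distribution_def Let_def using x0(1) by blast
qed

text \<open>The trigonometric polynomial \<open>kernel F x\<close> takes values in \<open>[0, 1]\<close>, equals \<open>1\<close> at \<open>x\<close> and is
  bounded away from \<open>1\<close> off a basic neighbourhood of \<open>x\<close>; its high powers localise a measure
  at \<open>x\<close>, and their integrals depend on the characteristic function only.\<close>

context adic_base
begin

definition kernel :: "(real \<times> int) set \<Rightarrow> (real \<times> (nat \<Rightarrow> int)) set \<times> complex \<Rightarrow>
    (real \<times> (nat \<Rightarrow> int)) set \<times> complex \<Rightarrow> real"
  where "kernel F x x' = (\<Sum>y\<in>F. 1 + Re (E x' y * cnj (E x y))) / (2 * real (card F))"

lemma unit_Re_bounds:
  assumes "cmod z = 1" "cmod w = 1"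
  shows "\<bar>Re (z * cnj w)\<bar> \<le> 1" and "(cmod (z - w))\<^sup>2 = 2 - 2 * Re (z * cnj w)"
proof -
  show "\<bar>Re (z * cnj w)\<bar> \<le> 1" using abs_Re_le_cmod[of "z * cnj w"] assms by (simp add: norm_mult)
  have "(cmod (z - w))\<^sup>2 = (cmod z)\<^sup>2 + (cmod w)\<^sup>2 - 2 * Re (z * cnj w)"
    unfolding cmod_power2 by (simp add: power2_eq_square algebra_simps)
  then show "(cmod (z - w))\<^sup>2 = 2 - 2 * Re (z * cnj w)" using assms by simp
qed

lemma kernel_bounds:
  assumes F: "finite F" "F \<noteq> {}" and x: "x \<in> carrier X" "x' \<in> carrier X"
  shows "0 \<le> kernel F x x'" and "kernel F x x' \<le> 1"
    and "y \<in> F \<Longrightarrow> cmod (E x' y - E x y) \<ge> \<epsilon> \<Longrightarrow> \<epsilon> \<ge> 0 \<Longrightarrow> kernel F x x' \<le> 1 - \<epsilon>\<^sup>2 / (4 * real (card F))"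
proof -
  have card: "real (card F) > 0" using F by (simp add: card_gt_0_iff)
  have R: "\<bar>Re (E x' y * cnj (E x y))\<bar> \<le> 1" for y
    by (rule unit_Re_bounds(1)[OF norm_E[OF x(2)] norm_E[OF x(1)]])
  have b: "0 \<le> 1 + Re (E x' y * cnj (E x y))" "1 + Re (E x' y * cnj (E x y)) \<le> 2" for y using R[of y] by linarith+
  show "0 \<le> kernel F x x'" unfolding kernel_def by (intro divide_nonneg_nonneg sum_nonneg b) simp
  have "(\<Sum>y\<in>F. 1 + Re (E x' y * cnj (E x y))) \<le> (\<Sum>y\<in>F. 2)" by (intro sum_mono b)
  then show "kernel F x x' \<le> 1" unfolding kernel_def using card by (simp add: divide_le_eq mult.commute)
  assume y: "y \<in> F" and \<epsilon>: "cmod (E x' y - E x y) \<ge> \<epsilon>" "\<epsilon> \<ge> 0"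
  have "\<epsilon>\<^sup>2 \<le> (cmod (E x' y - E x y))\<^sup>2" using \<epsilon> by (intro power_mono)
  \<comment> \<open>The summand equals \<open>2\<close> minus half the squared distance of the two
    values; dividing by \<open>2 * card F\<close> gives the constant in the bound.\<close>
  then have "1 + Re (E x' y * cnj (E x y)) \<le> 2 - \<epsilon>\<^sup>2 / 2"
    unfolding unit_Re_bounds(2)[OF norm_E[OF x(2)] norm_E[OF x(1)]] by linarith
  moreover have "(\<Sum>y\<in>F - {y}. 1 + Re (E x' y * cnj (E x y))) \<le> (\<Sum>y\<in>F - {y}. 2)" by (intro sum_mono b)
  moreover have "(\<Sum>y\<in>F. 2 :: real) = 2 + (\<Sum>y\<in>F - {y}. 2)" by (rule sum.remove[OF F(1) y])
  moreover have "(\<Sum>y\<in>F. 1 + Re (E x' y * cnj (E x y))) = (1 + Re (E x' y * cnj (E x y))) + (\<Sum>y\<in>F - {y}. 1 + Re (E x' y * cnj (E x y)))"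
    by (rule sum.remove[OF F(1) y])
  ultimately have "(\<Sum>y\<in>F. 1 + Re (E x' y * cnj (E x y))) \<le> 2 * real (card F) - \<epsilon>\<^sup>2 / 2" by simp
  then have "kernel F x x' \<le> (2 * real (card F) - \<epsilon>\<^sup>2 / 2) / (2 * real (card F))"
    unfolding kernel_def using card by (intro divide_right_mono) auto
  also have "\<dots> = 1 - \<epsilon>\<^sup>2 / (4 * real (card F))" using card by (simp add: field_simps)
  finally show "kernel F x x' \<le> 1 - \<epsilon>\<^sup>2 / (4 * real (card F))" .
qed

lemma kernel_self:
  assumes "finite F" "F \<noteq> {}" "x \<in> carrier X" shows "kernel F x x = 1"
proof -
  have "Re (E x y * cnj (E x y)) = 1" for y
    using norm_E[OF assms(3), of y] by (simp add: complex_norm_square[symmetric] del: times_complex.sel)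
  then have "(\<Sum>y\<in>F. 1 + Re (E x y * cnj (E x y))) = (\<Sum>y\<in>F. 2)" by (intro sum.cong refl) simp
  then show ?thesis unfolding kernel_def using assms by (simp add: card_gt_0_iff)
qed

lemma continuous_kernel:
  assumes "finite F" "F \<subseteq> Y" shows "continuous_map TX euclideanreal (kernel F x)"
proof -
  have "continuous_map TX euclideanreal (\<lambda>x'. Re (E x' y * cnj (E x y)))" if "y \<in> F" for y
    using continuous_E[of y] assms(2) that
    by (intro continuous_map_compose_on[where S = UNIV and g = "\<lambda>z. Re (z * cnj (E x y))"])
      (auto intro!: continuous_intros)
  then have "continuous_map TX euclideanreal (\<lambda>x'. (\<Sum>y\<in>F. 1 + Re (E x' y * cnj (E x y))) * (1 / (2 * real (card F))))"
    using assms(1) by (intro continuous_map_real_mult_right continuous_map_sum continuous_map_add) auto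
  then show ?thesis by (simp add: kernel_def[abs_def])
qed

text \<open>One factor of the kernel is written out by characters, each of which shifts
  \<open>z\<close> by an element of \<open>F\<close> or its negative. This is the induction step for
  the moments.\<close>

lemma kernel_expansion:
  assumes "finite F" "F \<subseteq> Y" and x: "x \<in> carrier X" and x': "x' \<in> carrier X" and z: "z \<in> Y"
  shows "E x' z * complex_of_real (kernel F x x' ^ Suc m) =
    (\<Sum>y\<in>F. E x' z * complex_of_real (kernel F x x' ^ m) +
      (cnj (E x y) / 2) * (E x' (z + y) * complex_of_real (kernel F x x' ^ m)) +
      (E x y / 2) * (E x' (z + - y) * complex_of_real (kernel F x x' ^ m))) / (2 * of_nat (card F))"
proof -
  have Re: "complex_of_real (Re w) = w / 2 + cnj w / 2" for w by (simp add: complex_eq_iff)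
  have k: "complex_of_real (kernel F x x') =
      (\<Sum>y\<in>F. 1 + (E x' y * cnj (E x y) / 2 + cnj (E x' y) * E x y / 2)) / (2 * of_nat (card F))"
    unfolding kernel_def of_real_divide of_real_sum of_real_add Re by simp
  have "E x' z * complex_of_real (kernel F x x' ^ Suc m) =
      E x' z * complex_of_real (kernel F x x' ^ m) * complex_of_real (kernel F x x')"
    by (simp only: power_Suc of_real_mult mult_ac)
  also have "\<dots> = (\<Sum>y\<in>F. E x' z * complex_of_real (kernel F x x' ^ m) *
        (1 + (E x' y * cnj (E x y) / 2 + cnj (E x' y) * E x y / 2))) / (2 * of_nat (card F))"
    unfolding k by (simp only: times_divide_eq_right sum_distrib_left)
  also have "(\<Sum>y\<in>F. E x' z * complex_of_real (kernel F x x' ^ m) *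
        (1 + (E x' y * cnj (E x y) / 2 + cnj (E x' y) * E x y / 2))) =
      (\<Sum>y\<in>F. E x' z * complex_of_real (kernel F x x' ^ m) +
      (cnj (E x y) / 2) * (E x' (z + y) * complex_of_real (kernel F x x' ^ m)) +
      (E x y / 2) * (E x' (z + - y) * complex_of_real (kernel F x x' ^ m)))"
  proof (rule sum.cong[OF refl])
    fix y assume "y \<in> F"
    then have y: "y \<in> Y" using assms(2) by blast
    show "E x' z * complex_of_real (kernel F x x' ^ m) * (1 + (E x' y * cnj (E x y) / 2 + cnj (E x' y) * E x y / 2)) =
      E x' z * complex_of_real (kernel F x x' ^ m) +
      (cnj (E x y) / 2) * (E x' (z + y) * complex_of_real (kernel F x x' ^ m)) +
      (E x y / 2) * (E x' (z + - y) * complex_of_real (kernel F x x' ^ m))"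
      unfolding E_add[OF x' z y] E_add[OF x' z Y_minus[OF y]] E_minus[OF x' y] by (simp add: algebra_simps)
  qed
  finally show ?thesis .
qed

end

lemma (in solenoid_distribution) kernel_integrable:
  assumes F: "finite F" "F \<noteq> {}" "F \<subseteq> Y" and x: "x \<in> carrier X"
  shows "z \<in> Y \<Longrightarrow> integrable \<mu> (\<lambda>x'. E x' z * complex_of_real (kernel F x x' ^ m))"
    and "kernel F x \<in> borel_measurable \<mu>"
proof -
  show meas: "kernel F x \<in> borel_measurable \<mu>"
    using measurable_borel_of[OF continuous_kernel[OF F(1,3)]] measurable_cong_sets[OF sets_mu refl] by blast
  assume z: "z \<in> Y"
  show "integrable \<mu> (\<lambda>x'. E x' z * complex_of_real (kernel F x x' ^ m))"
  proof (rule integrable_const_bound[where B = 1])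
    show "AE x' in \<mu>. cmod (E x' z * complex_of_real (kernel F x x' ^ m)) \<le> 1"
    proof (rule AE_I2)
      fix x' assume "x' \<in> space \<mu>"
      then have x': "x' \<in> carrier X" by (simp add: space_mu)
      show "cmod (E x' z * complex_of_real (kernel F x x' ^ m)) \<le> 1"
        using kernel_bounds(1,2)[OF F(1,2) x x'] norm_E[OF x', of z] by (simp add: norm_mult norm_power power_le_one)
    qed
    show "(\<lambda>x'. E x' z * complex_of_real (kernel F x x' ^ m)) \<in> borel_measurable \<mu>"
      using meas E_meas[OF z] by measurable
  qed
qed

text \<open>The induction on \<open>m\<close> must keep \<open>z\<close> arbitrary, since every
  further factor of the kernel shifts the character.\<close>

lemma (in adic_base) kernel_moments_eq:
  assumes \<mu>: "solenoid_distribution a \<mu>" and \<nu>: "solenoid_distribution a \<nu>"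
    and ft: "\<And>y. y \<in> Y \<Longrightarrow> (LINT x|\<mu>. E x y) = (LINT x|\<nu>. E x y)"
    and F: "finite F" "F \<noteq> {}" "F \<subseteq> Y" and x: "x \<in> carrier X"
  shows "z \<in> Y \<Longrightarrow> (LINT x'|\<mu>. E x' z * complex_of_real (kernel F x x' ^ m)) = (LINT x'|\<nu>. E x' z * complex_of_real (kernel F x x' ^ m))"
proof (induction m arbitrary: z)
  case 0
  then show ?case using ft by simp
next
  case (Suc m)
  have expand: "(LINT x'|\<kappa>. E x' z * complex_of_real (kernel F x x' ^ Suc m)) =
    (\<Sum>y\<in>F. (LINT x'|\<kappa>. E x' z * complex_of_real (kernel F x x' ^ m)) +
      (cnj (E x y) / 2) * (LINT x'|\<kappa>. E x' (z + y) * complex_of_real (kernel F x x' ^ m)) +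
      (E x y / 2) * (LINT x'|\<kappa>. E x' (z + - y) * complex_of_real (kernel F x x' ^ m))) / (2 * of_nat (card F))"
    if \<kappa>: "solenoid_distribution a \<kappa>" for \<kappa>
  proof -
    interpret K: solenoid_distribution a \<kappa> by (rule \<kappa>)
    have int: "integrable \<kappa> (\<lambda>x'. E x' w * complex_of_real (kernel F x x' ^ m))" if "w \<in> Y" for w
      by (rule K.kernel_integrable(1)[OF F x that])
    have i1: "integrable \<kappa> (\<lambda>x'. E x' z * complex_of_real (kernel F x x' ^ m))" by (rule int[OF Suc.prems])
    have yY: "y \<in> Y" if "y \<in> F" for y using that F(3) by (rule subsetD[rotated])
    have i2: "integrable \<kappa> (\<lambda>x'. (cnj (E x y) / 2) * (E x' (z + y) * complex_of_real (kernel F x x' ^ m)))" if "y \<in> F" for y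
      by (rule integrable_mult_right[OF int[OF Y_add[OF Suc.prems yY[OF that]]]])
    have i3: "integrable \<kappa> (\<lambda>x'. (E x y / 2) * (E x' (z + - y) * complex_of_real (kernel F x x' ^ m)))" if "y \<in> F" for y
      by (rule integrable_mult_right[OF int[OF Y_add[OF Suc.prems Y_minus[OF yY[OF that]]]]])
    have "(LINT x'|\<kappa>. E x' z * complex_of_real (kernel F x x' ^ Suc m)) =
      (LINT x'|\<kappa>. (\<Sum>y\<in>F. E x' z * complex_of_real (kernel F x x' ^ m) +
      (cnj (E x y) / 2) * (E x' (z + y) * complex_of_real (kernel F x x' ^ m)) +
      (E x y / 2) * (E x' (z + - y) * complex_of_real (kernel F x x' ^ m))) / (2 * of_nat (card F)))"
      by (intro Bochner_Integration.integral_cong refl kernel_expansion[OF F(1,3) x _ Suc.prems]) (simp add: K.space_mu)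
    also have "\<dots> = (\<Sum>y\<in>F. (LINT x'|\<kappa>. E x' z * complex_of_real (kernel F x x' ^ m) +
      (cnj (E x y) / 2) * (E x' (z + y) * complex_of_real (kernel F x x' ^ m)) +
      (E x y / 2) * (E x' (z + - y) * complex_of_real (kernel F x x' ^ m)))) / (2 * of_nat (card F))"
      by (subst integral_divide_zero, subst Bochner_Integration.integral_sum)
        (intro Bochner_Integration.integrable_add i1 i2 i3, assumption+, rule refl)
    also have "(\<Sum>y\<in>F. (LINT x'|\<kappa>. E x' z * complex_of_real (kernel F x x' ^ m) +
      (cnj (E x y) / 2) * (E x' (z + y) * complex_of_real (kernel F x x' ^ m)) +
      (E x y / 2) * (E x' (z + - y) * complex_of_real (kernel F x x' ^ m)))) =
      (\<Sum>y\<in>F. (LINT x'|\<kappa>. E x' z * complex_of_real (kernel F x x' ^ m)) +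
      (cnj (E x y) / 2) * (LINT x'|\<kappa>. E x' (z + y) * complex_of_real (kernel F x x' ^ m)) +
      (E x y / 2) * (LINT x'|\<kappa>. E x' (z + - y) * complex_of_real (kernel F x x' ^ m)))"
    proof (rule sum.cong[OF refl])
      fix y assume y: "y \<in> F"
      show "(LINT x'|\<kappa>. E x' z * complex_of_real (kernel F x x' ^ m) +
      (cnj (E x y) / 2) * (E x' (z + y) * complex_of_real (kernel F x x' ^ m)) +
      (E x y / 2) * (E x' (z + - y) * complex_of_real (kernel F x x' ^ m))) =
      (LINT x'|\<kappa>. E x' z * complex_of_real (kernel F x x' ^ m)) +
      (cnj (E x y) / 2) * (LINT x'|\<kappa>. E x' (z + y) * complex_of_real (kernel F x x' ^ m)) +
      (E x y / 2) * (LINT x'|\<kappa>. E x' (z + - y) * complex_of_real (kernel F x x' ^ m))"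
        unfolding Bochner_Integration.integral_add[OF Bochner_Integration.integrable_add[OF i1 i2[OF y]] i3[OF y]]
          Bochner_Integration.integral_add[OF i1 i2[OF y]] by simp
    qed
    finally show ?thesis .
  qed
  have zy: "z + y \<in> Y" "z + - y \<in> Y" if "y \<in> F" for y
    by (rule Y_add[OF Suc.prems subsetD[OF F(3) that]], rule Y_add[OF Suc.prems Y_minus[OF subsetD[OF F(3) that]]])
  show ?case unfolding expand[OF \<mu>] expand[OF \<nu>]
    by (intro arg_cong[where f = "\<lambda>w. w / (2 * of_nat (card F))"] sum.cong refl)
      (simp only: Suc.IH[OF Suc.prems] Suc.IH[OF zy(1)] Suc.IH[OF zy(2)])
qed

text \<open>If \<open>U\<close> is null for \<open>\<mu>\<close>, the moments of the kernel are at
  most \<open>\<theta> ^ m\<close>. But \<open>\<nu>\<close> gives positive mass to a neighbourhood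
  \<open>V\<close> of \<open>x\<close> where the kernel exceeds \<open>\<eta> > \<theta>\<close>, so
  the same moments are at least \<open>\<eta> ^ m\<close> times that mass.\<close>

lemma (in adic_base) measure_support_subset:
  assumes \<mu>: "solenoid_distribution a \<mu>" and \<nu>: "solenoid_distribution a \<nu>"
    and ft: "\<And>y. y \<in> Y \<Longrightarrow> (LINT x|\<mu>. E x y) = (LINT x|\<nu>. E x y)"
  shows "measure_support TX \<nu> \<subseteq> measure_support TX \<mu>"
proof
  interpret M: solenoid_distribution a \<mu> by (rule \<mu>)
  interpret N: solenoid_distribution a \<nu> by (rule \<nu>)
  fix x assume "x \<in> measure_support TX \<nu>"
  then have x: "x \<in> carrier X" and x_supp: "\<And>V. openin TX V \<Longrightarrow> x \<in> V \<Longrightarrow> emeasure \<nu> V \<noteq> 0"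
    unfolding measure_support_def topspace_TX by blast+
  have "emeasure \<mu> U \<noteq> 0" if U: "openin TX U" "x \<in> U" for U
  proof
    assume null: "emeasure \<mu> U = 0"
    obtain F0 \<epsilon> where F0: "finite F0" "F0 \<subseteq> Y" "\<epsilon> > 0"
      and nbhd: "\<forall>x'\<in>carrier X. (\<forall>y\<in>F0. cmod (E x' y - E x y) < \<epsilon>) \<longrightarrow> x' \<in> U"
      using TX_base[OF U] by (elim exE conjE) (rule that)
    \<comment> \<open>Adding the trivial character keeps \<open>F\<close> nonempty, so that the
      kernel is normalised.\<close>
    define F where "F = insert 0 F0"
    have F: "finite F" "F \<noteq> {}" "F \<subseteq> Y" using F0 zero_Y by (auto simp: F_def)
    have card: "real (card F) > 0" using F by (simp add: card_gt_0_iff)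
    define \<theta> where "\<theta> = max 0 (1 - \<epsilon>\<^sup>2 / (4 * real (card F)))"
    have \<theta>: "0 \<le> \<theta>" "\<theta> < 1" using F0(3) card by (auto simp: \<theta>_def)
    have off: "kernel F x x' \<le> \<theta>" if x': "x' \<in> carrier X" "x' \<notin> U" for x'
    proof -
      obtain y where "y \<in> F0" "\<not> cmod (E x' y - E x y) < \<epsilon>" using nbhd x' by blast
      then have "kernel F x x' \<le> 1 - \<epsilon>\<^sup>2 / (4 * real (card F))"
        using F0(3) by (intro kernel_bounds(3)[OF F(1,2) x x'(1), of y]) (auto simp: F_def)
      then show ?thesis by (simp add: \<theta>_def)
    qed
    \<comment> \<open>Any number strictly between \<open>\<theta>\<close> and 1 would do.\<close>
    define \<eta> where "\<eta> = (\<theta> + 1) / 2"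
    have \<eta>: "\<theta> < \<eta>" "\<eta> < 1" "0 < \<eta>" using \<theta> by (auto simp: \<eta>_def)
    define V where "V = {x' \<in> topspace TX. kernel F x x' \<in> {\<eta><..}}"
    have V: "openin TX V" unfolding V_def
      by (rule openin_continuous_map_preimage[OF continuous_kernel[OF F(1,3)]]) simp
    have "x \<in> V" using x kernel_self[OF F(1,2) x] \<eta>(2) unfolding V_def topspace_TX by simp
    then have "emeasure \<nu> V \<noteq> 0" by (rule x_supp[OF V])
    then have pos: "N.prob V > 0" by (simp add: N.emeasure_eq_measure zero_less_measure_iff)
    have Uset: "U \<in> sets \<mu>" unfolding M.sets_mu by (rule openin_borel_of[OF U(1)])
    have Vset: "V \<in> sets \<nu>" unfolding N.sets_mu by (rule openin_borel_of[OF V])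
    have "\<eta> ^ m * N.prob V \<le> \<theta> ^ m" for m
    proof -
      have moments: "(LINT x'|\<mu>. kernel F x x' ^ m) = (LINT x'|\<nu>. kernel F x x' ^ m)"
      proof -
        have "complex_of_real (LINT x'|\<kappa>. kernel F x x' ^ m) = (LINT x'|\<kappa>. E x' 0 * complex_of_real (kernel F x x' ^ m))"
          if "solenoid_distribution a \<kappa>" for \<kappa>
        proof -
          interpret K: solenoid_distribution a \<kappa> by (rule that)
          have "(LINT x'|\<kappa>. E x' 0 * complex_of_real (kernel F x x' ^ m)) = (LINT x'|\<kappa>. complex_of_real (kernel F x x' ^ m))"
            by (intro Bochner_Integration.integral_cong refl) (simp add: K.space_mu E_0)
          then show ?thesis by (simp only: integral_complex_of_real)
        qed
        then have "complex_of_real (LINT x'|\<mu>. kernel F x x' ^ m) = complex_of_real (LINT x'|\<nu>. kernel F x x' ^ m)"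
          using kernel_moments_eq[OF \<mu> \<nu> ft F x zero_Y] \<mu> \<nu> by simp
        then show ?thesis by (simp only: of_real_eq_iff)
      qed
      have int: "integrable \<kappa> (\<lambda>x'. kernel F x x' ^ m)" if "solenoid_distribution a \<kappa>" for \<kappa>
      proof -
        interpret K: solenoid_distribution a \<kappa> by (rule that)
        show ?thesis
        proof (rule K.integrable_const_bound[where B = 1])
          show "AE x' in \<kappa>. norm (kernel F x x' ^ m) \<le> 1"
          proof (rule AE_I2)
            fix x' assume "x' \<in> space \<kappa>"
            then have x': "x' \<in> carrier X" by (simp add: K.space_mu)
            show "norm (kernel F x x' ^ m) \<le> 1" using kernel_bounds(1,2)[OF F(1,2) x x'] by (simp add: power_abs power_le_one)
          qed
          show "(\<lambda>x'. kernel F x x' ^ m) \<in> borel_measurable \<kappa>" using K.kernel_integrable(2)[OF F x] by measurable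
        qed
      qed
      have "\<eta> ^ m * N.prob V = (LINT x'|\<nu>. \<eta> ^ m * indicator V x')" using Vset by simp
      also have "\<dots> \<le> (LINT x'|\<nu>. kernel F x x' ^ m)"
      proof (rule integral_mono)
        show "integrable \<nu> (\<lambda>x'. \<eta> ^ m * indicator V x')"
          using Vset by (intro integrable_mult_right) (simp add: N.emeasure_eq_measure)
        show "integrable \<nu> (\<lambda>x'. kernel F x x' ^ m)" by (rule int[OF \<nu>])
        fix x' assume "x' \<in> space \<nu>"
        then have x': "x' \<in> carrier X" by (simp add: N.space_mu)
        show "\<eta> ^ m * indicator V x' \<le> kernel F x x' ^ m"
          using kernel_bounds(1)[OF F(1,2) x x'] \<eta>(3)
          by (cases "x' \<in> V") (auto simp: V_def intro!: power_mono)
      qed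
      also have "\<dots> = (LINT x'|\<mu>. kernel F x x' ^ m)" by (rule moments[symmetric])
      also have "\<dots> \<le> (LINT x'|\<mu>. \<theta> ^ m)"
      proof (rule integral_mono_AE[OF int[OF \<mu>]])
        have "AE x' in \<mu>. x' \<notin> U" using null Uset by (intro AE_not_in) (simp add: null_sets_def)
        then show "AE x' in \<mu>. kernel F x x' ^ m \<le> \<theta> ^ m"
        proof (rule AE_mp[OF _ AE_I2], intro impI)
          fix x' assume "x' \<in> space \<mu>" "x' \<notin> U"
          then show "kernel F x x' ^ m \<le> \<theta> ^ m"
            using off kernel_bounds(1)[OF F(1,2) x] by (intro power_mono) (simp_all add: M.space_mu)
        qed
      qed simp
      also have "\<dots> = \<theta> ^ m" by (simp add: M.prob_space)
      finally show ?thesis .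
    qed
    then have "N.prob V \<le> (\<theta> / \<eta>) ^ m" for m
      using \<eta>(3) by (simp add: power_divide pos_le_divide_eq mult.commute)
    moreover have "(\<lambda>m. (\<theta> / \<eta>) ^ m) \<longlonglongrightarrow> 0" using \<theta> \<eta> by (intro LIMSEQ_power_zero) simp
    ultimately have "N.prob V \<le> 0" by (intro LIMSEQ_le_const[of "\<lambda>m. (\<theta> / \<eta>) ^ m" 0]) auto
    then show False using pos by simp
  qed
  then show "x \<in> measure_support TX \<mu>" using x unfolding measure_support_def topspace_TX by blast
qed

section \<open>The support as a coset of a copy of the solenoid\<close>

lemma std_normal_open_pos:
  assumes "open W" "(W :: real set) \<noteq> {}"
  shows "emeasure std_normal_distribution W \<noteq> 0"
proof
  assume 0: "emeasure std_normal_distribution W = 0"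
  have W: "W \<in> sets borel" using assms(1) by simp
  then have "(\<integral>\<^sup>+ x. ennreal (std_normal_density x) * indicator W x \<partial>lborel) = 0"
    using 0 by (subst (asm) emeasure_density) auto
  then have "AE x in lborel. ennreal (std_normal_density x) * indicator W x = 0"
    using W by (subst (asm) nn_integral_0_iff_AE) auto
  then have "AE x in lborel. x \<notin> W"
  proof (rule AE_mp[OF _ AE_I2], intro impI notI)
    fix x :: real assume "ennreal (std_normal_density x) * indicator W x = 0" "x \<in> W"
    moreover have "std_normal_density x > 0" by (rule normal_density_pos) simp
    ultimately show False by (simp add: ennreal_eq_0_iff)
  qed
  then have "emeasure lborel W = 0" using W by (subst (asm) AE_iff_measurable[of W]) auto
  moreover obtain x e where xe: "e > 0" "ball x e \<subseteq> W" using assms open_contains_ball by blast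
  have "{x - e / 2<..<x + e / 2} \<subseteq> ball x e" using xe(1) by (auto simp: dist_real_def abs_less_iff)
  then have "emeasure lborel {x - e / 2<..<x + e / 2} \<le> emeasure lborel W"
    using xe(2) W by (intro emeasure_mono) auto
  moreover have "emeasure lborel {x - e / 2<..<x + e / 2} = ennreal e" using xe(1) by simp
  ultimately show False using xe(1) by simp
qed

text \<open>The image \<open>\<nu>\<close> of the normal distribution under a translated
  one-parameter subgroup has the same characteristic function as \<open>\<mu>\<close>. That the
  support of \<open>\<mu>\<close> lies in the coset is seen on \<open>\<mu>\<close> directly; the
  reverse inclusion is shown for \<open>\<nu>\<close>, whose line is dense in the coset, and
  transferred by equality of the characteristic functions.\<close>

lemma (in solenoid_distribution) gaussian_like_support:
  assumes g: "gaussian_like ft s t l" and s: "s > 0" and t: "t \<in> \<rat>"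
  shows "\<exists>G. subgroup G X \<and> topological_iso (X\<lparr>carrier := G\<rparr>) (subtopology TX G) \<Sigma> TS \<noteq> {} \<and>
    measure_support TX \<mu> \<in> rcosets\<^bsub>X\<^esub> G"
proof -
  have l: "\<And>y z. y \<in> Y \<Longrightarrow> z \<in> Y \<Longrightarrow> l (y + z) = l y * l z" "\<And>y. y \<in> Y \<Longrightarrow> cmod (l y) = 1"
    and ft: "\<And>y. y \<in> Y \<Longrightarrow> ft y = l y * exp (- (s * (fst y + t * of_int (snd y))\<^sup>2))"
    using g unfolding gaussian_like_def by blast+
  obtain x0 where x0: "x0 \<in> carrier X" "\<And>y. y \<in> Y \<Longrightarrow> E x0 y = l y" using E_surj[OF l] by blast
  obtain d h where d: "d > 0" "h \<in> H" "h = of_int d * t"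
    and gen: "\<forall>w\<in>H. \<exists>r\<in>H. \<exists>n. w = of_int d * r + h * of_int n" using rational_direction[OF t] by blast
  interpret T: solenoid_embedding a d h by unfold_locales (use d gen in blast)+
  have dpos: "real_of_int d > 0" using d(1) by simp
  have lin: "fst y + t * of_int (snd y) = (of_int d * fst y + h * of_int (snd y)) / of_int d" for y :: "real \<times> int"
    using dpos by (simp add: d(3) field_simps)
  let ?z = "\<lambda>_::nat. 0::int"
  \<comment> \<open>The speed is fixed by the variance: half the square of
    \<open>2 * pi * W * b\<close> has to equal \<open>s\<close> times the square of
    \<open>W / d\<close>, where \<open>W\<close> is the image of \<open>y\<close> in
    \<open>H\<close>.\<close>
  define b where "b = sqrt (s / 2) / (pi * of_int d)"
  define \<gamma> where "\<gamma> v = T.\<tau> (q (b * v, ?z)) \<otimes>\<^bsub>X\<^esub> x0" for v :: real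
  have q\<Sigma>: "q (v, ?z) \<in> carrier \<Sigma>" for v unfolding \<Sigma>_carrier using zero_P by blast
  have \<gamma>X: "\<gamma> v \<in> carrier X" for v unfolding \<gamma>_def by (rule X.m_closed[OF T.tau(1)[OF q\<Sigma>] x0(1)])
  have E\<gamma>: "E (\<gamma> v) y = cis (2 * pi * ((of_int d * fst y + h * of_int (snd y)) * (b * v))) * l y" if y: "y \<in> Y" for v y
  proof -
    have r: "fst y \<in> H" using y by auto
    have "E (T.\<tau> (q (b * v, ?z))) y = chi (of_int d * fst y + h * of_int (snd y)) (q (b * v, ?z))"
      using T.tau(2)[OF q\<Sigma> r, of "b * v" "snd y"] by simp
    also have "\<dots> = cis (2 * pi * ((of_int d * fst y + h * of_int (snd y)) * (b * v)))"
      using chi_q[OF zero_P T.lin_H[OF r]] pre_chi_of_int_0 by simp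
    finally show ?thesis unfolding \<gamma>_def E_mult[OF T.tau(1)[OF q\<Sigma>] x0(1) y] x0(2)[OF y] by simp
  qed
  have cont\<gamma>: "continuous_map euclideanreal TX \<gamma>"
  proof (rule continuous_map_into_TX[OF \<gamma>X])
    fix y assume "y \<in> Y"
    show "continuous_map euclideanreal euclidean (\<lambda>v. E (\<gamma> v) y)"
      unfolding E\<gamma>[OF \<open>y \<in> Y\<close>] by (simp, intro continuous_intros)
  qed
  have \<gamma>_meas: "\<gamma> \<in> borel \<rightarrow>\<^sub>M borel_of TX" by (rule measurable_into_borel_of[OF cont\<gamma>])
  then have \<gamma>_meas': "\<gamma> \<in> std_normal_distribution \<rightarrow>\<^sub>M borel_of TX" by simp
  define \<nu> where "\<nu> = distr std_normal_distribution (borel_of TX) \<gamma>"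
  interpret R: real_distribution std_normal_distribution by (rule real_dist_normal_dist)
  have \<nu>: "solenoid_distribution a \<nu>"
  proof (intro solenoid_distribution.intro solenoid_distribution_axioms.intro adic_base_axioms)
    show "prob_space \<nu>" unfolding \<nu>_def by (rule R.prob_space_distr[OF \<gamma>_meas'])
    show "sets \<nu> = sets (borel_of TX)" by (simp add: \<nu>_def)
  qed
  have \<mu>: "solenoid_distribution a \<mu>" by unfold_locales
  have ft_eq: "(LINT x|\<mu>. E x y) = (LINT x|\<nu>. E x y)" if y: "y \<in> Y" for y
  proof -
    define w where "w = 2 * pi * (of_int d * fst y + h * of_int (snd y)) * b"
    have "(LINT x|\<nu>. E x y) = (LINT v|std_normal_distribution. E (\<gamma> v) y)"
      unfolding \<nu>_def by (rule integral_distr[OF \<gamma>_meas' E_measurable[OF y]])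
    also have "\<dots> = (LINT v|std_normal_distribution. iexp (w * v) * l y)"
      unfolding E\<gamma>[OF y] by (intro Bochner_Integration.integral_cong refl) (simp add: w_def cis_conv_exp mult_ac)
    also have "\<dots> = char std_normal_distribution w * l y" unfolding char_def by (rule integral_mult_left_zero)
    also have "\<dots> = l y * exp (- (w\<^sup>2 / 2))" by (simp add: char_std_normal_distribution)
    also have "w\<^sup>2 / 2 = s * (fst y + t * of_int (snd y))\<^sup>2"
    proof -
      have "b\<^sup>2 = s / 2 / (pi\<^sup>2 * (of_int d)\<^sup>2)" using s by (simp add: b_def power_divide power_mult_distrib)
      moreover define W where "W = of_int d * fst y + h * of_int (snd y)"
      have "w\<^sup>2 / 2 = 2 * pi\<^sup>2 * b\<^sup>2 * W\<^sup>2" unfolding w_def W_def[symmetric] by (simp add: power_mult_distrib)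
      ultimately show ?thesis unfolding lin W_def[symmetric] using dpos by (simp add: power_divide)
    qed
    finally show ?thesis using ft[OF y] by (simp add: ft_def)
  qed
  have "measure_support TX \<mu> = T.S #>\<^bsub>X\<^esub> x0"
  proof
    show "measure_support TX \<mu> \<subseteq> T.S #>\<^bsub>X\<^esub> x0"
    proof
      fix x assume "x \<in> measure_support TX \<mu>"
      then have x: "x \<in> carrier X" and supp: "\<And>U. openin TX U \<Longrightarrow> x \<in> U \<Longrightarrow> emeasure \<mu> U \<noteq> 0"
        unfolding measure_support_def topspace_TX by blast+
      \<comment> \<open>For \<open>y\<close> in the kernel the exponent vanishes, so the character
        is almost surely equal to \<open>l y\<close>. The points where it differs form an open null
        set, which the support avoids.\<close>
      have eq: "E x y = E x0 y" if y: "y \<in> Y" and ker: "of_int d * fst y + h * of_int (snd y) = 0" for y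
      proof (rule ccontr)
        assume ne: "E x y \<noteq> E x0 y"
        have fty: "ft y = l y" using ft[OF y] unfolding lin ker by simp
        then have "AE x in \<mu>. E x y = l y" using AE_E_constant[OF y] l(2)[OF y] by simp
        then have AE: "AE x in \<mu>. E x y = E x0 y" by (simp only: x0(2)[OF y])
        define U where "U = {x \<in> topspace TX. E x y \<in> - {E x0 y}}"
        have U: "openin TX U" unfolding U_def
          by (rule openin_continuous_map_preimage[OF continuous_E[OF y]]) (simp add: open_Compl)
        have Us: "U \<in> sets \<mu>" unfolding sets_mu by (rule openin_borel_of[OF U])
        have "AE x in \<mu>. x \<notin> U" by (rule AE_mp[OF AE AE_I2]) (simp add: U_def)
        then have "emeasure \<mu> U = 0" using Us by (subst (asm) AE_iff_measurable[of U]) (auto dest: sets.sets_into_space)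
        moreover have "x \<in> U" using x ne unfolding U_def topspace_TX by simp
        ultimately show False using supp[OF U] by blast
      qed
      define x1 where "x1 = x \<otimes>\<^bsub>X\<^esub> inv\<^bsub>X\<^esub> x0"
      have x1: "x1 \<in> carrier X" unfolding x1_def by (rule X.m_closed[OF x X.inv_closed[OF x0(1)]])
      have x1x0: "x = x1 \<otimes>\<^bsub>X\<^esub> x0"
        unfolding x1_def using X.m_assoc[OF x X.inv_closed[OF x0(1)] x0(1)] X.l_inv[OF x0(1)] X.r_one[OF x] by simp
      have "E x1 (r, n) = 1" if "r \<in> H" "of_int d * r + h * of_int n = 0" for r n
      proof -
        have y: "(r, n) \<in> Y" using that(1) by simp
        have "E x (r, n) = E x1 (r, n) * E x0 (r, n)" unfolding x1x0 by (rule E_mult[OF x1 x0(1) y])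
        moreover have "E x0 (r, n) \<noteq> 0" using norm_E[OF x0(1), of "(r, n)"] by auto
        ultimately show ?thesis using eq[OF y] that(2) by simp
      qed
      then have "x1 \<in> T.S" unfolding T.S_iff using x1 by blast
      then show "x \<in> T.S #>\<^bsub>X\<^esub> x0" unfolding r_coset_def x1x0 by blast
    qed
    have "T.S #>\<^bsub>X\<^esub> x0 \<subseteq> measure_support TX \<nu>"
    proof
      fix x assume "x \<in> T.S #>\<^bsub>X\<^esub> x0"
      then obtain s' where s': "s' \<in> carrier \<Sigma>" "x = T.\<tau> s' \<otimes>\<^bsub>X\<^esub> x0" unfolding r_coset_def by blast
      obtain u \<delta> where u\<delta>: "(u, \<delta>) \<in> carrier P" "s' = q (u, \<delta>)" using s'(1) unfolding \<Sigma>_carrier by auto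
      have x: "x \<in> carrier X" unfolding s'(2) by (rule X.m_closed[OF T.tau(1)[OF s'(1)] x0(1)])
      have "emeasure \<nu> U \<noteq> 0" if U: "openin TX U" "x \<in> U" for U
      proof -
        obtain F \<epsilon> where F: "finite F" "F \<subseteq> Y" "\<epsilon> > 0"
          and nbhd: "\<forall>x'\<in>carrier X. (\<forall>y\<in>F. cmod (E x' y - E x y) < \<epsilon>) \<longrightarrow> x' \<in> U"
          using TX_base[OF U] by (elim exE conjE) (rule that)
        have bpos: "b \<noteq> 0" using s d(1) by (simp add: b_def)
        let ?w = "\<lambda>y :: real \<times> int. of_int d * fst y + h * of_int (snd y)"
        have "?w ` F \<subseteq> H"
        proof (rule image_subsetI)
          fix y assume "y \<in> F"
          then have "fst y \<in> H" using F(2) by auto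
          then show "?w y \<in> H" by (rule T.lin_H)
        qed
        then obtain k where k: "\<forall>w\<in>?w ` F. \<exists>m. w = of_int m / of_int (A k)"
          using adic_rationals_common_denominator[OF finite_imageI[OF F(1)]] by blast
        \<comment> \<open>At level \<open>k\<close> a character sees \<open>(u, \<delta>)\<close>
          only through \<open>u - val k \<delta>\<close>. The point of the line with this real
          coordinate therefore agrees with \<open>x\<close> exactly at all characters in
          \<open>F\<close>.\<close>
        define v where "v = (u - of_int (val k \<delta>)) / b"
        have "E (\<gamma> v) y = E x y" if y: "y \<in> F" for y
        proof -
          have yY: "y \<in> Y" using y F(2) by blast
          then have r: "fst y \<in> H" by auto
          obtain m where "?w y = of_int m / of_int (A k)" using k y by blast
          then have level: "?w y * of_int (A k) \<in> \<int>" by simp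
          have "E x y = chi (?w y) s' * l y"
            unfolding s'(2) E_mult[OF T.tau(1)[OF s'(1)] x0(1) yY] x0(2)[OF yY]
            using T.tau(2)[OF s'(1) r, of "snd y"] by simp
          also have "chi (?w y) s' = cis (2 * pi * (?w y * (u - of_int (val k \<delta>))))"
            unfolding u\<delta>(2) chi_q[OF u\<delta>(1) T.lin_H[OF r]] pre_chi_at[OF level] by simp
          also have "u - of_int (val k \<delta>) = b * v" using bpos by (simp add: v_def)
          finally show ?thesis unfolding E\<gamma>[OF yY] by simp
        qed
        then have "\<gamma> v \<in> U" using nbhd \<gamma>X F(3) by simp
        have W: "open {v. \<gamma> v \<in> U}"
          using openin_continuous_map_preimage[OF cont\<gamma> U(1)] by simp
        have "emeasure \<nu> U = emeasure std_normal_distribution (\<gamma> -` U \<inter> space std_normal_distribution)"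
          unfolding \<nu>_def by (rule emeasure_distr[OF \<gamma>_meas' openin_borel_of[OF U(1)]])
        also have "\<gamma> -` U \<inter> space std_normal_distribution = {v. \<gamma> v \<in> U}" by auto
        finally show ?thesis using std_normal_open_pos[OF W] \<open>\<gamma> v \<in> U\<close> by auto
      qed
      then show "x \<in> measure_support TX \<nu>" using x unfolding measure_support_def topspace_TX by blast
    qed
    also have "\<dots> \<subseteq> measure_support TX \<mu>" by (rule measure_support_subset[OF \<mu> \<nu> ft_eq])
    finally show "T.S #>\<^bsub>X\<^esub> x0 \<subseteq> measure_support TX \<mu>" .
  qed
  then have "measure_support TX \<mu> \<in> rcosets\<^bsub>X\<^esub> T.S" unfolding RCOSETS_def using x0(1) by blast
  then show ?thesis using T.S_subgroup T.topological_iso_S by blast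
qed

section \<open>Independent linear statistics\<close>

context adic_base
begin

definition adjoint_data :: "((real \<times> (nat \<Rightarrow> int)) set \<times> complex \<Rightarrow> (real \<times> (nat \<Rightarrow> int)) set \<times> complex) \<Rightarrow>
    real \<Rightarrow> real \<Rightarrow> int \<Rightarrow> bool"
  where "adjoint_data \<alpha> p c e \<longleftrightarrow> p \<noteq> 0 \<and> (\<lambda>x. p * x) ` H = H \<and> c \<in> H \<and> (e = 1 \<or> e = - 1) \<and>
    (\<forall>x\<in>carrier X. \<forall>r\<in>H. \<forall>n. E (\<alpha> x) (r, n) = E x (p * r + c * of_int n, e * n))"

lemma expectation_prod_E:
  assumes M: "prob_space M" and indep: "prob_space.indep_vars M (\<lambda>_. borel_of TX) Z {1..3::nat}"
    and y: "\<And>i. i \<in> {1..3} \<Longrightarrow> y i \<in> Y"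
  shows "(LINT \<omega>|M. (\<Prod>i\<in>{1..3}. E (Z i \<omega>) (y i))) = (\<Prod>i\<in>{1..3}. (LINT \<omega>|M. E (Z i \<omega>) (y i)))"
proof -
  interpret prob_space M by (rule M)
  have rv: "Z i \<in> M \<rightarrow>\<^sub>M borel_of TX" if "i \<in> {1..3}" for i
    using indep that unfolding indep_vars_def by blast
  have "indep_vars (\<lambda>_. borel) (\<lambda>i \<omega>. E (Z i \<omega>) (y i)) {1..3}"
    by (rule indep_vars_compose2[OF indep, where Y = "\<lambda>i x. E x (y i)"]) (rule E_measurable[OF y])
  moreover have "integrable M (\<lambda>\<omega>. E (Z i \<omega>) (y i))" if i: "i \<in> {1..3}" for i
  proof (rule unimodular_integrable)
    show "(\<lambda>\<omega>. E (Z i \<omega>) (y i)) \<in> borel_measurable M"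
      by (rule measurable_compose[OF rv[OF i] E_measurable[OF y[OF i]]])
    show "cmod (E (Z i \<omega>) (y i)) = 1" if "\<omega> \<in> space M" for \<omega>
      using measurable_space[OF rv[OF i] that] unfolding space_borel_of topspace_TX by (rule norm_E)
  qed
  ultimately show ?thesis by (intro indep_vars_lebesgue_integral) auto
qed

text \<open>The expectation of the product of the \<open>E (L i \<omega>) (u i)\<close> is computed
  twice. Collecting the factors by \<open>\<xi> j\<close> gives the left side of the functional
  equation; independence of the \<open>L i\<close>, followed by that of the \<open>\<xi> j\<close>
  within each of them, gives the right side.\<close>

lemma independent_linear_statistics:
  fixes M :: "'w measure" and \<xi> :: "nat \<Rightarrow> 'w \<Rightarrow> (real \<times> (nat \<Rightarrow> int)) set \<times> complex"
    and \<mu> :: "nat \<Rightarrow> ((real \<times> (nat \<Rightarrow> int)) set \<times> complex) measure"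
    and \<alpha> :: "nat \<Rightarrow> nat \<Rightarrow> (real \<times> (nat \<Rightarrow> int)) set \<times> complex \<Rightarrow> (real \<times> (nat \<Rightarrow> int)) set \<times> complex"
  assumes aut: "\<And>i j. i \<in> {1..3} \<Longrightarrow> j \<in> {1..3} \<Longrightarrow> \<alpha> i j \<in> topological_aut X TX"
    and prob: "prob_space M"
    and indep_xi: "prob_space.indep_vars M (\<lambda>_. borel_of TX) \<xi> {1..3}"
    and distributions: "\<And>j. j \<in> {1..3} \<Longrightarrow> \<mu> j = distr M (borel_of TX) (\<xi> j)"
    and nonvanishing: "\<And>j y. j \<in> {1..3} \<Longrightarrow> y \<in> carrier CG \<Longrightarrow> char_function (\<mu> j) y \<noteq> 0"
    and indep_L: "prob_space.indep_vars M (\<lambda>_. borel_of TX)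
      (\<lambda>i \<omega>. \<alpha> i 1 (\<xi> 1 \<omega>) \<otimes>\<^bsub>X\<^esub> \<alpha> i 2 (\<xi> 2 \<omega>) \<otimes>\<^bsub>X\<^esub> \<alpha> i 3 (\<xi> 3 \<omega>)) {1..3}"
    and j: "j \<in> {1..3}"
  shows "degenerate_distribution TX (\<mu> j) \<or> gaussian_distribution X TX (\<mu> j) \<and>
    (\<exists>G. subgroup G X \<and> topological_iso (X\<lparr>carrier := G\<rparr>) (subtopology TX G) \<Sigma> TS \<noteq> {} \<and>
      measure_support TX (\<mu> j) \<in> rcosets\<^bsub>X\<^esub> G)"
proof -
  interpret M: prob_space M by (rule prob)
  have "\<exists>p c e. i \<in> {1..3} \<longrightarrow> j \<in> {1..3} \<longrightarrow> adjoint_data (\<alpha> i j) p c e" for i j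
    using automorphism_adjoint[OF aut, of i j] unfolding adjoint_data_def by blast
  then obtain p c e where adj: "\<And>i j. i \<in> {1..3} \<Longrightarrow> j \<in> {1..3} \<Longrightarrow> adjoint_data (\<alpha> i j) (p i j) (c i j) (e i j)"
    by metis
  have rv: "\<xi> j \<in> M \<rightarrow>\<^sub>M borel_of TX" if "j \<in> {1..3}" for j
    using indep_xi that unfolding M.indep_vars_def by blast
  have xiX: "\<xi> j \<omega> \<in> carrier X" if "j \<in> {1..3}" "\<omega> \<in> space M" for j \<omega>
    using measurable_space[OF rv[OF that(1)] that(2)] unfolding space_borel_of topspace_TX .
  have sd: "solenoid_distribution a (\<mu> j)" if "j \<in> {1..3}" for j
  proof (intro solenoid_distribution.intro solenoid_distribution_axioms.intro adic_base_axioms)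
    show "prob_space (\<mu> j)" unfolding distributions[OF that] by (rule M.prob_space_distr[OF rv[OF that]])
    show "sets (\<mu> j) = sets (borel_of TX)" by (simp add: distributions[OF that])
  qed
  define f where "f j y = (LINT x|\<mu> j. E x y)" for j :: nat and y
  have f_ft: "solenoid_distribution.ft a (\<mu> j) = f j" if "j \<in> {1..3}" for j
    unfolding solenoid_distribution.ft_def[OF sd[OF that], abs_def] f_def[abs_def] ..
  have f_eq: "f j y = (LINT \<omega>|M. E (\<xi> j \<omega>) y)" if "j \<in> {1..3}" "y \<in> Y" for j y
    unfolding f_def distributions[OF that(1)] by (rule integral_distr[OF rv[OF that(1)] E_measurable[OF that(2)]])
  have char: "char_like (f j)" if j: "j \<in> {1..3}" for j
  proof -
    interpret D: solenoid_distribution a "\<mu> j" by (rule sd[OF j])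
    have "D.ft y \<noteq> 0" if "y \<in> Y" for y
      using nonvanishing[OF j, of "evaluation y"] that unfolding CG_carrier D.char_function_evaluation by blast
    then show ?thesis using D.char_like_ft f_ft[OF j] by simp
  qed
  interpret LF: linear_forms a p c e f
    by unfold_locales (use adj char in \<open>simp_all add: adjoint_data_def\<close>)
  have E_act: "E (\<alpha> i j x) u = E x (LF.act i j u)" if "i \<in> {1..3}" "j \<in> {1..3}" "x \<in> carrier X" "u \<in> Y" for i j x u
    using adj[OF that(1,2)] that(3,4) unfolding adjoint_data_def LF.act_def by (cases u) auto
  have \<alpha>X: "\<alpha> i j x \<in> carrier X" if "i \<in> {1..3}" "j \<in> {1..3}" "x \<in> carrier X" for i j x
    using aut[OF that(1,2)] that(3) hom_in_carrier[of "\<alpha> i j" X X x] by (auto simp: topological_iso_def iso_def)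
  define L where "L i \<omega> = \<alpha> i 1 (\<xi> 1 \<omega>) \<otimes>\<^bsub>X\<^esub> \<alpha> i 2 (\<xi> 2 \<omega>) \<otimes>\<^bsub>X\<^esub> \<alpha> i 3 (\<xi> 3 \<omega>)" for i \<omega>
  have m: "1 \<in> {1..3::nat}" "2 \<in> {1..3::nat}" "3 \<in> {1..3::nat}" by auto
  have E_L: "E (L i \<omega>) u = (\<Prod>j\<in>{1..3}. E (\<xi> j \<omega>) (LF.act i j u))"
    if i: "i \<in> {1..3}" and \<omega>: "\<omega> \<in> space M" and u: "u \<in> Y" for i \<omega> u
  proof -
    have a: "\<alpha> i j (\<xi> j \<omega>) \<in> carrier X" if "j \<in> {1..3}" for j by (rule \<alpha>X[OF i that xiX[OF that \<omega>]])
    show ?thesis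
      unfolding L_def E_mult[OF X.m_closed[OF a[OF m(1)] a[OF m(2)]] a[OF m(3)] u] E_mult[OF a[OF m(1)] a[OF m(2)] u]
        E_act[OF i m(1) xiX[OF m(1) \<omega>] u] E_act[OF i m(2) xiX[OF m(2) \<omega>] u] E_act[OF i m(3) xiX[OF m(3) \<omega>] u]
        prod_1_3 ..
  qed
  have E_sum: "E x (\<Sum>i\<in>{1..3}. w i) = (\<Prod>i\<in>{1..3}. E x (w i))"
    if "x \<in> carrier X" "\<And>i. i \<in> {1..3} \<Longrightarrow> w i \<in> Y" for x and w :: "nat \<Rightarrow> real \<times> int"
    unfolding sum_1_3 prod_1_3 using that(2)[OF m(1)] that(2)[OF m(2)] that(2)[OF m(3)]
    by (simp only: E_add[OF that(1)] Y_add)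
  interpret IF: independent_linear_forms a p c e f
  proof
    fix u :: "nat \<Rightarrow> real \<times> int" assume u: "\<And>i. i \<in> {1..3} \<Longrightarrow> u i \<in> Y"
    have S: "(\<Sum>i\<in>{1..3}. LF.act i j (u i)) \<in> Y" if "j \<in> {1..3}" for j
      unfolding sum_1_3 by (intro Y_add LF.act_Y m that u)
    have "(\<Prod>j\<in>{1..3}. f j (\<Sum>i\<in>{1..3}. LF.act i j (u i))) =
        (\<Prod>j\<in>{1..3}. (LINT \<omega>|M. E (\<xi> j \<omega>) (\<Sum>i\<in>{1..3}. LF.act i j (u i))))"
      by (intro prod.cong refl f_eq S)
    also have "\<dots> = (LINT \<omega>|M. (\<Prod>j\<in>{1..3}. E (\<xi> j \<omega>) (\<Sum>i\<in>{1..3}. LF.act i j (u i))))"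
      by (rule expectation_prod_E[OF prob indep_xi S, symmetric])
    also have "\<dots> = (LINT \<omega>|M. (\<Prod>i\<in>{1..3}. E (L i \<omega>) (u i)))"
    proof (rule Bochner_Integration.integral_cong[OF refl])
      fix \<omega> assume \<omega>: "\<omega> \<in> space M"
      have "(\<Prod>j\<in>{1..3}. E (\<xi> j \<omega>) (\<Sum>i\<in>{1..3}. LF.act i j (u i))) =
          (\<Prod>j\<in>{1..3}. \<Prod>i\<in>{1..3}. E (\<xi> j \<omega>) (LF.act i j (u i)))"
        by (intro prod.cong refl E_sum xiX \<omega> LF.act_Y u)
      also have "\<dots> = (\<Prod>i\<in>{1..3}. \<Prod>j\<in>{1..3}. E (\<xi> j \<omega>) (LF.act i j (u i)))" by (rule prod.swap)
      also have "\<dots> = (\<Prod>i\<in>{1..3}. E (L i \<omega>) (u i))"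
        by (intro prod.cong refl E_L[symmetric] \<omega> u)
      finally show "(\<Prod>j\<in>{1..3}. E (\<xi> j \<omega>) (\<Sum>i\<in>{1..3}. LF.act i j (u i))) = (\<Prod>i\<in>{1..3}. E (L i \<omega>) (u i))" .
    qed
    also have "\<dots> = (\<Prod>i\<in>{1..3}. (LINT \<omega>|M. E (L i \<omega>) (u i)))"
      by (rule expectation_prod_E[OF prob _ u]) (use indep_L in \<open>simp only: L_def[abs_def]\<close>)
    also have "\<dots> = (\<Prod>i\<in>{1..3}. \<Prod>j\<in>{1..3}. f j (LF.act i j (u i)))"
    proof (rule prod.cong[OF refl])
      fix i assume i: "i \<in> {1..3::nat}"
      have Yi: "LF.act i j (u i) \<in> Y" if "j \<in> {1..3}" for j by (rule LF.act_Y[OF i that u[OF i]])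
      have "(LINT \<omega>|M. E (L i \<omega>) (u i)) = (LINT \<omega>|M. (\<Prod>j\<in>{1..3}. E (\<xi> j \<omega>) (LF.act i j (u i))))"
        by (intro Bochner_Integration.integral_cong refl E_L i u)
      also have "\<dots> = (\<Prod>j\<in>{1..3}. (LINT \<omega>|M. E (\<xi> j \<omega>) (LF.act i j (u i))))"
        by (rule expectation_prod_E[OF prob indep_xi Yi])
      also have "\<dots> = (\<Prod>j\<in>{1..3}. f j (LF.act i j (u i)))" by (intro prod.cong refl f_eq[symmetric] Yi)
      finally show "(LINT \<omega>|M. E (L i \<omega>) (u i)) = (\<Prod>j\<in>{1..3}. f j (LF.act i j (u i)))" .
    qed
    finally show "(\<Prod>j\<in>{1..3}. f j (\<Sum>i\<in>{1..3}. LF.act i j (u i))) = (\<Prod>i\<in>{1..3}. \<Prod>j\<in>{1..3}. f j (LF.act i j (u i)))" .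
  qed
  interpret D: solenoid_distribution a "\<mu> j" by (rule sd[OF j])
  from IF.unimodular_or_rational_gaussian_like[OF j] show ?thesis
  proof (elim disjE bexE exE conjE)
    assume "\<forall>y\<in>Y. cmod (f j y) = 1"
    then have "cmod (D.ft y) = 1" if "y \<in> Y" for y unfolding f_ft[OF j] using that by (rule bspec)
    then show ?thesis by (intro disjI1 D.degenerate_of_unimodular)
  next
    fix s t l assume "s > 0" "t \<in> \<rat>" "gaussian_like (f j) s t l"
    then have "gaussian_like D.ft s t l" by (simp only: f_ft[OF j])
    then show ?thesis
      by (intro disjI2 conjI D.gaussian_of_gaussian_like[of s t l] D.gaussian_like_support[of s t l])
        (use \<open>s > 0\<close> \<open>t \<in> \<rat>\<close> in simp_all)
  qed
qed

end

theorem theorem2: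
  fixes a :: "nat \<Rightarrow> int"
    and X :: "((real \<times> (nat \<Rightarrow> int)) set \<times> complex) monoid"
    and TX :: "((real \<times> (nat \<Rightarrow> int)) set \<times> complex) topology"
    and M :: "'w measure"
    and \<alpha> :: "nat \<Rightarrow> nat \<Rightarrow> (real \<times> (nat \<Rightarrow> int)) set \<times> complex \<Rightarrow> (real \<times> (nat \<Rightarrow> int)) set \<times> complex"
    and \<xi> :: "nat \<Rightarrow> 'w \<Rightarrow> (real \<times> (nat \<Rightarrow> int)) set \<times> complex"
    and \<mu> :: "nat \<Rightarrow> ((real \<times> (nat \<Rightarrow> int)) set \<times> complex) measure"
  assumes a_gt_1: "\<And>n. a n > 1"
    and X_def: "X = solenoid_group a \<times>\<times> circle_group"
    and TX_def: "TX = prod_topology (solenoid_topology a) circle_topology"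
    and aut: "\<And>i j. i \<in> {1..3} \<Longrightarrow> j \<in> {1..3} \<Longrightarrow> \<alpha> i j \<in> topological_aut X TX"
    and prob: "prob_space M"
    and indep_xi: "prob_space.indep_vars M (\<lambda>_. borel_of TX) \<xi> {1..3}"
    and distributions: "\<And>j. j \<in> {1..3} \<Longrightarrow> \<mu> j = distr M (borel_of TX) (\<xi> j)"
    and nonvanishing: "\<And>j y. j \<in> {1..3} \<Longrightarrow> y \<in> carrier (character_group X TX) \<Longrightarrow>
      char_function (\<mu> j) y \<noteq> 0"
    and indep_L: "prob_space.indep_vars M (\<lambda>_. borel_of TX)
      (\<lambda>i \<omega>. \<alpha> i 1 (\<xi> 1 \<omega>) \<otimes>\<^bsub>X\<^esub> \<alpha> i 2 (\<xi> 2 \<omega>) \<otimes>\<^bsub>X\<^esub> \<alpha> i 3 (\<xi> 3 \<omega>)) {1..3}"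
  shows "\<forall>j\<in>{1..3}.
    degenerate_distribution TX (\<mu> j) \<or>
    gaussian_distribution X TX (\<mu> j) \<and>
    (\<exists>H. subgroup H X \<and>
      topological_iso (X\<lparr>carrier := H\<rparr>) (subtopology TX H) (solenoid_group a) (solenoid_topology a) \<noteq> {} \<and>
      measure_support TX (\<mu> j) \<in> rcosets\<^bsub>X\<^esub> H)"
proof
  fix j assume j: "j \<in> {1..3::nat}"
  interpret adic_base a by unfold_locales (rule a_gt_1)
  show "degenerate_distribution TX (\<mu> j) \<or> gaussian_distribution X TX (\<mu> j) \<and>
    (\<exists>H. subgroup H X \<and>
      topological_iso (X\<lparr>carrier := H\<rparr>) (subtopology TX H) (solenoid_group a) (solenoid_topology a) \<noteq> {} \<and>
      measure_support TX (\<mu> j) \<in> rcosets\<^bsub>X\<^esub> H)"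
    unfolding X_def TX_def
    by (rule independent_linear_statistics[OF aut[unfolded X_def TX_def] prob indep_xi[unfolded TX_def]
          distributions[unfolded TX_def] nonvanishing[unfolded X_def TX_def] indep_L[unfolded X_def TX_def] j])
qed

end
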